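(* As $n\to\infty$, $$\sup_{x\in\mathbb R}\left|\nu_{n,1}\left\{\frac{\log O_n(\alpha)-\mathbf M\log O_n(\alpha)}{(1/\sqrt3)\log^{3/2}n}<x\right\}-\Phi(x)-\frac{3^{3/2}}{24\sqrt{2\pi}}\frac{(1-x^2)e^{-x^2/2}}{\sqrt{\log n}}\right|\ll\left(\frac{\log\log n}{\log n}\right)^{2/3}.$$
   Context: $\nu_{n,1}$ is the uniform probability measure on the symmetric group $S_n$ and $\mathbf M$ the corresponding expectation. For $\sigma\in S_n$, $\alpha_j(\sigma)$ is the number of cycles of length $j$ in its disjoint cycle decomposition and $\alpha=(\alpha_1(\sigma),\dots,\alpha_n(\sigma))$. For a vector $a=(a_1,\dots,a_n)$ of nonnegative integers, $O_n(a)=\mathrm{lcm}\{i:1\leqslant i\leqslant n,\ a_i>0\}$; thus $O_n(\alpha(\sigma))$ is the order of $\sigma$. $\Phi$ is the standard normal distribution function. *)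

theory Defs
  imports
    "HOL-Probability.Probability"
    "HOL-Combinatorics.Orbits"
    "HOL-Library.Landau_Symbols"
begin

text \<open>The symmetric group on \<open>{1..n}\<close>, with its uniform probability measure.\<close>

definition unif_perm :: "nat \<Rightarrow> (nat \<Rightarrow> nat) pmf" where
  "unif_perm n = pmf_of_set {\<sigma>. \<sigma> permutes {1..n}}"

text \<open>
  A cycle is identified with its underlying set, fixed points being cycles of length 1.
  A permutation of \<open>{1..n}\<close> fixes every natural number outside \<open>{1..n}\<close>, so the restriction
  to subsets of \<open>{1..n}\<close> is essential for \<open>j = 1\<close>.
\<close>

definition cycle_count :: "nat \<Rightarrow> (nat \<Rightarrow> nat) \<Rightarrow> nat \<Rightarrow> nat" where
  "cycle_count n \<sigma> j = card {C. C \<subseteq> {1..n} \<and> cyclic_on \<sigma> C \<and> card C = j}"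

text \<open>Vectors \<open>(a 1, \<dots>, a n)\<close> are functions of which only the values on \<open>{1..n}\<close> are used.\<close>

definition order_of_vec :: "nat \<Rightarrow> (nat \<Rightarrow> nat) \<Rightarrow> nat" where
  "order_of_vec n a = Lcm {i. 1 \<le> i \<and> i \<le> n \<and> a i > 0}"

abbreviation log_order :: "nat \<Rightarrow> (nat \<Rightarrow> nat) \<Rightarrow> real" where
  "log_order n \<sigma> \<equiv> ln (real (order_of_vec n (cycle_count n \<sigma>)))"

abbreviation std_normal_cdf :: "real \<Rightarrow> real" where
  "std_normal_cdf \<equiv> cdf std_normal_distribution"

text \<open>
  The supremum of a set of reals is only meaningful if the set is bounded above, which this lemma
  provides for the deviation from a one-term Edgeworth approximation.
\<close>

lemma bdd_above_edgeworth_deviation: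
  fixes c d :: real
  shows "bdd_above (range (\<lambda>x::real. \<bar>measure_pmf.prob p (A x) - std_normal_cdf x
           - c * ((1 - x\<^sup>2) * exp (- x\<^sup>2 / 2) / d)\<bar>))"
proof -
  have g: "\<bar>(1 - x\<^sup>2) * exp (- x\<^sup>2 / 2)\<bar> \<le> 2" for x :: real
  proof -
    have "1 + x\<^sup>2 / 2 \<le> exp (x\<^sup>2 / 2)"
      by (rule exp_ge_add_one_self)
    hence "\<bar>1 - x\<^sup>2\<bar> \<le> 2 * exp (x\<^sup>2 / 2)"
      using zero_le_power2[of x] by linarith
    thus ?thesis
      by (simp add: abs_mult exp_minus field_simps)
  qed
  interpret real_distribution std_normal_distribution
    by (rule real_dist_normal_dist)
  show ?thesis
  proof (rule bdd_aboveI2)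
    fix x :: real
    have a: "0 \<le> measure_pmf.prob p (A x)" "measure_pmf.prob p (A x) \<le> 1"
      by auto
    have b: "0 \<le> std_normal_cdf x" "std_normal_cdf x \<le> 1"
      by (auto simp: cdf_nonneg cdf_bounded_prob)
    have "\<bar>c * ((1 - x\<^sup>2) * exp (- x\<^sup>2 / 2) / d)\<bar> = \<bar>c / d\<bar> * \<bar>(1 - x\<^sup>2) * exp (- x\<^sup>2 / 2)\<bar>"
      by (simp add: abs_mult)
    also have "\<dots> \<le> \<bar>c / d\<bar> * 2"
      by (intro mult_left_mono g) auto
    finally have h: "\<bar>c * ((1 - x\<^sup>2) * exp (- x\<^sup>2 / 2) / d)\<bar> \<le> \<bar>c / d\<bar> * 2" .
    have "\<bar>u - v - w\<bar> \<le> 1 + r"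
      if "0 \<le> u" "u \<le> 1" "0 \<le> v" "v \<le> 1" "\<bar>w\<bar> \<le> r" for u v w r :: real
      using that by linarith
    from this[OF a b h] show "\<bar>measure_pmf.prob p (A x) - std_normal_cdf x
        - c * ((1 - x\<^sup>2) * exp (- x\<^sup>2 / 2) / d)\<bar> \<le> 1 + \<bar>c / d\<bar> * 2" .
  qed
qed

end

theory Submission
  imports Defs "HOL-Computational_Algebra.Formal_Power_Series" "HOL-Number_Theory.Prime_Powers"
    "HOL-Real_Asymp.Real_Asymp"
begin

text \<open>
  Average over \<open>S\<^sub>n\<close> and remove the cycle through a fixed point: its length is uniform on
  \<open>{1..n}\<close> and the rest is a uniform permutation. For the characteristic function
  \<open>h\<^sub>n(t)\<close> of \<open>log P\<^sub>n = \<Sum> \<alpha>\<^sub>j log j\<close> this says \<open>n h\<^sub>n = \<Sum>\<^sub>j j\<^bsup>it\<^esup> h\<^sub>n\<^sub>-\<^sub>j\<close>. Differencing in \<open>n\<close> gives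
  \<open>n (h\<^sub>n - h\<^sub>n\<^sub>-\<^sub>1) = (n\<^bsup>it\<^esup> - 1) h\<^sub>n\<^sub>-\<^sub>1 + O(t\<^sup>2 log n)\<close>, so \<open>h\<^sub>n\<close> stays close to the
  characteristic function of \<open>\<Sum> Z\<^sub>j log j\<close> with independent Poisson variables \<open>Z\<^sub>j\<close> of mean \<open>1/j\<close>;
  keeping a decaying majorant in the error term makes this usable on the whole range needed. The
  Poisson sum has skewness \<open>3\<^bsup>3/2\<^esup> / (4 \<surd>log n)\<close>, whence the Edgeworth term, and Gaussian smoothing
  turns the estimate of characteristic functions into one of distribution functions, with error
  \<open>o((loglog n / log n)\<^bsup>2/3\<^esup>)\<close>.

  The defect \<open>log P\<^sub>n - log O\<^sub>n\<close> is \<open>\<Sum>\<^sub>q \<Lambda>(q) (D\<^sub>q - 1)\<^sup>+\<close>, where \<open>D\<^sub>q\<close> counts the cycles of length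
  divisible by \<open>q\<close>. The prime powers \<open>q > log\<^sup>3 n\<close> contribute \<open>O(1)\<close> in mean, and the others have
  variance \<open>O(log n (loglog n)\<^sup>2)\<close>. Chebyshev's inequality at the scale
  \<open>(loglog n / log n)\<^bsup>2/3\<^esup> log\<^bsup>3/2\<^esup> n\<close> gives the rate.
\<close>

section \<open>Cycle statistics of a uniform random permutation\<close>

text \<open>The recurrence for \<open>h_n\<close> averages with weights of modulus 1; only its
  difference, with weights of size |t|/j, can be iterated with a small error. Write L = log n, sigma
  = L^{3/2}/sqrt 3 and s = t sigma. The accumulated error is of size t^2 L^2 = 3 s^2/L and has to be
  integrated against ds/s far beyond |s| = sqrt L, so an error bound without decay would be useless.
  The smoothing kernel has width L^{-3/4} and the estimates run up to |s| = L^{4/5}. Both exponents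
  lie between 2/3, the exponent of the rate, and 5/6, beyond which the growth exp(c s^2/L) of the
  majorant is no longer beaten by its decay exp(-c L^{3/2}/|s|). The defect has mean of order L log
  L, which exceeds eta sigma for eta = (log L/L)^{2/3}; so it cannot be discarded, and only its
  fluctuation is bounded. A variance of order L (log L)^2 makes Chebyshev's bound at eta sigma equal
  to (log L/L)^2/eta^2 up to a constant, and this is eta. Smoothing costs less, so the rate comes
  from this balance alone.\<close>

definition cycles_in :: "'a set \<Rightarrow> ('a \<Rightarrow> 'a) \<Rightarrow> nat \<Rightarrow> nat" where
  "cycles_in S \<sigma> j = card {C. C \<subseteq> S \<and> cyclic_on \<sigma> C \<and> card C = j}"

lemma cycle_count_eq_cycles_in: "cycle_count n \<sigma> = cycles_in {1..n} \<sigma>"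
  by (simp add: fun_eq_iff cycle_count_def cycles_in_def)

definition add_cycle :: "nat \<Rightarrow> (nat \<Rightarrow> nat) \<Rightarrow> nat \<Rightarrow> nat" where
  "add_cycle j a = a(j := Suc (a j))"

lemma cyclic_on_conjugate:
  assumes h: "bij_betw h S T" and \<sigma>: "\<And>x. x \<in> S \<Longrightarrow> \<sigma> x \<in> S"
    and \<tau>: "\<And>x. x \<in> S \<Longrightarrow> \<tau> (h x) = h (\<sigma> x)" and C: "C \<subseteq> S"
  shows "cyclic_on \<tau> (h ` C) \<longleftrightarrow> cyclic_on \<sigma> C"
proof
  assume "cyclic_on \<sigma> C"
  thus "cyclic_on \<tau> (h ` C)"
    by (rule cyclic_on_image) (use C \<tau> in auto)
next
  assume *: "cyclic_on \<tau> (h ` C)"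
  have inv: "inv_into S h (h x) = x" if "x \<in> S" for x
    using h that by (simp add: bij_betw_def)
  have "cyclic_on \<sigma> (inv_into S h ` (h ` C))"
  proof (rule cyclic_on_image[OF *])
    fix y assume "y \<in> h ` C"
    then obtain x where "x \<in> C" "y = h x" by auto
    moreover from this have "x \<in> S" using C by auto
    ultimately show "\<sigma> (inv_into S h y) = inv_into S h (\<tau> y)"
      using \<sigma> \<tau> inv by simp
  qed
  also have "inv_into S h ` (h ` C) = C"
    using C inv by (force simp: image_iff subset_iff)
  finally show "cyclic_on \<sigma> C" .
qed

lemma cycles_in_conjugate:
  assumes h: "bij_betw h S T" and \<sigma>: "\<And>x. x \<in> S \<Longrightarrow> \<sigma> x \<in> S"
    and \<tau>: "\<And>x. x \<in> S \<Longrightarrow> \<tau> (h x) = h (\<sigma> x)"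
  shows "cycles_in T \<tau> = cycles_in S \<sigma>"
proof
  fix j
  have inj: "inj_on h S" and T: "T = h ` S" using h by (auto simp: bij_betw_def)
  have cyc: "cyclic_on \<tau> (h ` C) \<longleftrightarrow> cyclic_on \<sigma> C" if "C \<subseteq> S" for C
    by (rule cyclic_on_conjugate[OF h _ _ that]) (use \<sigma> \<tau> in auto)
  have "{C. C \<subseteq> T \<and> cyclic_on \<tau> C \<and> card C = j}
      = (`) h ` {C. C \<subseteq> S \<and> cyclic_on \<sigma> C \<and> card C = j}"
  proof (intro set_eqI iffI)
    fix D assume D: "D \<in> {C. C \<subseteq> T \<and> cyclic_on \<tau> C \<and> card C = j}"
    then obtain C where C: "C \<subseteq> S" "D = h ` C" unfolding T by (auto simp: subset_image_iff)
    moreover have "card D = card C"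
      using C inj by (simp add: card_image inj_on_subset)
    ultimately show "D \<in> (`) h ` {C. C \<subseteq> S \<and> cyclic_on \<sigma> C \<and> card C = j}"
      using D cyc[of C] by auto
  next
    fix D assume "D \<in> (`) h ` {C. C \<subseteq> S \<and> cyclic_on \<sigma> C \<and> card C = j}"
    then obtain C where C: "C \<subseteq> S" "cyclic_on \<sigma> C" "card C = j" "D = h ` C" by auto
    moreover have "card D = card C"
      using C inj by (simp add: card_image inj_on_subset)
    ultimately show "D \<in> {C. C \<subseteq> T \<and> cyclic_on \<tau> C \<and> card C = j}"
      using cyc[of C] unfolding T by auto
  qed
  moreover have "inj_on ((`) h) {C. C \<subseteq> S \<and> cyclic_on \<sigma> C \<and> card C = j}"
    by (rule inj_on_subset[OF inj_on_image_Pow[OF inj]]) auto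
  ultimately show "cycles_in T \<tau> j = cycles_in S \<sigma> j"
    unfolding cycles_in_def by (simp add: card_image)
qed

text \<open>Generic in the ground set, because removing a cycle leaves an arbitrary subset, and in
  the values, which are natural numbers when permutations are counted, real for moments and complex
  for characteristic functions.\<close>

definition cycle_sum :: "'a set \<Rightarrow> ((nat \<Rightarrow> nat) \<Rightarrow> 'b::comm_monoid_add) \<Rightarrow> 'b" where
  "cycle_sum S F = (\<Sum>\<sigma> | \<sigma> permutes S. F (cycles_in S \<sigma>))"

lemma sum_permutes_conjugate:
  assumes h: "bij_betw h S T"
  shows "(\<Sum>\<sigma> | \<sigma> permutes S. G (\<lambda>x. if x \<in> T then h (\<sigma> (inv_into S h x)) else x))
       = (\<Sum>\<tau> | \<tau> permutes T. G \<tau>)"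
  by (rule sum.reindex_bij_betw[OF bij_betw_permutations[OF h]])

lemma cycle_sum_bij:
  assumes h: "bij_betw h S T"
  shows "cycle_sum S F = cycle_sum T F"
proof -
  have "cycle_sum T F = (\<Sum>\<sigma> | \<sigma> permutes S. F (cycles_in T (\<lambda>x. if x \<in> T then h (\<sigma> (inv_into S h x)) else x)))"
    unfolding cycle_sum_def by (rule sum_permutes_conjugate[OF h, symmetric])
  also have "\<dots> = cycle_sum S F" unfolding cycle_sum_def
  proof (rule sum.cong[OF refl], rule arg_cong[where f = F], rule cycles_in_conjugate[OF h])
    fix \<sigma> x assume "\<sigma> \<in> {\<sigma>. \<sigma> permutes S}" "x \<in> S"
    thus "\<sigma> x \<in> S" by (simp add: permutes_in_image)
    show "(if h x \<in> T then h (\<sigma> (inv_into S h (h x))) else h x) = h (\<sigma> x)"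
      using h \<open>x \<in> S\<close> by (auto simp: bij_betw_def)
  qed
  finally show ?thesis ..
qed

lemma cycle_sum_card:
  assumes "finite S"
  shows "cycle_sum S F = cycle_sum {1..card S} F"
  using assms ex_bij_betw_nat_finite_1[OF assms] cycle_sum_bij by metis

section \<open>Removing the cycle through a point\<close>

definition cyclic_perms :: "'a set \<Rightarrow> ('a \<Rightarrow> 'a) set" where
  "cyclic_perms C = {\<rho>. \<rho> permutes C \<and> cyclic_on \<rho> C}"

lemma cyclic_on_unique:
  assumes "cyclic_on f C" "cyclic_on f D" "x \<in> C" "x \<in> D"
  shows "C = D"
  using assms by (metis orbit_cyclic_eq3)

lemma cyclic_on_nonempty: "cyclic_on f C \<Longrightarrow> C \<noteq> {}"
  by (auto simp: cyclic_on_def)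

text \<open>\<open>C\<close> is one cycle of the composite, and cycles that meet coincide. Every
  other cycle therefore lies in \<open>S - C\<close>, where the composite agrees with
  \<open>\<tau>\<close>; so exactly one cycle, of length \<open>card C\<close>, is added.\<close>

lemma cycles_in_compose:
  assumes fin: "finite S" and C: "C \<subseteq> S" and \<rho>: "\<rho> \<in> cyclic_perms C" and \<tau>: "\<tau> permutes S - C"
  shows "cycles_in S (\<rho> \<circ> \<tau>) = add_cycle (card C) (cycles_in (S - C) \<tau>)"
proof
  fix j
  let ?\<sigma> = "\<rho> \<circ> \<tau>"
  have eqC: "?\<sigma> x = \<rho> x" if "x \<in> C" for x
    using \<tau> that by (auto simp: permutes_def)
  have eqD: "?\<sigma> x = \<tau> x" if "x \<in> S - C" for x
  proof -
    have "\<tau> x \<in> S - C" using permutes_in_image[OF \<tau>, of x] that by blast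
    thus ?thesis using \<rho> by (auto simp: permutes_def cyclic_perms_def)
  qed
  have cC: "cyclic_on ?\<sigma> C"
    using \<rho> cyclic_cong[of C ?\<sigma> \<rho>] eqC by (auto simp: cyclic_perms_def)
  have cD: "cyclic_on ?\<sigma> D \<longleftrightarrow> cyclic_on \<tau> D" if "D \<subseteq> S - C" for D
    using cyclic_cong[of D ?\<sigma> \<tau>] eqD that by blast
  have split: "D = C \<or> D \<subseteq> S - C" if "cyclic_on ?\<sigma> D" "D \<subseteq> S" for D
    using cyclic_on_unique[OF cC that(1)] that(2) by blast
  let ?A = "{D. D \<subseteq> S - C \<and> cyclic_on \<tau> D \<and> card D = j}"
  have "{D. D \<subseteq> S \<and> cyclic_on ?\<sigma> D \<and> card D = j} = (if j = card C then insert C ?A else ?A)"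
  proof (intro set_eqI iffI)
    fix D assume "D \<in> {D. D \<subseteq> S \<and> cyclic_on ?\<sigma> D \<and> card D = j}"
    thus "D \<in> (if j = card C then insert C ?A else ?A)"
      using split[of D] cD[of D] by auto
  next
    fix D assume "D \<in> (if j = card C then insert C ?A else ?A)"
    thus "D \<in> {D. D \<subseteq> S \<and> cyclic_on ?\<sigma> D \<and> card D = j}"
      using cC cD[of D] C by (auto split: if_splits)
  qed
  moreover have "C \<notin> ?A"
  proof
    assume "C \<in> ?A"
    hence "C \<subseteq> S - C" by simp
    hence "C = {}" by blast
    thus False using cyclic_on_nonempty[OF cC] by simp
  qed
  moreover have "finite ?A" by (rule finite_subset[of _ "Pow S"]) (use fin in auto)
  ultimately show "cycles_in S ?\<sigma> j = add_cycle (card C) (cycles_in (S - C) \<tau>) j"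
    by (cases "j = card C") (simp_all add: cycles_in_def add_cycle_def del: mem_Collect_eq)
qed

text \<open>Restriction to \<open>C\<close> and to \<open>S - C\<close> splits such a permutation,
  and composition is the inverse map. The summand on the right does not involve
  \<open>\<rho>\<close>, so afterwards only the number of cyclic permutations of \<open>C\<close>
  matters.\<close>

lemma sum_orbit_decompose:
  assumes fin: "finite S" and a: "a \<in> C" and C: "C \<subseteq> S"
  shows "(\<Sum>\<sigma> | \<sigma> permutes S \<and> orbit \<sigma> a = C. F (cycles_in S \<sigma>))
       = (\<Sum>(\<rho>, \<tau>) \<in> cyclic_perms C \<times> {\<tau>. \<tau> permutes S - C}.
            F (add_cycle (card C) (cycles_in (S - C) \<tau>)))"
proof (rule sum.reindex_bij_witness[where
        j = "\<lambda>\<sigma>. (perm_restrict \<sigma> C, perm_restrict \<sigma> (S - C))" and i = "\<lambda>(\<rho>, \<tau>). \<rho> \<circ> \<tau>"])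
  fix \<sigma> assume \<sigma>: "\<sigma> \<in> {\<sigma>. \<sigma> permutes S \<and> orbit \<sigma> a = C}"
  have c: "cyclic_on \<sigma> C" using \<sigma> cyclic_on_orbit[OF _ fin, of \<sigma> a] by auto
  have p1: "perm_restrict \<sigma> C permutes C"
  proof -
    have "bij_betw \<sigma> C C"
      unfolding bij_betw_def
    proof
      show inj: "inj_on \<sigma> C" using \<sigma> by (auto intro: permutes_inj_on)
      show "\<sigma> ` C = C"
        by (rule endo_inj_surj[OF _ _ inj]) (use c in \<open>auto intro: cyclic_on_inI finite_cyclic_on\<close>)
    qed
    hence "bij_betw (perm_restrict \<sigma> C) C C"
      by (rule bij_betw_cong[THEN iffD1, rotated]) (simp add: perm_restrict_simps)
    thus ?thesis by (rule bij_imp_permutes) (simp add: perm_restrict_simps)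
  qed
  have p2: "perm_restrict \<sigma> (S - C) permutes S - C"
    using \<sigma> c by (intro perm_restrict_diff_cyclic) auto
  show *: "(case (perm_restrict \<sigma> C, perm_restrict \<sigma> (S - C)) of (\<rho>, \<tau>) \<Rightarrow> \<rho> \<circ> \<tau>) = \<sigma>"
    using perm_restrict_union[OF p1 p2] \<sigma> C by (simp add: Un_absorb1)
  show m: "(perm_restrict \<sigma> C, perm_restrict \<sigma> (S - C)) \<in> cyclic_perms C \<times> {\<tau>. \<tau> permutes S - C}"
    using p1 p2 c by (simp add: cyclic_perms_def cyclic_on_perm_restrict)
  show "(case (perm_restrict \<sigma> C, perm_restrict \<sigma> (S - C)) of
          (\<rho>, \<tau>) \<Rightarrow> F (add_cycle (card C) (cycles_in (S - C) \<tau>))) = F (cycles_in S \<sigma>)"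
    using cycles_in_compose[OF fin C, of "perm_restrict \<sigma> C" "perm_restrict \<sigma> (S - C)"] m * by simp
next
  fix p assume p: "p \<in> cyclic_perms C \<times> {\<tau>. \<tau> permutes S - C}"
  obtain \<rho> \<tau> where p_eq: "p = (\<rho>, \<tau>)" by (cases p)
  have \<rho>: "\<rho> permutes C" "cyclic_on \<rho> C" and \<tau>: "\<tau> permutes S - C"
    using p p_eq by (auto simp: cyclic_perms_def)
  have eqC: "(\<rho> \<circ> \<tau>) x = \<rho> x" if "x \<in> C" for x
    using \<tau> that by (auto simp: permutes_def)
  have eqD: "(\<rho> \<circ> \<tau>) x = \<tau> x" if "x \<in> S - C" for x
  proof -
    have "\<tau> x \<in> S - C" using permutes_in_image[OF \<tau>, of x] that by blast
    thus ?thesis using \<rho> by (auto simp: permutes_def)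
  qed
  have cC: "cyclic_on (\<rho> \<circ> \<tau>) C"
    using \<rho> cyclic_cong[of C "\<rho> \<circ> \<tau>" \<rho>] eqC by auto
  have "\<rho> \<circ> \<tau> permutes S"
    by (intro permutes_compose permutes_subset[OF \<rho>(1) C] permutes_subset[OF \<tau>]) auto
  moreover have "orbit (\<rho> \<circ> \<tau>) a = C"
    using cC a by (rule orbit_cyclic_eq3)
  ultimately show "(case p of (\<rho>, \<tau>) \<Rightarrow> \<rho> \<circ> \<tau>) \<in> {\<sigma>. \<sigma> permutes S \<and> orbit \<sigma> a = C}"
    by (simp add: p_eq)
  have "perm_restrict (\<rho> \<circ> \<tau>) C = \<rho>"
    using eqC \<rho>(1) by (auto simp: fun_eq_iff perm_restrict_def permutes_def)
  moreover have "perm_restrict (\<rho> \<circ> \<tau>) (S - C) = \<tau>"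
    using eqD \<tau> by (auto simp: fun_eq_iff perm_restrict_def permutes_def)
  ultimately show "(perm_restrict (case p of (\<rho>, \<tau>) \<Rightarrow> \<rho> \<circ> \<tau>) C,
          perm_restrict (case p of (\<rho>, \<tau>) \<Rightarrow> \<rho> \<circ> \<tau>) (S - C)) = p"
    by (simp add: p_eq)
qed

lemma cycle_sum_decompose:
  fixes F :: "(nat \<Rightarrow> nat) \<Rightarrow> 'b::comm_semiring_1"
  assumes fin: "finite S" and a: "a \<in> S"
  shows "cycle_sum S F = (\<Sum>C | a \<in> C \<and> C \<subseteq> S. of_nat (card (cyclic_perms C)) *
           cycle_sum (S - C) (\<lambda>\<alpha>. F (add_cycle (card C) \<alpha>)))"
proof -
  let ?P = "{\<sigma>. \<sigma> permutes S}" and ?Cs = "{C. a \<in> C \<and> C \<subseteq> S}"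
  have finP: "finite ?P" using fin by (rule finite_permutations)
  have finC: "finite ?Cs" by (rule finite_subset[of _ "Pow S"]) (use fin in auto)
  have "orbit \<sigma> a \<in> ?Cs" if "\<sigma> \<in> ?P" for \<sigma>
    using that a fin permutes_orbit_subset[of \<sigma> S a] permutation_self_in_orbit[of \<sigma> a]
    by (auto simp: permutation_permutes)
  hence "cycle_sum S F = (\<Sum>C\<in>?Cs. \<Sum>\<sigma> | \<sigma> \<in> ?P \<and> orbit \<sigma> a = C. F (cycles_in S \<sigma>))"
    unfolding cycle_sum_def by (intro sum.group[symmetric] finP finC) auto
  also have "\<dots> = (\<Sum>C | a \<in> C \<and> C \<subseteq> S. of_nat (card (cyclic_perms C)) *
           cycle_sum (S - C) (\<lambda>\<alpha>. F (add_cycle (card C) \<alpha>)))"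
  proof (rule sum.cong[OF refl])
    fix C assume "C \<in> ?Cs"
    thus "(\<Sum>\<sigma> | \<sigma> \<in> ?P \<and> orbit \<sigma> a = C. F (cycles_in S \<sigma>)) = of_nat (card (cyclic_perms C)) *
           cycle_sum (S - C) (\<lambda>\<alpha>. F (add_cycle (card C) \<alpha>))"
      using sum_orbit_decompose[OF fin, of a C F]
      by (simp add: cycle_sum_def sum.cartesian_product[symmetric])
  qed
  finally show ?thesis .
qed

lemma card_subsets_containing:
  assumes "finite S" "a \<in> S" "j \<ge> 1"
  shows "card {C. a \<in> C \<and> C \<subseteq> S \<and> card C = j} = (card S - 1) choose (j - 1)"
proof -
  have "bij_betw (insert a) {D. D \<subseteq> S - {a} \<and> card D = j - 1} {C. a \<in> C \<and> C \<subseteq> S \<and> card C = j}"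
  proof (rule bij_betw_byWitness[where f' = "\<lambda>C. C - {a}"])
    show "insert a ` {D. D \<subseteq> S - {a} \<and> card D = j - 1} \<subseteq> {C. a \<in> C \<and> C \<subseteq> S \<and> card C = j}"
    proof safe
      fix D assume D: "D \<subseteq> S - {a}" "card D = j - 1"
      have "finite D" using D assms by (meson finite_Diff finite_subset)
      thus "card (insert a D) = j" using D assms by (subst card_insert_disjoint) auto
    qed (use assms in auto)
    show "(\<lambda>C. C - {a}) ` {C. a \<in> C \<and> C \<subseteq> S \<and> card C = j} \<subseteq> {D. D \<subseteq> S - {a} \<and> card D = j - 1}"
      by auto
  qed auto
  hence "card {C. a \<in> C \<and> C \<subseteq> S \<and> card C = j} = card {D. D \<subseteq> S - {a} \<and> card D = j - 1}"
    by (simp add: bij_betw_same_card)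
  also have "\<dots> = card (S - {a}) choose (j - 1)"
    using assms by (intro n_subsets) auto
  finally show ?thesis using assms by simp
qed

lemma sum_subsets_containing:
  fixes g :: "nat \<Rightarrow> 'b::comm_semiring_1"
  assumes fin: "finite S" and a: "a \<in> S"
  shows "(\<Sum>C | a \<in> C \<and> C \<subseteq> S. g (card C)) = (\<Sum>j=1..card S. of_nat ((card S - 1) choose (j - 1)) * g j)"
proof -
  let ?Cs = "{C. a \<in> C \<and> C \<subseteq> S}"
  have finC: "finite ?Cs" by (rule finite_subset[of _ "Pow S"]) (use fin in auto)
  have "card C \<in> {1..card S}" if "C \<in> ?Cs" for C
  proof -
    have "finite C" using that fin finite_subset by auto
    moreover have "C \<noteq> {}" using that by auto
    ultimately have "0 < card C" by (simp add: card_gt_0_iff)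
    thus ?thesis using that fin by (simp add: card_mono Suc_le_eq)
  qed
  hence "(\<Sum>C\<in>?Cs. g (card C)) = (\<Sum>j=1..card S. \<Sum>C | C \<in> ?Cs \<and> card C = j. g (card C))"
    by (intro sum.group[symmetric] finC) auto
  also have "\<dots> = (\<Sum>j=1..card S. of_nat ((card S - 1) choose (j - 1)) * g j)"
  proof (rule sum.cong[OF refl])
    fix j assume "j \<in> {1..card S}"
    thus "(\<Sum>C | C \<in> ?Cs \<and> card C = j. g (card C)) = of_nat ((card S - 1) choose (j - 1)) * g j"
      using card_subsets_containing[OF fin a, of j] by simp
  qed
  finally show ?thesis .
qed

text \<open>The decomposition according to the cycle through \<open>a\<close>, applied to the constant function,
  also counts the cyclic permutations.\<close>
lemma card_cyclic_perms:
  assumes "finite C" "C \<noteq> {}"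
  shows "card (cyclic_perms C) = fact (card C - 1)"
  using assms
proof (induction C rule: finite_psubset_induct)
  case (psubset C)
  then obtain a where a: "a \<in> C" by auto
  let ?n = "card C" and ?Cs = "{D. a \<in> D \<and> D \<subseteq> C}"
  have n: "?n \<ge> 1" using psubset by (simp add: card_gt_0_iff Suc_le_eq)
  have finC: "finite ?Cs" by (rule finite_subset[of _ "Pow C"]) (use psubset in auto)
  have one: "cycle_sum S (\<lambda>_. 1 :: nat) = fact (card S)" if "finite S" for S :: "'a set"
    using that by (simp add: cycle_sum_def card_permutations)
  have one': "cycle_sum (C - D) (\<lambda>_. 1 :: nat) = fact (?n - card D)" if "D \<in> ?Cs" for D
  proof -
    have "finite D" using that psubset(1) finite_subset by auto
    thus ?thesis using that psubset(1) by (subst one) (auto simp: card_Diff_subset)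
  qed
  let ?g = "\<lambda>k. fact (k - 1) * fact (?n - k) :: nat"
  have split: "?Cs = insert C (?Cs - {C})" using a by auto
  have "fact ?n = (\<Sum>D\<in>?Cs. card (cyclic_perms D) * fact (?n - card D))"
    unfolding one[OF psubset(1), symmetric] cycle_sum_decompose[OF psubset(1) a, of "\<lambda>_. 1 :: nat"]
    by (rule sum.cong[OF refl]) (simp only: one' of_nat_id)
  also have "\<dots> = card (cyclic_perms C) + (\<Sum>D\<in>?Cs - {C}. card (cyclic_perms D) * fact (?n - card D))"
    by (subst split, subst sum.insert) (use finC in auto)
  also have "(\<Sum>D\<in>?Cs - {C}. card (cyclic_perms D) * fact (?n - card D)) = (\<Sum>D\<in>?Cs - {C}. ?g (card D))"
  proof (rule sum.cong[OF refl])
    fix D assume "D \<in> ?Cs - {C}"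
    thus "card (cyclic_perms D) * fact (?n - card D) = ?g (card D)"
      using psubset.IH[of D] by auto
  qed
  finally have 1: "fact ?n = card (cyclic_perms C) + (\<Sum>D\<in>?Cs - {C}. ?g (card D))" .
  \<comment> \<open>With the conjectured counts each of the \<open>?n\<close> terms, sorted by
    cardinality, is \<open>fact (?n - 1)\<close>, and the total is \<open>fact ?n\<close> again. The
    true decomposition has the same total and, by induction, the same terms for every
    \<open>D\<close> other than \<open>C\<close>; this forces the term of \<open>C\<close>.\<close>
  have "(\<Sum>D\<in>?Cs. ?g (card D)) = ?g ?n + (\<Sum>D\<in>?Cs - {C}. ?g (card D))"
    by (subst split, subst sum.insert) (use finC in auto)
  moreover have "(\<Sum>D\<in>?Cs. ?g (card D)) = (\<Sum>j=1..?n. ((?n - 1) choose (j - 1)) * ?g j)"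
    using sum_subsets_containing[OF psubset(1) a, of ?g] by simp
  moreover have "(\<Sum>j=1..?n. ((?n - 1) choose (j - 1)) * ?g j) = (\<Sum>j=1..?n. fact (?n - 1))"
  proof (rule sum.cong[OF refl])
    fix j assume "j \<in> {1..?n}"
    thus "((?n - 1) choose (j - 1)) * ?g j = fact (?n - 1)"
      using binomial_fact_lemma[of "j - 1" "?n - 1"] by (auto simp add: ac_simps diff_le_mono)
  qed
  moreover have "(\<Sum>j=1..?n. fact (?n - 1)) = (fact ?n :: nat)"
    using n by (simp add: fact_reduce)
  ultimately show ?case using 1 by simp
qed

section \<open>Averages over the symmetric group and their recurrence\<close>

definition cyc_exp :: "nat \<Rightarrow> ((nat \<Rightarrow> nat) \<Rightarrow> 'b::field_char_0) \<Rightarrow> 'b" where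
  "cyc_exp n F = cycle_sum {1..n} F / fact n"

text \<open>A cycle of length j through n can be chosen in binomial(n - 1, j - 1) (j - 1)! ways and
  leaves (n - j)! permutations. The product is (n - 1)! whatever j is, so all lengths get the same
  weight 1/n.\<close>

theorem cyc_exp_recurrence:
  assumes n: "n \<ge> 1"
  shows "of_nat n * cyc_exp n F = (\<Sum>j=1..n. cyc_exp (n - j) (\<lambda>\<alpha>. F (add_cycle j \<alpha>)))"
proof -
  let ?S = "{1..n}"
  let ?g = "\<lambda>j. fact (j - 1) * cycle_sum {1..n - j} (\<lambda>\<alpha>. F (add_cycle j \<alpha>))"
  have a: "n \<in> ?S" using n by auto
  have "cycle_sum ?S F = (\<Sum>C | n \<in> C \<and> C \<subseteq> ?S. of_nat (card (cyclic_perms C)) *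
           cycle_sum (?S - C) (\<lambda>\<alpha>. F (add_cycle (card C) \<alpha>)))"
    by (rule cycle_sum_decompose[OF _ a]) auto
  also have "\<dots> = (\<Sum>C | n \<in> C \<and> C \<subseteq> ?S. ?g (card C))"
  proof (rule sum.cong[OF refl])
    fix C assume C: "C \<in> {C. n \<in> C \<and> C \<subseteq> ?S}"
    hence f: "finite C" using finite_subset by auto
    have "card (cyclic_perms C) = fact (card C - 1)"
      using C f by (intro card_cyclic_perms) auto
    moreover have "card (?S - C) = n - card C"
      using C f by (simp add: card_Diff_subset)
    ultimately show "of_nat (card (cyclic_perms C)) *
           cycle_sum (?S - C) (\<lambda>\<alpha>. F (add_cycle (card C) \<alpha>)) = ?g (card C)"
      using cycle_sum_card[of "?S - C" "\<lambda>\<alpha>. F (add_cycle (card C) \<alpha>)"] by simp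
  qed
  also have "\<dots> = (\<Sum>j=1..n. of_nat ((n - 1) choose (j - 1)) * ?g j)"
    using sum_subsets_containing[OF _ a, of ?g] by simp
  also have "\<dots> = (\<Sum>j=1..n. fact (n - 1) * cyc_exp (n - j) (\<lambda>\<alpha>. F (add_cycle j \<alpha>)))"
  proof (rule sum.cong[OF refl])
    fix j assume j: "j \<in> {1..n}"
    have "fact (j - 1) * fact (n - j) * ((n - 1) choose (j - 1)) = (fact (n - 1) :: nat)"
      using j binomial_fact_lemma[of "j - 1" "n - 1"] by (auto simp add: diff_le_mono)
    hence "of_nat (fact (j - 1) * fact (n - j) * ((n - 1) choose (j - 1))) = (of_nat (fact (n - 1)) :: 'a)"
      by simp
    hence "fact (j - 1) * fact (n - j) * of_nat ((n - 1) choose (j - 1)) = (fact (n - 1) :: 'a)"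
      by (simp only: of_nat_mult of_nat_fact)
    hence "of_nat ((n - 1) choose (j - 1)) * fact (j - 1) = (fact (n - 1) / fact (n - j) :: 'a)"
      by (simp add: field_simps)
    thus "of_nat ((n - 1) choose (j - 1)) * ?g j = fact (n - 1) * cyc_exp (n - j) (\<lambda>\<alpha>. F (add_cycle j \<alpha>))"
      by (simp add: cyc_exp_def mult.assoc[symmetric])
  qed
  also have "\<dots> = fact (n - 1) * (\<Sum>j=1..n. cyc_exp (n - j) (\<lambda>\<alpha>. F (add_cycle j \<alpha>)))"
    by (simp add: sum_distrib_left)
  finally have "cycle_sum ?S F = \<dots>" .
  moreover have "fact n = (of_nat n * fact (n - 1) :: 'a)" using n by (simp add: fact_reduce)
  moreover have "of_nat n \<noteq> (0 :: 'a)" using n by simp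
  ultimately show ?thesis by (simp add: cyc_exp_def)
qed

lemma cyc_exp_0: "cyc_exp 0 F = F (\<lambda>_. 0)"
proof -
  have "cycles_in {} (id :: nat \<Rightarrow> nat) = (\<lambda>_. 0)"
    by (auto simp: cycles_in_def fun_eq_iff cyclic_on_def)
  thus ?thesis by (simp add: cyc_exp_def cycle_sum_def)
qed

lemma cyc_exp_add: "cyc_exp n (\<lambda>\<alpha>. F \<alpha> + G \<alpha>) = cyc_exp n F + cyc_exp n G"
  by (simp add: cyc_exp_def cycle_sum_def sum.distrib add_divide_distrib)

lemma cyc_exp_diff: "cyc_exp n (\<lambda>\<alpha>. F \<alpha> - G \<alpha>) = cyc_exp n F - cyc_exp n G"
  by (simp add: cyc_exp_def cycle_sum_def sum_subtractf diff_divide_distrib)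

lemma cyc_exp_cmult: "cyc_exp n (\<lambda>\<alpha>. c * F \<alpha>) = c * cyc_exp n F"
  by (simp add: cyc_exp_def cycle_sum_def sum_distrib_left)

lemma cyc_exp_const: "cyc_exp n (\<lambda>_. c) = c"
  by (simp add: cyc_exp_def cycle_sum_def card_permutations)

lemma cyc_exp_sum: "finite A \<Longrightarrow> cyc_exp n (\<lambda>\<alpha>. \<Sum>i\<in>A. F i \<alpha>) = (\<Sum>i\<in>A. cyc_exp n (F i))"
  by (induction A rule: finite_induct) (simp_all add: cyc_exp_const cyc_exp_add)

lemma cyc_exp_mono:
  fixes F :: "(nat \<Rightarrow> nat) \<Rightarrow> real"
  assumes "\<And>\<alpha>. F \<alpha> \<le> G \<alpha>"
  shows "cyc_exp n F \<le> cyc_exp n G"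
  unfolding cyc_exp_def cycle_sum_def by (intro divide_right_mono sum_mono assms) auto

lemma cyc_exp_nonneg:
  fixes F :: "(nat \<Rightarrow> nat) \<Rightarrow> real"
  assumes "\<And>\<alpha>. 0 \<le> F \<alpha>"
  shows "0 \<le> cyc_exp n F"
  using cyc_exp_mono[of "\<lambda>_. 0" F n] assms by (simp add: cyc_exp_const)

text \<open>The cut-off \<open>N\<close> is kept apart from the size of the permutation: the
  recurrence passes to smaller permutations, while the statistic has to remain the same
  function.\<close>

definition cycle_stat :: "nat \<Rightarrow> (nat \<Rightarrow> real) \<Rightarrow> (nat \<Rightarrow> nat) \<Rightarrow> real" where
  "cycle_stat N f \<alpha> = (\<Sum>j=1..N. real (\<alpha> j) * f j)"

lemma cycle_stat_add_cycle:
  assumes "j \<in> {1..N}"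
  shows "cycle_stat N f (add_cycle j \<alpha>) = f j + cycle_stat N f \<alpha>"
proof -
  have "cycle_stat N f (add_cycle j \<alpha>) = (\<Sum>i=1..N. real (\<alpha> i) * f i + (if i = j then f i else 0))"
    unfolding cycle_stat_def by (rule sum.cong) (auto simp: add_cycle_def algebra_simps)
  thus ?thesis using assms by (simp add: sum.distrib cycle_stat_def)
qed

lemma cycle_stat_0: "cycle_stat N f (\<lambda>_. 0) = 0"
  by (simp add: cycle_stat_def)

text \<open>Subtracting consecutive instances of a recurrence \<open>n * u n = R n + (u 0 + \<dots> + u (n - 1))\<close>
  turns it into a first order one.\<close>
lemma difference_of_recurrence:
  fixes u :: "nat \<Rightarrow> real"
  assumes rec: "\<And>n. 1 \<le> n \<Longrightarrow> n \<le> N \<Longrightarrow> real n * u n = R n + (\<Sum>j=1..n. u (n - j))"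
    and R0: "R 0 = 0" and n: "1 \<le> n" "n \<le> N"
  shows "u n = u (n - 1) + (R n - R (n - 1)) / real n"
proof -
  have *: "(\<Sum>j=1..m. u (m - j)) = (\<Sum>i<m. u i)" for m
    by (rule sum.reindex_bij_witness[where i = "\<lambda>i. m - i" and j = "\<lambda>j. m - j"]) auto
  obtain m where m: "n = Suc m" using n by (cases n) auto
  \<comment> \<open>\<open>R 0 = 0\<close> makes the recurrence true at m = 0 as well, so that n = 1
    is no exception.\<close>
  have "real m * u m = R m + (\<Sum>i<m. u i)"
    using rec[of m] n R0 m by (cases "m = 0") (auto simp del: One_nat_def simp: *)
  moreover have "real n * u n = R n + (\<Sum>i<m. u i) + u m"
    using rec[OF n] unfolding * by (simp add: m)
  ultimately have "real n * (u n - u m) = R n - R m"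
    by (simp add: m algebra_simps)
  thus ?thesis using n m by (simp add: field_simps)
qed

text \<open>Adding a cycle of length \<open>j\<close> shifts the statistic by \<open>f j\<close>;
  hence \<open>R\<close> is the partial sum of \<open>f\<close>, and its difference is
  \<open>f n\<close>. For an indicator \<open>f\<close> this says that \<alpha>_k has mean
  1/k.\<close>

lemma cyc_exp_cycle_stat:
  assumes "n \<le> N"
  shows "cyc_exp n (cycle_stat N f) = (\<Sum>k=1..n. f k / real k)"
  using assms
proof (induction n)
  case 0
  thus ?case by (simp add: cyc_exp_0 cycle_stat_0)
next
  case (Suc n)
  let ?u = "\<lambda>n. cyc_exp n (cycle_stat N f)"
  have "?u (Suc n) = ?u (Suc n - 1) + ((\<Sum>j=1..Suc n. f j) - (\<Sum>j=1..Suc n - 1. f j)) / real (Suc n)"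
  proof (rule difference_of_recurrence[where R = "\<lambda>n. \<Sum>j=1..n. f j"])
    fix m assume m: "1 \<le> m" "m \<le> N"
    have "(\<Sum>j=1..m. cyc_exp (m - j) (\<lambda>\<alpha>. cycle_stat N f (add_cycle j \<alpha>))) = (\<Sum>j=1..m. f j + ?u (m - j))"
      by (rule sum.cong) (use m in \<open>auto simp: cycle_stat_add_cycle cyc_exp_add cyc_exp_const\<close>)
    thus "real m * ?u m = (\<Sum>j=1..m. f j) + (\<Sum>j=1..m. ?u (m - j))"
      using cyc_exp_recurrence[OF m(1), of "cycle_stat N f"] by (simp add: sum.distrib)
  qed (use Suc in auto)
  thus ?case using Suc by simp
qed

text \<open>An ordered pair of different cycles with lengths i, j contributes 1/(i j) if i + j \<le>
  n and nothing otherwise, because both have to fit into n points. The double sum lists these pairs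
  by their total length \<open>k\<close>; the first sum pairs each cycle with itself.\<close>

lemma cyc_exp_cycle_stat_square:
  assumes "n \<le> N"
  shows "cyc_exp n (\<lambda>\<alpha>. (cycle_stat N f \<alpha>)\<^sup>2) = (\<Sum>k=1..n. (f k)\<^sup>2 / real k)
           + (\<Sum>k=1..n. \<Sum>j=1..<k. f j / real j * (f (k - j) / real (k - j)))"
  using assms
proof (induction n)
  case 0
  thus ?case by (simp add: cyc_exp_0 cycle_stat_0)
next
  case (Suc n)
  let ?u = "\<lambda>n. cyc_exp n (\<lambda>\<alpha>. (cycle_stat N f \<alpha>)\<^sup>2)"
  define \<mu> where "\<mu> m = (\<Sum>k=1..m. f k / real k)" for m
  define R where "R m = (\<Sum>j=1..m. (f j)\<^sup>2 + 2 * f j * \<mu> (m - j))" for m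
  have "?u (Suc n) = ?u (Suc n - 1) + (R (Suc n) - R (Suc n - 1)) / real (Suc n)"
  proof (rule difference_of_recurrence)
    fix m assume m: "1 \<le> m" "m \<le> N"
    have "(\<Sum>j=1..m. cyc_exp (m - j) (\<lambda>\<alpha>. (cycle_stat N f (add_cycle j \<alpha>))\<^sup>2))
        = (\<Sum>j=1..m. ((f j)\<^sup>2 + 2 * f j * \<mu> (m - j)) + ?u (m - j))"
    proof (rule sum.cong[OF refl])
      fix j assume j: "j \<in> {1..m}"
      have "(\<lambda>\<alpha>. (cycle_stat N f (add_cycle j \<alpha>))\<^sup>2)
          = (\<lambda>\<alpha>. (f j)\<^sup>2 + 2 * f j * cycle_stat N f \<alpha> + (cycle_stat N f \<alpha>)\<^sup>2)"
        using j m by (simp add: fun_eq_iff cycle_stat_add_cycle power2_sum)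
      thus "cyc_exp (m - j) (\<lambda>\<alpha>. (cycle_stat N f (add_cycle j \<alpha>))\<^sup>2)
          = ((f j)\<^sup>2 + 2 * f j * \<mu> (m - j)) + ?u (m - j)"
        using m by (simp add: cyc_exp_add cyc_exp_const cyc_exp_cmult cyc_exp_cycle_stat \<mu>_def)
    qed
    thus "real m * ?u m = R m + (\<Sum>j=1..m. ?u (m - j))"
      using cyc_exp_recurrence[OF m(1), of "\<lambda>\<alpha>. (cycle_stat N f \<alpha>)\<^sup>2"] by (simp add: sum.distrib R_def)
  qed (use Suc in \<open>auto simp: R_def\<close>)
  moreover have "R (Suc n) - R n = (f (Suc n))\<^sup>2 + 2 * (\<Sum>j=1..n. f j * (f (Suc n - j) / real (Suc n - j)))"
  proof -
    have "\<mu> (Suc n - j) = \<mu> (n - j) + f (Suc n - j) / real (Suc n - j)" if "j \<in> {1..n}" for j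
      using that by (simp add: \<mu>_def Suc_diff_le)
    hence "(\<Sum>j=1..n. (f j)\<^sup>2 + 2 * f j * \<mu> (Suc n - j))
        = (\<Sum>j=1..n. ((f j)\<^sup>2 + 2 * f j * \<mu> (n - j)) + 2 * (f j * (f (Suc n - j) / real (Suc n - j))))"
      by (intro sum.cong) (auto simp: algebra_simps)
    also have "\<dots> = R n + 2 * (\<Sum>j=1..n. f j * (f (Suc n - j) / real (Suc n - j)))"
      by (simp only: sum.distrib sum_distrib_left R_def)
    finally have *: "(\<Sum>j=1..n. (f j)\<^sup>2 + 2 * f j * \<mu> (Suc n - j))
        = R n + 2 * (\<Sum>j=1..n. f j * (f (Suc n - j) / real (Suc n - j)))" .
    have "\<mu> 0 = 0" by (simp add: \<mu>_def)
    hence "R (Suc n) = (\<Sum>j=1..n. (f j)\<^sup>2 + 2 * f j * \<mu> (Suc n - j)) + (f (Suc n))\<^sup>2"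
      unfolding R_def by simp
    thus ?thesis using * by linarith
  qed
  moreover have "2 * (\<Sum>j=1..n. f j * (f (Suc n - j) / real (Suc n - j))) / real (Suc n)
       = (\<Sum>j=1..<Suc n. f j / real j * (f (Suc n - j) / real (Suc n - j)))"
  proof -
    let ?s = "\<Sum>j=1..n. f j * (f (Suc n - j) / real (Suc n - j))"
    \<comment> \<open>With a = j and b = n + 1 - j, averaging over the reflection of j replaces 1/b
      by (1/a + 1/b)/2 = (n + 1)/(2 a b). This cancels the factor 2/(n + 1).\<close>
    have "?s = (\<Sum>j=1..n. f (Suc n - j) * (f j / real j))"
      by (rule sum.reindex_bij_witness[where i = "\<lambda>j. Suc n - j" and j = "\<lambda>j. Suc n - j"]) auto
    hence "2 * ?s = (\<Sum>j=1..n. f j * (f (Suc n - j) / real (Suc n - j)) + f (Suc n - j) * (f j / real j))"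
      by (simp add: sum.distrib)
    also have "\<dots> = (\<Sum>j=1..n. real (Suc n) * (f j / real j * (f (Suc n - j) / real (Suc n - j))))"
    proof (rule sum.cong[OF refl])
      fix j assume j: "j \<in> {1..n}"
      define a b where "a = real j" and "b = real (Suc n - j)"
      have "a > 0" "b > 0" "real (Suc n) = a + b" using j by (auto simp: a_def b_def)
      thus "f j * (f (Suc n - j) / real (Suc n - j)) + f (Suc n - j) * (f j / real j)
          = real (Suc n) * (f j / real j * (f (Suc n - j) / real (Suc n - j)))"
        unfolding a_def[symmetric] b_def[symmetric] by (simp add: field_simps)
    qed
    also have "\<dots> = real (Suc n) * (\<Sum>j=1..<Suc n. f j / real j * (f (Suc n - j) / real (Suc n - j)))"
      by (simp only: sum_distrib_left atLeastLessThanSuc_atLeastAtMost)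
    finally show ?thesis by (simp del: sum.op_ivl_Suc)
  qed
  ultimately have "?u (Suc n) = ?u n + (f (Suc n))\<^sup>2 / real (Suc n)
      + (\<Sum>j=1..<Suc n. f j / real j * (f (Suc n - j) / real (Suc n - j)))"
    by (simp add: add_divide_distrib del: of_nat_Suc sum.op_ivl_Suc)
  thus ?case using Suc by (simp del: of_nat_Suc sum.op_ivl_Suc)
qed

lemma sum_convolution_le:
  fixes g :: "nat \<Rightarrow> real"
  assumes "\<And>k. g k \<ge> 0"
  shows "(\<Sum>k=1..n. \<Sum>j=1..<k. g j * g (k - j)) \<le> (\<Sum>k=1..n. g k)\<^sup>2"
proof -
  have "(\<Sum>k=1..n. \<Sum>j=1..<k. g j * g (k - j)) = (\<Sum>(k,j)\<in>(SIGMA k:{1..n}. {1..<k}). g j * g (k - j))"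
    by (subst sum.Sigma) auto
  also have "\<dots> = (\<Sum>(i,j)\<in>(\<lambda>(k,j). (j, k - j)) ` (SIGMA k:{1..n}. {1..<k}). g i * g j)"
    by (subst sum.reindex) (auto simp: inj_on_def case_prod_unfold)
  also have "\<dots> \<le> (\<Sum>(i,j)\<in>{1..n} \<times> {1..n}. g i * g j)"
    by (rule sum_mono2) (auto simp: assms)
  also have "\<dots> = (\<Sum>k=1..n. g k)\<^sup>2"
    by (simp add: power2_eq_square sum_product sum.cartesian_product)
  finally show ?thesis .
qed

text \<open>As \<open>f\<close> is nonnegative, dropping the condition that two cycles fit together
  completes the double sum to the square of the mean. What remains is the variance for independent
  Poisson counts of mean 1/k.\<close>

lemma cyc_var_cycle_stat_le:
  assumes "n \<le> N" "\<And>k. f k \<ge> 0"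
  shows "cyc_exp n (\<lambda>\<alpha>. (cycle_stat N f \<alpha>)\<^sup>2) \<le> (\<Sum>k=1..n. (f k)\<^sup>2 / real k) + (cyc_exp n (cycle_stat N f))\<^sup>2"
  using sum_convolution_le[of "\<lambda>k. f k / real k" n] assms
  by (simp add: cyc_exp_cycle_stat_square cyc_exp_cycle_stat)

section \<open>Coefficients of exponentials of power series\<close>

text \<open>The coefficients of \<open>exp (\<Sum>\<^sub>j x j z\<^sup>j / j)\<close>.\<close>
fun exp_coeff :: "(nat \<Rightarrow> 'a::field_char_0) \<Rightarrow> nat \<Rightarrow> 'a" where
  "exp_coeff x n = (if n = 0 then 1 else (\<Sum>i\<in>{..<n}. exp_coeff x i * x (n - i)) / of_nat n)"

declare exp_coeff.simps [simp del]

lemma exp_coeff_0: "exp_coeff x 0 = 1"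
  by (simp add: exp_coeff.simps)

lemma exp_coeff_rec: "n \<ge> 1 \<Longrightarrow> of_nat n * exp_coeff x n = (\<Sum>i<n. exp_coeff x i * x (n - i))"
  by (subst exp_coeff.simps) simp

text \<open>The recurrence is asked for up to \<open>N\<close> only: for averages of a statistic
  with cut-off \<open>N\<close> it is available just in that range.\<close>

lemma exp_coeff_unique:
  assumes "h 0 = 1" and "\<And>n. 1 \<le> n \<Longrightarrow> n \<le> N \<Longrightarrow> of_nat n * h n = (\<Sum>i<n. h i * x (n - i))" and "n \<le> N"
  shows "h n = exp_coeff x n"
  using assms(3)
proof (induction n rule: less_induct)
  case (less n)
  show ?case
  proof (cases "n = 0")
    case True
    thus ?thesis using assms(1) by (simp add: exp_coeff_0)
  next
    case False
    have "of_nat n * h n = (\<Sum>i<n. exp_coeff x i * x (n - i))"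
      using assms(2)[of n] False less by simp
    hence "of_nat n * h n = of_nat n * exp_coeff x n" using exp_coeff_rec[of n x] False by simp
    thus ?thesis using False by simp
  qed
qed

text \<open>The exponential of a sum is a product. The exponent has the shifted sequence
  \<open>X x\<close> as its formal derivative, so the defining recurrence is the equation H' = H X
  with constant term 1, and both sides solve it.\<close>

lemma exp_coeff_add: "exp_coeff (\<lambda>j. x j + y j) n = (\<Sum>i\<le>n. exp_coeff x i * exp_coeff y (n - i))"
proof -
  define X where "X x = Abs_fps (\<lambda>n. x (Suc n))" for x :: "nat \<Rightarrow> 'a"
  have d: "fps_deriv (Abs_fps (exp_coeff x)) = Abs_fps (exp_coeff x) * X x" for x :: "nat \<Rightarrow> 'a"
  proof (rule fps_ext)
    fix n
    show "fps_nth (fps_deriv (Abs_fps (exp_coeff x))) n = fps_nth (Abs_fps (exp_coeff x) * X x) n"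
      using exp_coeff_rec[of "Suc n" x]
      by (simp add: fps_mult_nth X_def lessThan_Suc_atMost atLeast0AtMost Suc_diff_le)
  qed
  define H where "H = Abs_fps (exp_coeff x) * Abs_fps (exp_coeff y)"
  have dH: "fps_deriv H = H * X (\<lambda>j. x j + y j)"
  proof -
    have "X (\<lambda>j. x j + y j) = X x + X y" by (simp add: X_def fps_eq_iff)
    thus ?thesis by (simp add: H_def d algebra_simps)
  qed
  have "fps_nth H n = exp_coeff (\<lambda>j. x j + y j) n"
  proof (rule exp_coeff_unique[where N = n])
    show "fps_nth H 0 = 1" by (simp add: H_def exp_coeff_0)
  next
    fix m assume "1 \<le> m" "m \<le> n"
    then obtain k where k: "m = Suc k" by (cases m) auto
    have "of_nat m * fps_nth H m = fps_nth (fps_deriv H) k" by (simp add: k)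
    also have "\<dots> = (\<Sum>i<m. fps_nth H i * (x (m - i) + y (m - i)))"
      unfolding dH by (simp add: fps_mult_nth X_def k lessThan_Suc_atMost atLeast0AtMost Suc_diff_le)
    finally show "of_nat m * fps_nth H m = (\<Sum>i<m. fps_nth H i * (x (m - i) + y (m - i)))" .
  qed auto
  thus ?thesis by (simp add: H_def fps_mult_nth atLeast0AtMost)
qed

lemma exp_coeff_1: "exp_coeff (\<lambda>_. 1) n = 1"
  by (rule exp_coeff_unique[symmetric, where N = n]) auto

lemma exp_coeff_nonneg:
  fixes x :: "nat \<Rightarrow> real"
  assumes "\<And>j. x j \<ge> 0"
  shows "exp_coeff x n \<ge> 0"
proof (induction n rule: less_induct)
  case (less n)
  show ?case
  proof (cases "n = 0")
    case False
    have "0 \<le> (\<Sum>i<n. exp_coeff x i * x (n - i))"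
      using less assms by (intro sum_nonneg mult_nonneg_nonneg) auto
    hence "0 \<le> real n * exp_coeff x n" using False by (simp add: exp_coeff_rec)
    thus ?thesis using False by (simp add: zero_le_mult_iff)
  qed (simp add: exp_coeff_0)
qed

text \<open>The constant sequence 1 belongs to exp(-log(1 - z)) = 1/(1 - z), and multiplying by that
  series forms partial sums.\<close>

lemma exp_coeff_partial_sum: "exp_coeff (\<lambda>j. 1 + x j) n = (\<Sum>i\<le>n. exp_coeff x i)"
  using exp_coeff_add[of x "\<lambda>_. 1" n] by (simp add: exp_coeff_1 add.commute)

section \<open>Avoiding cycle lengths divisible by a given number\<close>

definition mult_ind :: "nat \<Rightarrow> nat \<Rightarrow> real" where
  "mult_ind q j = of_bool (q dvd j)"

lemma exp_coeff_mult_ind: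
  assumes q: "q \<ge> 1" and n: "n \<ge> 1"
  shows "exp_coeff (\<lambda>j. c * mult_ind q j) n
       = (if q dvd n then c * exp_coeff (\<lambda>j. 1 + c * mult_ind q j) (n - q) / real n else 0)"
proof -
  let ?d = "exp_coeff (\<lambda>j. c * mult_ind q j)"
  have zero: "?d n = 0" if "\<not> q dvd n" for n
    using that
  proof (induction n rule: less_induct)
    case (less n)
    hence n: "n \<ge> 1" by (cases n) auto
    have "?d i * (c * mult_ind q (n - i)) = 0" if "i < n" for i
    proof (cases "q dvd n - i")
      case True
      hence "\<not> q dvd i" using less.prems that dvd_diffD[of q n i] by auto
      thus ?thesis using less.IH[OF that] by simp
    qed (simp add: mult_ind_def)
    hence "(\<Sum>i<n. ?d i * (c * mult_ind q (n - i))) = 0" by (intro sum.neutral) auto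
    hence "real n * ?d n = 0" using exp_coeff_rec[OF n, of "\<lambda>j. c * mult_ind q j"] by simp
    thus ?case using n by simp
  qed
  show ?thesis
  proof (cases "q dvd n")
    case True
    hence le: "q \<le> n" using n by (simp add: dvd_imp_le)
    have "real n * ?d n = (\<Sum>i<n. ?d i * (c * mult_ind q (n - i)))"
      using n by (simp add: exp_coeff_rec)
    also have "\<dots> = (\<Sum>i\<le>n - q. c * ?d i)"
    proof (rule sum.mono_neutral_cong_right)
      show "{..n - q} \<subseteq> {..<n}" using q n by auto
      show "\<forall>i\<in>{..<n} - {..n - q}. ?d i * (c * mult_ind q (n - i)) = 0"
      proof
        fix i assume i: "i \<in> {..<n} - {..n - q}"
        hence "0 < n - i" "n - i < q" by auto
        hence "\<not> q dvd n - i" by (auto dest: dvd_imp_le)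
        thus "?d i * (c * mult_ind q (n - i)) = 0" by (simp add: mult_ind_def)
      qed
      show "?d i * (c * mult_ind q (n - i)) = c * ?d i" if "i \<in> {..n - q}" for i
      proof (cases "q dvd i")
        case True
        with \<open>q dvd n\<close> show ?thesis by (simp add: mult_ind_def)
      next
        case False
        thus ?thesis by (simp add: zero)
      qed
    qed auto
    also have "\<dots> = c * exp_coeff (\<lambda>j. 1 + c * mult_ind q j) (n - q)"
      by (simp add: exp_coeff_partial_sum sum_distrib_left)
    finally show ?thesis using True n by (simp add: field_simps)
  qed (simp add: zero)
qed

text \<open>The series (1 - z^q)^{1/q} is the case c = -1: beyond index 0 its coefficients are zero
  or minus a nonnegative coefficient divided by the index. Its partial sums are the probabilities
  that no cycle length is divisible by \<open>q\<close>, which are therefore decreasing.\<close>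

lemma exp_coeff_avoid_decseq:
  assumes q: "q \<ge> 1"
  shows "exp_coeff (\<lambda>j. - mult_ind q j) (Suc n) \<le> 0"
    and "decseq (exp_coeff (\<lambda>j. 1 - mult_ind q j))"
proof -
  have nn: "0 \<le> exp_coeff (\<lambda>j. 1 - mult_ind q j) n" for n
    by (rule exp_coeff_nonneg) (simp add: mult_ind_def)
  show 1: "exp_coeff (\<lambda>j. - mult_ind q j) (Suc n) \<le> 0" for n
    using exp_coeff_mult_ind[OF q, of "Suc n" "-1"] nn[of "Suc n - q"] by simp
  show "decseq (exp_coeff (\<lambda>j. 1 - mult_ind q j))"
    unfolding decseq_Suc_iff
  proof
    fix n
    have "exp_coeff (\<lambda>j. 1 - mult_ind q j) m = (\<Sum>i\<le>m. exp_coeff (\<lambda>j. - mult_ind q j) i)" for m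
      using exp_coeff_partial_sum[of "\<lambda>j. - mult_ind q j" m] by simp
    thus "exp_coeff (\<lambda>j. 1 - mult_ind q j) (Suc n) \<le> exp_coeff (\<lambda>j. 1 - mult_ind q j) n"
      using 1[of n] by simp
  qed
qed

lemma harm_le_ln:
  assumes "n \<ge> 1"
  shows "harm n \<le> 1 + ln (real n)"
proof -
  obtain m where m: "n = Suc m" using assms by (cases n) auto
  have "harm (Suc m) - ln (real (Suc m)) \<le> harm (Suc 0) - ln (real (Suc 0))"
    by (rule decseqD[OF decseq_harm_diff_ln]) simp
  thus ?thesis by (simp add: m harm_def)
qed

text \<open>The left side is the mean number of cycles with length divisible by \<open>q\<close>;
  over the multiples k = q m it is a harmonic sum divided by \<open>q\<close>.\<close>

lemma sum_mult_ind_le: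
  assumes q: "q \<ge> 1" and n: "n \<ge> 1"
  shows "(\<Sum>k=1..n. mult_ind q k / real k) \<le> (1 + ln (real n)) / real q"
proof -
  have "(\<Sum>k=1..n. mult_ind q k / real k) = (\<Sum>k\<in>{k\<in>{1..n}. q dvd k}. 1 / real k)"
    by (rule sum.mono_neutral_cong_right) (auto simp: mult_ind_def)
  also have "\<dots> = (\<Sum>m=1..n div q. 1 / real (q * m))"
  proof (rule sum.reindex_bij_witness[where i = "\<lambda>m. q * m" and j = "\<lambda>k. k div q"])
    fix k assume "k \<in> {k\<in>{1..n}. q dvd k}"
    thus "k div q \<in> {1..n div q}" "q * (k div q) = k" "1 / real (q * (k div q)) = 1 / real k"
      using q by (auto simp: div_le_mono Suc_le_eq dvd_imp_le div_greater_zero_iff)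
  next
    fix m assume m: "m \<in> {1..n div q}"
    thus "q * m div q = m" using q by simp
    have "q * m \<le> q * (n div q)" using m by simp
    also have "\<dots> \<le> n" by simp
    finally show "q * m \<in> {k\<in>{1..n}. q dvd k}" using m q by auto
  qed
  also have "\<dots> = (\<Sum>m=1..n div q. 1 / real m) / real q"
    by (simp add: sum_divide_distrib mult.commute)
  also have "(\<Sum>m=1..n div q. 1 / real m) \<le> (\<Sum>m=1..n. 1 / real m)"
    by (rule sum_mono2) (auto intro: order_trans[OF _ div_le_dividend])
  also have "(\<Sum>m=1..n. 1 / real m) = harm n" by (simp add: harm_def inverse_eq_divide)
  also have "harm n \<le> 1 + ln (real n)"
    by (rule harm_le_ln[OF n])
  finally show ?thesis by (simp add: divide_right_mono)
qed

text \<open>These coefficients are partial sums of nonnegative ones, hence increasing. So the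
  increment at n + 1 is at most the value at n times
  \<open>mult_ind q (Suc n) / real (Suc n)\<close>, and 1 + x \<le> exp x turns the resulting
  product into an exponential.\<close>

lemma exp_coeff_double_le:
  assumes q: "q \<ge> 1"
  shows "exp_coeff (\<lambda>j. 1 + mult_ind q j) n \<le> exp (\<Sum>k=1..n. mult_ind q k / real k)"
proof (induction n)
  case 0
  thus ?case by (simp add: exp_coeff_0)
next
  case (Suc n)
  let ?G = "exp_coeff (\<lambda>j. 1 + mult_ind q j)" and ?g = "exp_coeff (mult_ind q)"
  have G: "?G m = (\<Sum>i\<le>m. ?g i)" for m by (rule exp_coeff_partial_sum)
  have g: "?g i \<ge> 0" for i by (rule exp_coeff_nonneg) (simp add: mult_ind_def)
  have mono: "?G i \<le> ?G j" if "i \<le> j" for i j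
    unfolding G by (rule sum_mono2) (use that g in auto)
  have G0: "?G n \<ge> 0" unfolding G by (intro sum_nonneg g)
  have "?g (Suc n) = mult_ind q (Suc n) * ?G (Suc n - q) / real (Suc n)"
    using exp_coeff_mult_ind[OF q, of "Suc n" 1] by (simp add: mult_ind_def[of q "Suc n"])
  also have "\<dots> \<le> mult_ind q (Suc n) * ?G n / real (Suc n)"
    using q by (intro divide_right_mono mult_left_mono mono) (auto simp: mult_ind_def)
  finally have "?g (Suc n) \<le> ?G n * (mult_ind q (Suc n) / real (Suc n))"
    by (simp add: mult.commute)
  hence "?G (Suc n) \<le> ?G n * (1 + mult_ind q (Suc n) / real (Suc n))"
    unfolding G[of "Suc n"] by (simp add: G[of n, symmetric] algebra_simps)
  also have "\<dots> \<le> exp (\<Sum>k=1..n. mult_ind q k / real k) * exp (mult_ind q (Suc n) / real (Suc n))"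
    using Suc G0 by (intro mult_mono) (auto simp: mult_ind_def)
  also have "\<dots> = exp (\<Sum>k=1..Suc n. mult_ind q k / real k)" by (simp add: exp_add)
  finally show ?case .
qed

text \<open>
  With \<open>a\<close>, \<open>b\<close> the probabilities to avoid cycle lengths divisible by \<open>q\<close>, resp. \<open>q'\<close>, the generating
  function of the probabilities to avoid both is \<open>A(z) (1 - z\<^bsup>q'\<^esup>)\<^bsup>1/q'\<^esup> (1 - z\<^bsup>qq'\<^esup>)\<^bsup>-1/(qq')\<^esup>\<close>. All
  coefficients but the first of the second factor are nonpositive and \<open>a\<close> decreases, so the first
  two factors contribute at most \<open>a n * b n\<close>; the third one is \<open>1\<close> up to \<open>O(log n / (qq'))\<close>.
\<close>
lemma exp_coeff_avoid_both_le:
  assumes q: "q \<ge> 1" "q' \<ge> 1" and cop: "coprime q q'" and n: "n \<ge> 1"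
  shows "exp_coeff (\<lambda>j. (1 - mult_ind q j) * (1 - mult_ind q' j)) n
       \<le> exp_coeff (\<lambda>j. 1 - mult_ind q j) n * exp_coeff (\<lambda>j. 1 - mult_ind q' j) n + 2 * (1 + ln (real n)) / (real q * real q')"
proof -
  define a b e g c where "a = exp_coeff (\<lambda>j. 1 - mult_ind q j)" and "b = exp_coeff (\<lambda>j. 1 - mult_ind q' j)"
    and "e = exp_coeff (\<lambda>j. (1 - mult_ind q j) + - mult_ind q' j)" and "g = exp_coeff (mult_ind (q * q'))"
    and "c = exp_coeff (\<lambda>j. (1 - mult_ind q j) * (1 - mult_ind q' j))"
  define y where "y = (1 + ln (real n)) / (real q * real q')"
  have a0: "a 0 = 1" and b0: "b 0 = 1" by (simp_all add: a_def b_def exp_coeff_0)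
  have ann: "a m \<ge> 0" and bnn: "b m \<ge> 0" for m
    by (auto simp: a_def b_def mult_ind_def intro!: exp_coeff_nonneg)
  have adec: "a m \<le> a k" and bdec: "b m \<le> b k" if "k \<le> m" for m k
    using exp_coeff_avoid_decseq(2)[OF q(1)] exp_coeff_avoid_decseq(2)[OF q(2)] that
    by (auto simp: a_def b_def decseq_def)
  have a1: "a m \<le> 1" and b1: "b m \<le> 1" for m using adec[of 0 m] bdec[of 0 m] a0 b0 by auto
  have e_le: "e m \<le> a m * b m" for m
  proof -
    let ?\<beta> = "exp_coeff (\<lambda>j. - mult_ind q' j)"
    have "e m = (\<Sum>i\<le>m. ?\<beta> i * a (m - i))"
      unfolding e_def a_def exp_coeff_add[symmetric] by (simp add: add.commute)
    also have "\<dots> \<le> (\<Sum>i\<le>m. ?\<beta> i * a m)"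
    proof (rule sum_mono)
      fix i assume "i \<in> {..m}"
      show "?\<beta> i * a (m - i) \<le> ?\<beta> i * a m"
      proof (cases i)
        case (Suc k)
        thus ?thesis using exp_coeff_avoid_decseq(1)[OF q(2), of k] adec[of "m - i" m]
          by (intro mult_left_mono_neg) auto
      qed simp
    qed
    also have "\<dots> = a m * b m"
      using exp_coeff_partial_sum[of "\<lambda>j. - mult_ind q' j" m] by (simp add: b_def sum_distrib_left mult.commute[of _ "a m"])
    finally show ?thesis .
  qed
  have e1: "e m \<le> 1" for m
    using e_le[of m] mult_mono[OF a1[of m] b1[of m]] ann bnn by simp
  \<comment> \<open>Inclusion and exclusion: since \<open>q\<close> and \<open>q'\<close> are
    coprime, both divide \<open>j\<close> exactly if \<open>q * q'\<close> does. The last summand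
    produces the third factor of the generating function.\<close>
  have x: "(1 - mult_ind q j) * (1 - mult_ind q' j) = ((1 - mult_ind q j) + - mult_ind q' j) + mult_ind (q * q') j" for j
    using divides_mult[OF _ _ cop, of j] by (auto simp: mult_ind_def dest: dvd_mult_left dvd_mult_right)
  have gnn: "g i \<ge> 0" for i unfolding g_def by (rule exp_coeff_nonneg) (simp add: mult_ind_def)
  have G: "(\<Sum>i\<le>n. g i) \<le> exp y"
  proof -
    have qq: "q * q' \<ge> 1" using q by simp
    have "(\<Sum>i\<le>n. g i) = exp_coeff (\<lambda>j. 1 + mult_ind (q * q') j) n"
      by (simp add: exp_coeff_partial_sum g_def)
    also have "\<dots> \<le> exp (\<Sum>k=1..n. mult_ind (q * q') k / real k)"
      by (rule exp_coeff_double_le[OF qq])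
    also have "\<dots> \<le> exp y"
      using sum_mult_ind_le[OF qq n] by (simp add: y_def)
    finally show ?thesis .
  qed
  have y0: "y \<ge> 0" using n q by (simp add: y_def)
  \<comment> \<open>If y \<le> 1, the third factor costs at most exp y - 1 \<le> 2 y. If y > 1, the
    right side exceeds 1, and \<open>c n\<close> is at most 1.\<close>
  have "c n \<le> a n * b n + 2 * y"
  proof (cases "y \<le> 1")
    case True
    have "c n = (\<Sum>i\<le>n. g i * e (n - i))"
      unfolding c_def x e_def g_def exp_coeff_add[symmetric] by (simp add: add.commute)
    also have "\<dots> = e n + (\<Sum>i\<in>{..n} - {0}. g i * e (n - i))"
      by (subst sum.remove[of _ 0]) (auto simp: g_def exp_coeff_0)
    also have "(\<Sum>i\<in>{..n} - {0}. g i * e (n - i)) \<le> (\<Sum>i\<in>{..n} - {0}. g i * 1)"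
      by (intro sum_mono mult_left_mono e1 gnn)
    also have "\<dots> = (\<Sum>i\<le>n. g i) - 1"
      by (subst (2) sum.remove[of _ 0]) (auto simp: g_def exp_coeff_0)
    also have "\<dots> \<le> exp y - 1" using G by simp
    also have "\<dots> \<le> 2 * y"
      using exp_bound[OF y0 True] y0 True mult_left_mono[OF True y0] by (simp add: power2_eq_square)
    finally show ?thesis using e_le[of n] by linarith
  next
    case False
    have "c m \<le> 1" for m
    proof (induction m rule: less_induct)
      case (less m)
      show ?case
      proof (cases "m = 0")
        case False
        have "real m * c m = (\<Sum>i<m. c i * ((1 - mult_ind q (m - i)) * (1 - mult_ind q' (m - i))))"
          unfolding c_def using False by (subst exp_coeff_rec) auto
        also have "\<dots> \<le> (\<Sum>i<m. 1 * 1)"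
          using less by (intro sum_mono mult_mono) (auto simp: mult_ind_def)
        also have "\<dots> = real m" by simp
        finally show ?thesis using False by simp
      qed (simp add: c_def exp_coeff_0)
    qed
    hence "c n \<le> 1" .
    thus ?thesis using False ann[of n] bnn[of n] mult_nonneg_nonneg[of "a n" "b n"] by linarith
  qed
  thus ?thesis by (simp add: a_def b_def c_def y_def)
qed

section \<open>Multiplicative cycle statistics\<close>

definition cycle_prod :: "nat \<Rightarrow> (nat \<Rightarrow> 'a::field_char_0) \<Rightarrow> (nat \<Rightarrow> nat) \<Rightarrow> 'a" where
  "cycle_prod N x \<alpha> = (\<Prod>j=1..N. x j ^ \<alpha> j)"

lemma cycle_prod_add_cycle:
  assumes "j \<in> {1..N}"
  shows "cycle_prod N x (add_cycle j \<alpha>) = x j * cycle_prod N x \<alpha>"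
proof -
  have "cycle_prod N x (add_cycle j \<alpha>) = (\<Prod>i=1..N. x i ^ \<alpha> i * (if i = j then x i else 1))"
    unfolding cycle_prod_def by (rule prod.cong) (auto simp: add_cycle_def)
  thus ?thesis using assms by (simp add: prod.distrib cycle_prod_def mult.commute)
qed

text \<open>Adding a cycle of length j multiplies the product by \<open>x j\<close>, so the
  recurrence for averages becomes the defining recurrence of \<open>exp_coeff\<close>. In other
  words, this is the cycle index of the symmetric group.\<close>

lemma cyc_exp_cycle_prod:
  assumes "n \<le> N"
  shows "cyc_exp n (cycle_prod N x) = exp_coeff x n"
proof (rule exp_coeff_unique[OF _ _ assms])
  show "cyc_exp 0 (cycle_prod N x) = 1" by (simp add: cyc_exp_0 cycle_prod_def)
  fix m assume m: "1 \<le> m" "m \<le> N"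
  have "of_nat m * cyc_exp m (cycle_prod N x)
      = (\<Sum>j=1..m. cyc_exp (m - j) (\<lambda>\<alpha>. cycle_prod N x (add_cycle j \<alpha>)))"
    by (rule cyc_exp_recurrence[OF m(1)])
  also have "\<dots> = (\<Sum>j=1..m. cyc_exp (m - j) (cycle_prod N x) * x j)"
    by (rule sum.cong) (use m in \<open>auto simp: cycle_prod_add_cycle cyc_exp_cmult\<close>)
  also have "\<dots> = (\<Sum>i<m. cyc_exp i (cycle_prod N x) * x (m - i))"
    by (rule sum.reindex_bij_witness[where i = "\<lambda>i. m - i" and j = "\<lambda>j. m - j"]) auto
  finally show "of_nat m * cyc_exp m (cycle_prod N x) = (\<Sum>i<m. cyc_exp i (cycle_prod N x) * x (m - i))" .
qed

section \<open>The characteristic function of the sum of the logarithms of the cycle lengths\<close>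

definition npow :: "real \<Rightarrow> nat \<Rightarrow> complex" where
  "npow t j = cis (t * ln (real j))"

definition perm_chf :: "real \<Rightarrow> nat \<Rightarrow> complex" where
  "perm_chf t = exp_coeff (npow t)"

text \<open>
  The perturbed Poisson product. The factor \<open>8\<close> instead of \<open>1\<close> below the cosine makes it decay
  slowly enough that \<open>majorant t n * sqrt (n + 1)\<close> increases, which is what the convolutions in
  the error term need.
\<close>
definition majorant :: "real \<Rightarrow> nat \<Rightarrow> real" where
  "majorant t n = (\<Prod>k=1..n. 1 - (1 - cos (t * ln (real k))) / (8 * real k) + 51 * t\<^sup>2 * ln (real k) / real k)"

lemma norm_npow [simp]: "norm (npow t j) = 1"
  by (simp add: npow_def)

lemma npow_1 [simp]: "npow t (Suc 0) = 1"
  by (simp add: npow_def)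

lemma norm_cis_diff_le: "norm (cis a - cis b) \<le> \<bar>a - b\<bar>"
proof (rule power2_le_imp_le)
  have "(norm (cis a - cis b))\<^sup>2 = (cos a - cos b)\<^sup>2 + (sin a - sin b)\<^sup>2"
    by (simp add: cmod_power2)
  also have "\<dots> = 2 - 2 * cos (a - b)"
    using sin_cos_squared_add[of a] sin_cos_squared_add[of b]
    by (simp add: power2_eq_square algebra_simps cos_diff)
  also have "cos (a - b) = 1 - 2 * (sin ((a - b) / 2))\<^sup>2"
    using cos_double_sin[of "(a - b) / 2"] by (simp only: mult_2 field_sum_of_halves)
  also have "2 - 2 * \<dots> = 4 * (sin ((a - b) / 2))\<^sup>2" by simp
  also have "\<dots> \<le> 4 * ((a - b) / 2)\<^sup>2"
    using abs_sin_x_le_abs_x[of "(a - b) / 2"] by (simp only: abs_le_square_iff mult_left_mono)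
  also have "\<dots> = \<bar>a - b\<bar>\<^sup>2" by (simp add: power_divide)
  finally show "(norm (cis a - cis b))\<^sup>2 \<le> \<bar>a - b\<bar>\<^sup>2" .
qed simp

lemma norm_npow_step:
  assumes "k \<ge> 1"
  shows "norm (npow t (Suc k) - npow t k) \<le> \<bar>t\<bar> / real k"
proof -
  have "norm (npow t (Suc k) - npow t k) \<le> \<bar>t * (ln (real (Suc k)) - ln (real k))\<bar>"
    using norm_cis_diff_le[of "t * ln (real (Suc k))" "t * ln (real k)"]
    by (simp add: npow_def right_diff_distrib)
  also have "ln (real (Suc k)) - ln (real k) = ln (1 + 1 / real k)"
    using assms ln_div[of "real (Suc k)" "real k"] by (simp add: add_divide_distrib add.commute)
  also have "\<bar>t * ln (1 + 1 / real k)\<bar> = \<bar>t\<bar> * ln (1 + 1 / real k)"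
    using assms by (simp add: abs_mult)
  also have "\<dots> \<le> \<bar>t\<bar> * (1 / real k)"
    by (intro mult_left_mono ln_add_one_self_le_self) auto
  finally show ?thesis by simp
qed

lemma norm_npow_minus_1:
  assumes "k \<ge> 1"
  shows "norm (npow t k - 1) \<le> \<bar>t\<bar> * ln (real k)"
  using norm_cis_diff_le[of "t * ln (real k)" 0] assms by (simp add: npow_def abs_mult)

text \<open>Subtracting consecutive recurrences replaces the weights by their increments, and these
  telescope to \<open>npow t (Suc m) - 1\<close> because \<open>npow t 1 = 1\<close>. The first form
  isolates the Poisson factor and leaves differences of \<open>perm_chf\<close> in the error; the
  second form serves to bound those differences.\<close>

lemma perm_chf_difference:
  "of_nat (Suc m) * (perm_chf t (Suc m) - perm_chf t m) = (npow t (Suc m) - 1) * perm_chf t m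
     + (\<Sum>i<m. (npow t (Suc (m - i)) - npow t (m - i)) * (perm_chf t i - perm_chf t m))"
  "of_nat (Suc m) * (perm_chf t (Suc m) - perm_chf t m)
     = (\<Sum>i<m. (npow t (Suc (m - i)) - npow t (m - i)) * perm_chf t i)"
proof -
  let ?h = "perm_chf t" and ?y = "\<lambda>k. npow t (Suc k) - npow t k"
  have m: "of_nat m * ?h m = (\<Sum>i<m. ?h i * npow t (m - i))"
    using exp_coeff_rec[of m "npow t"] by (cases "m = 0") (auto simp: perm_chf_def)
  have "of_nat (Suc m) * ?h (Suc m) = (\<Sum>i<Suc m. ?h i * npow t (Suc m - i))"
    using exp_coeff_rec[of "Suc m" "npow t"] by (simp add: perm_chf_def)
  also have "\<dots> = ?h m + (\<Sum>i<m. ?h i * npow t (Suc (m - i)))"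
    by (simp add: Suc_diff_le)
  finally have "of_nat (Suc m) * (?h (Suc m) - ?h m)
      = (\<Sum>i<m. ?h i * npow t (Suc (m - i))) - (\<Sum>i<m. ?h i * npow t (m - i))"
    using m by (simp add: algebra_simps)
  also have "\<dots> = (\<Sum>i<m. ?y (m - i) * ?h i)"
    by (simp add: sum_subtractf[symmetric] algebra_simps)
  finally show 1: "of_nat (Suc m) * (?h (Suc m) - ?h m) = (\<Sum>i<m. ?y (m - i) * ?h i)" .
  have "(\<Sum>i<m. ?y (m - i)) = (\<Sum>j=1..<Suc m. npow t (Suc j) - npow t j)"
    by (rule sum.reindex_bij_witness[where i = "\<lambda>i. m - i" and j = "\<lambda>j. m - j"]) auto
  also have "\<dots> = npow t (Suc m) - 1"
    by (subst sum_Suc_diff') auto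
  finally have 2: "(\<Sum>i<m. ?y (m - i)) = npow t (Suc m) - 1" .
  have "(\<Sum>i<m. ?y (m - i) * ?h i) = (\<Sum>i<m. ?y (m - i)) * ?h m + (\<Sum>i<m. ?y (m - i) * (?h i - ?h m))"
    unfolding sum_distrib_right sum.distrib[symmetric]
    by (rule sum.cong) (auto simp: algebra_simps)
  thus "of_nat (Suc m) * (?h (Suc m) - ?h m) = (npow t (Suc m) - 1) * ?h m
     + (\<Sum>i<m. ?y (m - i) * (?h i - ?h m))" using 1 2 by simp
qed

section \<open>Growth of the majorant and convolution sums\<close>

lemma majorant_0 [simp]: "majorant t 0 = 1"
  by (simp add: majorant_def)

lemma majorant_Suc:
  "majorant t (Suc m) = majorant t m * (1 - (1 - cos (t * ln (real (Suc m)))) / (8 * real (Suc m))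
      + 51 * t\<^sup>2 * ln (real (Suc m)) / real (Suc m))"
  by (simp add: majorant_def)

text \<open>The cosine costs at most 2/(8 k) = 1/(4 k), and (1 - 1/(4 k))^2 \<ge> 1 - 1/(2 k) \<ge>
  k/(k + 1). With 1 in place of 8 the factor could be too small.\<close>

lemma majorant_factor_ge:
  assumes "k \<ge> 1"
  shows "1 - (1 - cos (t * ln (real k))) / (8 * real k) + 51 * t\<^sup>2 * ln (real k) / real k
     \<ge> sqrt (real k) / sqrt (real (Suc k))"
proof -
  have k: "real k \<ge> 1" using assms by simp
  have "sqrt (real k) / sqrt (real (Suc k)) = sqrt (real k / real (Suc k))" by (simp add: real_sqrt_divide)
  also have "\<dots> \<le> 1 - 1 / (4 * real k)"
  proof (rule real_le_lsqrt)
    show "0 \<le> 1 - 1 / (4 * real k)" using k by (simp add: field_simps)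
    have "real k / real (Suc k) = 1 - 1 / (real k + 1)" by (simp add: field_simps)
    also have "\<dots> \<le> 1 - 1 / (2 * real k)" using k by (simp add: frac_le)
    also have "\<dots> \<le> (1 - 1 / (4 * real k))\<^sup>2"
      by (simp add: power2_eq_square algebra_simps)
    finally show "real k / real (Suc k) \<le> (1 - 1 / (4 * real k))\<^sup>2" .
  qed
  moreover have "(1 - cos (t * ln (real k))) / (8 * real k) \<le> 2 / (8 * real k)"
    using cos_ge_minus_one[of "t * ln (real k)"] by (intro divide_right_mono) auto
  moreover have "51 * t\<^sup>2 * ln (real k) / real k \<ge> 0" using k by simp
  ultimately show ?thesis by linarith
qed

lemma majorant_pos: "majorant t n > 0"
  unfolding majorant_def
proof (rule prod_pos)
  fix k assume "k \<in> {1..n}"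
  hence k: "k \<ge> 1" by simp
  have "0 < sqrt (real k) / sqrt (real (Suc k))" using k by simp
  thus "0 < 1 - (1 - cos (t * ln (real k))) / (8 * real k) + 51 * t\<^sup>2 * ln (real k) / real k"
    using majorant_factor_ge[OF k, of t] by linarith
qed

text \<open>Allows the majorant at a smaller index \<open>i\<close> to be replaced by its value at
  \<open>m\<close>, at the price of sqrt((m + 1)/(i + 1)). The sums over \<open>i\<close> can absorb
  a singularity of this order.\<close>

lemma majorant_sqrt_mono: "i \<le> m \<Longrightarrow> majorant t i * sqrt (real (Suc i)) \<le> majorant t m * sqrt (real (Suc m))"
proof (induction m rule: dec_induct)
  case (step m)
  have "majorant t m * sqrt (real (Suc m)) = majorant t m * (sqrt (real (Suc m)) / sqrt (real (Suc (Suc m)))) * sqrt (real (Suc (Suc m)))"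
    by simp
  also have "\<dots> \<le> majorant t (Suc m) * sqrt (real (Suc (Suc m)))"
    unfolding majorant_Suc using majorant_factor_ge[of "Suc m" t] majorant_pos[of t m]
    by (intro mult_right_mono mult_left_mono) auto
  finally show ?case using step by simp
qed simp

lemma sum_inverse_sqrt_le: "(\<Sum>i<m. 1 / sqrt (real (Suc i))) \<le> 2 * sqrt (real m)"
proof (induction m)
  case (Suc m)
  let ?a = "sqrt (real m)" and ?b = "sqrt (real (Suc m))"
  have ab: "0 \<le> ?a" "?a \<le> ?b" "0 < ?b" "?b\<^sup>2 = ?a\<^sup>2 + 1" by auto
  have "1 = (?b - ?a) * (?b + ?a)" using ab(4) by (simp add: power2_eq_square algebra_simps)
  also have "\<dots> \<le> (?b - ?a) * (2 * ?b)" using ab by (intro mult_left_mono) auto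
  finally have "1 / ?b \<le> 2 * (?b - ?a)" using ab(3) by (simp add: field_simps)
  thus ?case using Suc by simp
qed simp

text \<open>A discrete form of the primitive -2/sqrt x of x^{-3/2}; the constant 4 leaves room for
  sqrt(x + 1) \<le> (3/2) sqrt x.\<close>

lemma inverse_pow32_le:
  fixes x :: real
  assumes "x \<ge> 1"
  shows "1 / (x * sqrt x) \<le> 4 * (1 / sqrt x - 1 / sqrt (x + 1))"
proof -
  define a b where "a = sqrt x" and "b = sqrt (x + 1)"
  have ab: "a \<ge> 1" "b > 0" "a \<le> b" "x = a\<^sup>2" "b\<^sup>2 = a\<^sup>2 + 1" using assms by (auto simp: a_def b_def)
  have "b \<le> 3 / 2 * a"
  proof (rule power2_le_imp_le)
    have "1 \<le> a\<^sup>2" using ab by simp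
    thus "b\<^sup>2 \<le> (3 / 2 * a)\<^sup>2" using ab(5) by (simp add: power_mult_distrib power2_eq_square)
  qed (use ab in auto)
  have "b * (a + b) \<le> (3 / 2 * a) * (a + 3 / 2 * a)"
    using \<open>b \<le> 3 / 2 * a\<close> ab by (intro mult_mono) auto
  also have "\<dots> \<le> 4 * a\<^sup>2" by (simp add: power2_eq_square)
  finally have 1: "b * (a + b) \<le> 4 * a\<^sup>2" .
  have "1 / a - 1 / b = (b - a) / (a * b)" using ab by (simp add: field_simps)
  also have "b - a = 1 / (a + b)" using ab by (simp add: field_simps power2_eq_square)
  finally have 2: "1 / a - 1 / b = 1 / (a * (b * (a + b)))" using ab by (simp add: field_simps)
  have "1 / (a\<^sup>2 * a) = 4 / (a * (4 * a\<^sup>2))" by simp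
  also have "\<dots> \<le> 4 / (a * (b * (a + b)))"
    using 1 ab by (intro divide_left_mono mult_left_mono mult_pos_pos) auto
  finally have "1 / (a\<^sup>2 * a) \<le> 4 * (1 / a - 1 / b)" using 2 by simp
  moreover have "a\<^sup>2 = x" using ab(4) by simp
  ultimately show ?thesis by (simp add: a_def b_def)
qed

text \<open>The difference on the right is kept on purpose: it is small when \<open>i\<close> is
  close to \<open>m\<close>, which compensates the factor 1/(m - i) in
  \<open>perm_chf_error\<close>.\<close>

lemma sum_pow32_le:
  assumes "i \<le> m"
  shows "(\<Sum>p=i..<m. 1 / (real (Suc p) * sqrt (real (Suc p)))) \<le> 4 * (1 / sqrt (real (Suc i)) - 1 / sqrt (real (Suc m)))"
proof -
  have "(\<Sum>p=i..<m. 1 / (real (Suc p) * sqrt (real (Suc p))))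
     \<le> (\<Sum>p=i..<m. - 4 / sqrt (real (Suc (Suc p))) - (- 4 / sqrt (real (Suc p))))"
  proof (rule sum_mono)
    fix p
    show "1 / (real (Suc p) * sqrt (real (Suc p))) \<le> - 4 / sqrt (real (Suc (Suc p))) - (- 4 / sqrt (real (Suc p)))"
      using inverse_pow32_le[of "real (Suc p)"] by (simp add: algebra_simps)
  qed
  also have "\<dots> = 4 * (1 / sqrt (real (Suc i)) - 1 / sqrt (real (Suc m)))"
    using sum_Suc_diff'[of i m "\<lambda>p. - 4 / sqrt (real (Suc p))"] assms by simp
  finally show ?thesis .
qed

text \<open>With a = sqrt(p + 1), b = sqrt(i + 1) and j = p - i one has a^2 = j + b^2 \<le> j + a b,
  hence a/(j b) \<le> 1/j + 1/(a b). This separates a harmonic sum from a sum of inverse square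
  roots.\<close>

lemma sum_harm_sqrt_le:
  "(\<Sum>i<p. sqrt (real (Suc p)) / (real (p - i) * sqrt (real (Suc i)))) \<le> 3 + ln (real (Suc p))"
proof -
  let ?N = "real (Suc p)"
  have "(\<Sum>i<p. sqrt ?N / (real (p - i) * sqrt (real (Suc i))))
     \<le> (\<Sum>i<p. 1 / real (p - i) + 1 / sqrt ?N * (1 / sqrt (real (Suc i))))"
  proof (rule sum_mono)
    fix i assume "i \<in> {..<p}"
    define j b a where "j = real (p - i)" and "b = sqrt (real (Suc i))" and "a = sqrt ?N"
    have jb: "j > 0" "b > 0" "b \<le> a" "a\<^sup>2 = j + b\<^sup>2"
      using \<open>i \<in> {..<p}\<close> by (auto simp: j_def b_def a_def of_nat_diff)
    have "a\<^sup>2 = j + b * b" using jb by (simp add: power2_eq_square)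
    also have "\<dots> \<le> j + a * b" using jb by (intro add_left_mono mult_right_mono) auto
    finally have "a * a \<le> a * b + j" by (simp add: power2_eq_square)
    thus "a / (j * b) \<le> 1 / j + 1 / a * (1 / b)"
      using jb by (simp add: field_simps)
  qed
  also have "\<dots> = (\<Sum>i<p. 1 / real (p - i)) + 1 / sqrt ?N * (\<Sum>i<p. 1 / sqrt (real (Suc i)))"
    by (simp add: sum.distrib sum_distrib_left)
  also have "(\<Sum>i<p. 1 / real (p - i)) = harm p"
    unfolding harm_def inverse_eq_divide
    by (rule sum.reindex_bij_witness[where i = "\<lambda>i. p - i" and j = "\<lambda>j. p - j"]) auto
  also have "harm p \<le> 1 + ln ?N"
  proof (cases "p = 0")
    case False
    hence "ln (real p) \<le> ln ?N" "harm p \<le> 1 + ln (real p)" using harm_le_ln[of p] by auto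
    thus ?thesis by linarith
  qed (simp add: harm_def)
  also have "1 / sqrt ?N * (\<Sum>i<p. 1 / sqrt (real (Suc i))) \<le> 1 / sqrt ?N * (2 * sqrt ?N)"
    using sum_inverse_sqrt_le[of p] by (intro mult_left_mono) (auto intro: order_trans)
  finally show ?thesis by simp
qed

text \<open>The difference formula is used twice. Its second form bounds one step by |t| log m times
  the majorant divided by the index; summed, this bounds the distance of values at \<open>i\<close>
  and \<open>m\<close>. Another |t|/(m - i) from the increments of \<open>npow\<close> gives t^2,
  with a single logarithm, and the majorant at \<open>m\<close> survives throughout by
  \<open>majorant_sqrt_mono\<close>.\<close>

lemma perm_chf_error:
  assumes le: "\<And>i. i \<le> m \<Longrightarrow> norm (perm_chf t i) \<le> majorant t i"
  shows "norm (\<Sum>i<m. (npow t (Suc (m - i)) - npow t (m - i)) * (perm_chf t i - perm_chf t m))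
      \<le> 48 * t\<^sup>2 * ln (real (Suc m)) * majorant t m"
proof (cases "m = 0")
  case False
  let ?h = "perm_chf t" and ?A = "majorant t"
  define \<Lambda> where "\<Lambda> = 3 + ln (real (Suc m))"
  have \<Lambda>: "\<Lambda> \<ge> 0" by (simp add: \<Lambda>_def)
  have step: "norm (?h (Suc p) - ?h p) \<le> \<bar>t\<bar> * \<Lambda> * ?A p / real (Suc p)" if p: "p < m" for p
  proof -
    have "real (Suc p) * norm (?h (Suc p) - ?h p) = norm (\<Sum>i<p. (npow t (Suc (p - i)) - npow t (p - i)) * ?h i)"
      using arg_cong[OF perm_chf_difference(2)[of p t], of norm] by (simp only: norm_mult norm_of_nat)
    also have "\<dots> \<le> (\<Sum>i<p. \<bar>t\<bar> * ?A p * (sqrt (real (Suc p)) / (real (p - i) * sqrt (real (Suc i)))))"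
    proof (rule order_trans[OF norm_sum sum_mono])
      fix i assume i: "i \<in> {..<p}"
      have "?A i \<le> ?A p * sqrt (real (Suc p)) / sqrt (real (Suc i))"
        using majorant_sqrt_mono[of i p t] i by (simp add: field_simps)
      hence "norm (?h i) \<le> ?A p * sqrt (real (Suc p)) / sqrt (real (Suc i))"
        using le[of i] i p by simp
      hence "norm (npow t (Suc (p - i)) - npow t (p - i)) * norm (?h i)
          \<le> \<bar>t\<bar> / real (p - i) * (?A p * sqrt (real (Suc p)) / sqrt (real (Suc i)))"
        using i by (intro mult_mono norm_npow_step) auto
      thus "norm ((npow t (Suc (p - i)) - npow t (p - i)) * ?h i)
          \<le> \<bar>t\<bar> * ?A p * (sqrt (real (Suc p)) / (real (p - i) * sqrt (real (Suc i))))"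
        by (simp add: norm_mult)
    qed
    also have "\<dots> = \<bar>t\<bar> * ?A p * (\<Sum>i<p. sqrt (real (Suc p)) / (real (p - i) * sqrt (real (Suc i))))"
      by (simp add: sum_distrib_left)
    also have "\<dots> \<le> \<bar>t\<bar> * ?A p * \<Lambda>"
    proof (rule mult_left_mono)
      have "ln (real (Suc p)) \<le> ln (real (Suc m))" using p by simp
      thus "(\<Sum>i<p. sqrt (real (Suc p)) / (real (p - i) * sqrt (real (Suc i)))) \<le> \<Lambda>"
        unfolding \<Lambda>_def by (intro order_trans[OF sum_harm_sqrt_le[of p]]) linarith
    qed (use majorant_pos[of t p] in auto)
    finally show ?thesis by (simp add: field_simps)
  qed
  have dist: "norm (?h i - ?h m) \<le> 4 * \<bar>t\<bar> * \<Lambda> * ?A m * (real (m - i) / (sqrt (real (Suc i)) * sqrt (real (Suc m))))"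
    if i: "i < m" for i
  proof -
    let ?a = "sqrt (real (Suc m))" and ?b = "sqrt (real (Suc i))"
    have "?h i - ?h m = - (\<Sum>p=i..<m. ?h (Suc p) - ?h p)"
      using sum_Suc_diff'[of i m ?h] i by simp
    hence "norm (?h i - ?h m) \<le> (\<Sum>p=i..<m. norm (?h (Suc p) - ?h p))"
      by (simp add: norm_sum)
    also have "\<dots> \<le> (\<Sum>p=i..<m. \<bar>t\<bar> * \<Lambda> * (?A m * ?a) * (1 / (real (Suc p) * sqrt (real (Suc p)))))"
    proof (rule sum_mono)
      fix p assume p: "p \<in> {i..<m}"
      have "?A p \<le> ?A m * ?a / sqrt (real (Suc p))"
        using majorant_sqrt_mono[of p m t] p by (simp add: field_simps)
      hence "\<bar>t\<bar> * \<Lambda> * ?A p / real (Suc p) \<le> \<bar>t\<bar> * \<Lambda> * (?A m * ?a / sqrt (real (Suc p))) / real (Suc p)"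
        using \<Lambda> by (intro divide_right_mono mult_left_mono) auto
      thus "norm (?h (Suc p) - ?h p) \<le> \<bar>t\<bar> * \<Lambda> * (?A m * ?a) * (1 / (real (Suc p) * sqrt (real (Suc p))))"
        using step[of p] p by (simp add: mult.commute)
    qed
    also have "\<dots> = \<bar>t\<bar> * \<Lambda> * (?A m * ?a) * (\<Sum>p=i..<m. 1 / (real (Suc p) * sqrt (real (Suc p))))"
      by (simp add: sum_distrib_left)
    also have "\<dots> \<le> \<bar>t\<bar> * \<Lambda> * (?A m * ?a) * (4 * (1 / ?b - 1 / ?a))"
      using i \<Lambda> majorant_pos[of t m] by (intro mult_left_mono sum_pow32_le) auto
    also have "\<dots> = \<bar>t\<bar> * \<Lambda> * ?A m * 4 * (?a * (1 / ?b - 1 / ?a))"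
      by (simp only: ac_simps)
    also have "\<dots> \<le> \<bar>t\<bar> * \<Lambda> * ?A m * 4 * (real (m - i) / (?b * ?a))"
    proof (rule mult_left_mono)
      define a b where "a = ?a" and "b = ?b"
      have ab: "0 < b" "b \<le> a" using i by (auto simp: a_def b_def)
      have d: "real (m - i) = a\<^sup>2 - b\<^sup>2" using i by (simp add: a_def b_def of_nat_diff)
      have "a * (1 / b - 1 / a) = (a * a - a * b) / (b * a)" using ab by (simp add: field_simps)
      also have "\<dots> \<le> (a * a - b * b) / (b * a)"
        using ab by (intro divide_right_mono diff_left_mono mult_right_mono) auto
      finally show "?a * (1 / ?b - 1 / ?a) \<le> real (m - i) / (?b * ?a)"
        unfolding d by (simp add: a_def b_def power2_eq_square)
    qed (use \<Lambda> majorant_pos[of t m] in auto)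
    finally show ?thesis by (simp add: ac_simps)
  qed
  have "norm (\<Sum>i<m. (npow t (Suc (m - i)) - npow t (m - i)) * (?h i - ?h m))
      \<le> (\<Sum>i<m. 4 * t\<^sup>2 * \<Lambda> * ?A m / sqrt (real (Suc m)) * (1 / sqrt (real (Suc i))))"
  proof (rule order_trans[OF norm_sum sum_mono])
    fix i assume i: "i \<in> {..<m}"
    have "norm ((npow t (Suc (m - i)) - npow t (m - i)) * (?h i - ?h m))
       \<le> \<bar>t\<bar> / real (m - i) * (4 * \<bar>t\<bar> * \<Lambda> * ?A m * (real (m - i) / (sqrt (real (Suc i)) * sqrt (real (Suc m)))))"
      unfolding norm_mult using i by (intro mult_mono norm_npow_step dist) auto
    also have "\<dots> = 4 * (\<bar>t\<bar> * \<bar>t\<bar>) * \<Lambda> * ?A m / sqrt (real (Suc m)) * (1 / sqrt (real (Suc i)))"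
      using i by (simp add: field_simps)
    finally show "norm ((npow t (Suc (m - i)) - npow t (m - i)) * (?h i - ?h m))
        \<le> 4 * t\<^sup>2 * \<Lambda> * ?A m / sqrt (real (Suc m)) * (1 / sqrt (real (Suc i)))"
      by (simp add: power2_eq_square)
  qed
  also have "\<dots> = 4 * t\<^sup>2 * \<Lambda> * ?A m / sqrt (real (Suc m)) * (\<Sum>i<m. 1 / sqrt (real (Suc i)))"
    by (simp only: sum_distrib_left)
  also have "\<dots> \<le> 4 * t\<^sup>2 * \<Lambda> * ?A m / sqrt (real (Suc m)) * (2 * sqrt (real (Suc m)))"
  proof (rule mult_left_mono)
    show "(\<Sum>i<m. 1 / sqrt (real (Suc i))) \<le> 2 * sqrt (real (Suc m))"
      using sum_inverse_sqrt_le[of m] by (rule order_trans) simp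
  qed (use \<Lambda> majorant_pos[of t m] in auto)
  also have "\<dots> = 8 * \<Lambda> * (t\<^sup>2 * ?A m)" by simp
  \<comment> \<open>8 (3 + x) \<le> 48 x holds for x \<ge> 3/5, and x = ln(m + 1) \<ge> ln 2 since m
    > 0. For m = 0 the sum is empty.\<close>
  also have "\<dots> \<le> 48 * ln (real (Suc m)) * (t\<^sup>2 * ?A m)"
  proof (rule mult_right_mono)
    have "3 / 5 \<le> ln (2 :: real)" using ln2_ge_two_thirds by simp
    also have "\<dots> \<le> ln (real (Suc m))" using False by simp
    finally show "8 * \<Lambda> \<le> 48 * ln (real (Suc m))" by (simp add: \<Lambda>_def)
  qed (use majorant_pos[of t m] in auto)
  finally show ?thesis by (simp add: ac_simps)
qed simp

section \<open>Comparison with the Poisson product\<close>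

lemma norm_exp_minus_1_minus_le: "norm (exp z - 1 - z) \<le> exp (norm z) * (norm z)\<^sup>2" for z :: complex
proof -
  have "norm (exp z - (\<Sum>k\<le>1. z ^ k / fact k)) \<le> exp \<bar>Re z\<bar> * (norm z) ^ Suc 1 / fact 1"
    by (rule Taylor_exp)
  also have "\<dots> \<le> exp (norm z) * (norm z)\<^sup>2"
    using abs_Re_le_cmod[of z] by (simp add: numeral_2_eq_2 mult_right_mono)
  finally show ?thesis by (simp add: algebra_simps)
qed

text \<open>Replacing the factor 1 + z by exp z, which multiplies up to the Poisson product, costs
  at most exp |z| |z|^2 \<le> 3 |z|^2 because |z| \<le> 1. Together with the 48 of
  \<open>perm_chf_error\<close> this is the 51 in \<open>majorant\<close>.\<close>

lemma perm_chf_step: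
  assumes le: "\<And>i. i \<le> m \<Longrightarrow> norm (perm_chf t i) \<le> majorant t i"
  shows "norm (perm_chf t (Suc m) - exp ((npow t (Suc m) - 1) / of_nat (Suc m)) * perm_chf t m)
      \<le> 51 * t\<^sup>2 * ln (real (Suc m)) / real (Suc m) * majorant t m"
proof -
  let ?n = "real (Suc m)"
  define E where "E = (\<Sum>i<m. (npow t (Suc (m - i)) - npow t (m - i)) * (perm_chf t i - perm_chf t m))"
  define z where "z = (npow t (Suc m) - 1) / of_nat (Suc m)"
  have nz: "(of_nat (Suc m) :: complex) \<noteq> 0" by (simp del: of_nat_Suc)
  have "perm_chf t (Suc m) = (1 + z) * perm_chf t m + E / of_nat (Suc m)"
  proof -
    have "of_nat (Suc m) * (perm_chf t (Suc m) - perm_chf t m) = (npow t (Suc m) - 1) * perm_chf t m + E"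
      unfolding E_def by (rule perm_chf_difference)
    thus ?thesis using nz unfolding z_def by (simp add: field_simps del: of_nat_Suc)
  qed
  hence "perm_chf t (Suc m) - exp z * perm_chf t m = E / of_nat (Suc m) - (exp z - 1 - z) * perm_chf t m"
    by (simp add: algebra_simps)
  hence "norm (perm_chf t (Suc m) - exp z * perm_chf t m) \<le> norm E / ?n + norm (exp z - 1 - z) * norm (perm_chf t m)"
    using norm_triangle_ineq4[of "E / of_nat (Suc m)" "(exp z - 1 - z) * perm_chf t m"]
    by (simp add: norm_divide norm_mult del: of_nat_Suc)
  also have "norm E / ?n \<le> 48 * t\<^sup>2 * ln ?n * majorant t m / ?n"
    unfolding E_def by (intro divide_right_mono perm_chf_error le) auto
  also have "norm (exp z - 1 - z) * norm (perm_chf t m) \<le> 3 * (t\<^sup>2 * ln ?n / ?n) * majorant t m"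
  proof (intro mult_mono le order_refl)
    have z1: "norm z \<le> 1"
    proof (cases "m = 0")
      case False
      have "norm z \<le> 2 / ?n"
        unfolding z_def norm_divide norm_of_nat
        by (intro divide_right_mono order_trans[OF norm_triangle_ineq4]) auto
      also have "\<dots> \<le> 1" using False by simp
      finally show ?thesis .
    qed (simp add: z_def)
    have "norm z \<le> \<bar>t\<bar> * ln ?n / ?n"
      unfolding z_def norm_divide norm_of_nat by (intro divide_right_mono norm_npow_minus_1) auto
    hence "(norm z)\<^sup>2 \<le> (\<bar>t\<bar> * ln ?n / ?n)\<^sup>2" by (intro power_mono) auto
    also have "\<dots> = t\<^sup>2 * ln ?n / ?n * (ln ?n / ?n)" by (simp add: power2_eq_square)
    also have "\<dots> \<le> t\<^sup>2 * ln ?n / ?n * 1"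
    proof (rule mult_left_mono)
      have "ln ?n \<le> ?n" using ln_bound[of ?n] by simp
      thus "ln ?n / ?n \<le> 1" by simp
    qed simp
    finally have b: "(norm z)\<^sup>2 \<le> t\<^sup>2 * ln ?n / ?n" by simp
    show "norm (exp z - 1 - z) \<le> 3 * (t\<^sup>2 * ln ?n / ?n)"
    proof -
      have "exp (norm z) \<le> exp 1" using z1 by simp
      hence "exp (norm z) \<le> 3" using exp_le by linarith
      hence "exp (norm z) * (norm z)\<^sup>2 \<le> 3 * (t\<^sup>2 * ln ?n / ?n)"
        using b by (intro mult_mono) auto
      thus ?thesis using norm_exp_minus_1_minus_le[of z] by linarith
    qed
  qed auto
  also have "48 * t\<^sup>2 * ln ?n * majorant t m / ?n + 3 * (t\<^sup>2 * ln ?n / ?n) * majorant t m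
      = 51 * t\<^sup>2 * ln ?n / ?n * majorant t m"
    by (simp add: field_simps del: of_nat_Suc)
  finally show ?thesis by (simp add: z_def)
qed

text \<open>The exponent has real part -y with 0 \<le> y \<le> 2, and exp(-y) \<le> 1/(1 + y) \<le>
  1 - y/8 in this range.\<close>

lemma norm_exp_npow_le:
  "norm (exp ((npow t (Suc m) - 1) / of_nat (Suc m))) \<le> 1 - (1 - cos (t * ln (real (Suc m)))) / (8 * real (Suc m))"
proof -
  define y where "y = (1 - cos (t * ln (real (Suc m)))) / real (Suc m)"
  have y0: "y \<ge> 0" by (simp add: y_def)
  have "y \<le> 2 / 1"
    unfolding y_def using cos_ge_minus_one[of "t * ln (real (Suc m))"] by (intro frac_le) auto
  hence y2: "y \<le> 2" by simp
  have re: "Re ((npow t (Suc m) - 1) / of_nat (Suc m)) = - y"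
    by (simp add: y_def npow_def Re_divide_of_nat field_simps del: of_nat_Suc)
  have "exp (- y) \<le> 1 / (1 + y)"
    using exp_ge_add_one_self[of y] y0 by (simp add: exp_minus field_simps)
  also have "\<dots> \<le> 1 - y / 8"
  proof -
    have "y * y \<le> y * 2" using y0 y2 by (intro mult_left_mono)
    hence "1 \<le> (1 - y / 8) * (1 + y)" using y0 by (simp add: algebra_simps)
    thus ?thesis using y0 by (simp add: field_simps)
  qed
  finally have "exp (- y) \<le> 1 - (1 - cos (t * ln (real (Suc m)))) / (8 * real (Suc m))"
    by (simp only: y_def divide_divide_eq_left mult.commute)
  thus ?thesis unfolding norm_exp_eq_Re re .
qed

text \<open>Each factor of the majorant is the bound of \<open>norm_exp_npow_le\<close> plus the
  relative error of \<open>perm_chf_step\<close>. Strong induction is required because the error at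
  one step involves all earlier values.\<close>

lemma perm_chf_le_majorant: "norm (perm_chf t n) \<le> majorant t n"
proof (induction n rule: less_induct)
  case (less n)
  show ?case
  proof (cases n)
    case 0
    thus ?thesis by (simp add: perm_chf_def exp_coeff_0)
  next
    case (Suc m)
    let ?e = "exp ((npow t (Suc m) - 1) / of_nat (Suc m))"
    have le: "\<And>i. i \<le> m \<Longrightarrow> norm (perm_chf t i) \<le> majorant t i" using less Suc by auto
    have "norm (perm_chf t n) \<le> norm (?e * perm_chf t m) + norm (perm_chf t (Suc m) - ?e * perm_chf t m)"
      using norm_triangle_ineq[of "?e * perm_chf t m" "perm_chf t (Suc m) - ?e * perm_chf t m"] Suc by simp
    also have "norm (?e * perm_chf t m) \<le> (1 - (1 - cos (t * ln (real (Suc m)))) / (8 * real (Suc m))) * majorant t m"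
      unfolding norm_mult by (rule mult_mono'[OF norm_exp_npow_le le]) auto
    also have "norm (perm_chf t (Suc m) - ?e * perm_chf t m) \<le> 51 * t\<^sup>2 * ln (real (Suc m)) / real (Suc m) * majorant t m"
      by (rule perm_chf_step[OF le])
    finally show ?thesis by (simp add: Suc majorant_Suc algebra_simps del: of_nat_Suc)
  qed
qed

definition poisson_chf :: "real \<Rightarrow> nat \<Rightarrow> complex" where
  "poisson_chf t n = exp (\<Sum>k=1..n. (npow t k - 1) / of_nat k)"

text \<open>The old error is multiplied by a number that the majorant's factor dominates, so
  relative to the majorant the errors simply add up. Each new one is measured at m instead of m + 1;
  as the majorant at m is at most twice that at m + 1, the constant becomes 102 = 2 * 51.\<close>

lemma perm_chf_minus_poisson_chf:
  "norm (perm_chf t n - poisson_chf t n) \<le> majorant t n * (102 * t\<^sup>2 * (\<Sum>k=1..n. ln (real k) / real k))"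
proof (induction n)
  case 0
  thus ?case by (simp add: poisson_chf_def perm_chf_def exp_coeff_0)
next
  case (Suc m)
  let ?e = "exp ((npow t (Suc m) - 1) / of_nat (Suc m))" and ?n = "real (Suc m)"
  define S where "S = 102 * t\<^sup>2 * (\<Sum>k=1..m. ln (real k) / real k)"
  define r where "r = 1 - (1 - cos (t * ln ?n)) / (8 * ?n)"
  define c where "c = 51 * t\<^sup>2 * ln ?n / ?n"
  have S0: "S \<ge> 0" unfolding S_def by (intro mult_nonneg_nonneg sum_nonneg) auto
  have c0: "c \<ge> 0" by (simp add: c_def)
  have A: "majorant t (Suc m) = majorant t m * (r + c)"
    unfolding majorant_Suc r_def c_def by simp
  have "perm_chf t (Suc m) - poisson_chf t (Suc m) = (perm_chf t (Suc m) - ?e * perm_chf t m) + ?e * (perm_chf t m - poisson_chf t m)"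
    by (simp add: poisson_chf_def exp_add algebra_simps del: of_nat_Suc)
  hence "norm (perm_chf t (Suc m) - poisson_chf t (Suc m)) \<le> norm (perm_chf t (Suc m) - ?e * perm_chf t m) + norm ?e * norm (perm_chf t m - poisson_chf t m)"
    by (metis norm_mult norm_triangle_ineq)
  also have "\<dots> \<le> c * majorant t m + r * (majorant t m * S)"
    unfolding c_def r_def using perm_chf_step[where m = m and t = t, OF perm_chf_le_majorant] norm_exp_npow_le[of t m] Suc
    by (intro add_mono mult_mono') (auto simp: S_def)
  also have "\<dots> \<le> c * (2 * majorant t (Suc m)) + majorant t (Suc m) * S"
  proof (intro add_mono)
    show "c * majorant t m \<le> c * (2 * majorant t (Suc m))"
    proof (rule mult_left_mono[OF _ c0])
      have "majorant t m * sqrt ?n \<le> majorant t (Suc m) * sqrt (real (Suc (Suc m)))"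
        by (rule majorant_sqrt_mono) simp
      also have "sqrt (real (Suc (Suc m))) \<le> sqrt (4 * ?n)" by (rule real_sqrt_le_mono) simp
      also have "sqrt (4 * ?n) = 2 * sqrt ?n" by (simp only: real_sqrt_mult real_sqrt_four)
      finally have "majorant t m * sqrt ?n \<le> 2 * majorant t (Suc m) * sqrt ?n"
        using majorant_pos[of t "Suc m"] by (simp add: mult_left_mono mult.assoc del: of_nat_Suc)
      thus "majorant t m \<le> 2 * majorant t (Suc m)" by (simp del: of_nat_Suc)
    qed
    have "r * (majorant t m * S) \<le> (r + c) * (majorant t m * S)"
      using c0 S0 majorant_pos[of t m] by (intro mult_right_mono) auto
    thus "r * (majorant t m * S) \<le> majorant t (Suc m) * S" by (simp add: A ac_simps)
  qed
  also have "\<dots> = majorant t (Suc m) * (102 * t\<^sup>2 * (\<Sum>k=1..Suc m. ln (real k) / real k))"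
    by (simp add: S_def c_def algebra_simps del: of_nat_Suc)
  finally show ?case .
qed

lemma majorant_le_exp:
  "majorant t n \<le> exp (- (\<Sum>k=1..n. (1 - cos (t * ln (real k))) / real k) / 8 + 51 * t\<^sup>2 * (\<Sum>k=1..n. ln (real k) / real k))"
proof -
  let ?u = "\<lambda>k. - ((1 - cos (t * ln (real k))) / (8 * real k)) + 51 * t\<^sup>2 * ln (real k) / real k"
  have "majorant t n \<le> (\<Prod>k=1..n. exp (?u k))"
    unfolding majorant_def
  proof (rule prod_mono, rule conjI)
    fix k assume "k \<in> {1..n}"
    hence k: "k \<ge> 1" by simp
    have "0 \<le> sqrt (real k) / sqrt (real (Suc k))" using k by simp
    thus "0 \<le> 1 - (1 - cos (t * ln (real k))) / (8 * real k) + 51 * t\<^sup>2 * ln (real k) / real k"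
      using majorant_factor_ge[OF k, of t] by linarith
    show "1 - (1 - cos (t * ln (real k))) / (8 * real k) + 51 * t\<^sup>2 * ln (real k) / real k \<le> exp (?u k)"
      using exp_ge_add_one_self[of "?u k"] by linarith
  qed
  also have "\<dots> = exp (\<Sum>k=1..n. ?u k)" by (simp add: exp_sum)
  also have "(\<Sum>k=1..n. ?u k) = - (\<Sum>k=1..n. (1 - cos (t * ln (real k))) / real k) / 8 + 51 * t\<^sup>2 * (\<Sum>k=1..n. ln (real k) / real k)"
    unfolding sum_negf[symmetric] sum_divide_distrib sum_distrib_left sum.distrib[symmetric]
    by (rule sum.cong) auto
  finally show ?thesis .
qed

section \<open>Its Edgeworth approximation\<close>

lemma power_exp_bound:
  fixes y a :: real
  assumes "y \<ge> 0" "a > 0"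
  shows "y ^ m * exp (- a * y) \<le> fact m / a ^ m"
proof -
  have "(a * y) ^ m /\<^sub>R fact m \<le> (\<Sum>k. (a * y) ^ k /\<^sub>R fact k)"
    using sum_le_suminf[OF summable_exp_generic[of "a * y"], of "{m}"] assms by simp
  hence "(a * y) ^ m / fact m \<le> exp (a * y)"
    by (simp add: exp_def divide_inverse mult.commute)
  thus ?thesis using assms by (simp add: exp_minus field_simps power_mult_distrib)
qed

lemma sum_ln_power:
  assumes m: "m \<ge> 1" and n: "n \<ge> 1"
  shows "\<bar>(\<Sum>k=1..n. ln (real k) ^ m / real k) - ln (real n) ^ Suc m / real (Suc m)\<bar> \<le> ln (real n) ^ m"
proof -
  define F where "F k = ln (real k) ^ Suc m / real (Suc m)" for k
  define G where "G k = ln (real k) ^ m" for k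
  have inc: "F (Suc k) - F k \<le> G (Suc k) / real (Suc k) + (G (Suc k) / real k - G (Suc k) / real (Suc k))"
    "G (Suc k) / real (Suc k) \<le> F (Suc k) - F k + (G (Suc k) - G k)" if k: "k \<ge> 1" for k
  proof -
    define a b where "a = ln (real k)" and "b = ln (real (Suc k))"
    have ab: "0 \<le> a" "a \<le> b" using k by (auto simp: a_def b_def)
    have d: "b - a = ln (1 + 1 / real k)"
      using k ln_div[of "real (Suc k)" "real k"] by (simp add: a_def b_def add_divide_distrib add.commute)
    have d1: "b - a \<le> 1 / real k" unfolding d by (rule ln_add_one_self_le_self) simp
    have d2: "1 / real (Suc k) \<le> b - a"
    proof -
      have "ln (real k / real (Suc k)) \<le> real k / real (Suc k) - 1" using k by (intro ln_le_minus_one) auto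
      also have "ln (real k / real (Suc k)) = a - b" using k by (simp add: ln_div a_def b_def)
      also have "real k / real (Suc k) - 1 = - (1 / real (Suc k))" by (simp add: field_simps)
      finally show ?thesis by simp
    qed
    have F: "real (Suc m) * (F (Suc k) - F k) = b ^ Suc m - a ^ Suc m"
      by (simp add: F_def a_def b_def right_diff_distrib del: of_nat_Suc)
    have "b ^ Suc m - a ^ Suc m = (b - a) * (\<Sum>i<Suc m. a ^ (m - i) * b ^ i)"
      by (subst power_diff_sumr2) (simp add: mult.commute)
    also have "(\<Sum>i<Suc m. a ^ (m - i) * b ^ i) \<le> (\<Sum>i<Suc m. b ^ m)"
    proof (rule sum_mono)
      fix i assume "i \<in> {..<Suc m}"
      hence "a ^ (m - i) * b ^ i \<le> b ^ (m - i) * b ^ i"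
        using ab by (intro mult_right_mono power_mono) auto
      also have "\<dots> = b ^ m" using \<open>i \<in> {..<Suc m}\<close> by (simp flip: power_add)
      finally show "a ^ (m - i) * b ^ i \<le> b ^ m" .
    qed
    finally have u: "b ^ Suc m - a ^ Suc m \<le> (b - a) * (real (Suc m) * b ^ m)"
      using ab by (simp add: mult_left_mono)
    have "(\<Sum>i<Suc m. a ^ m) \<le> (\<Sum>i<Suc m. a ^ (m - i) * b ^ i)"
    proof (rule sum_mono)
      fix i assume "i \<in> {..<Suc m}"
      hence "a ^ m = a ^ (m - i) * a ^ i" by (simp flip: power_add)
      also have "\<dots> \<le> a ^ (m - i) * b ^ i" using ab by (intro mult_left_mono power_mono) auto
      finally show "a ^ m \<le> a ^ (m - i) * b ^ i" .
    qed
    hence "(b - a) * (real (Suc m) * a ^ m) \<le> (b - a) * (\<Sum>i<Suc m. a ^ (m - i) * b ^ i)"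
      using ab by (intro mult_left_mono) auto
    also have "\<dots> = b ^ Suc m - a ^ Suc m"
      by (subst power_diff_sumr2) (simp add: mult.commute)
    finally have l: "(b - a) * (real (Suc m) * a ^ m) \<le> b ^ Suc m - a ^ Suc m" .
    have "real (Suc m) * (F (Suc k) - F k) \<le> real (Suc m) * ((b - a) * b ^ m)"
      using u F by (simp only: ac_simps)
    hence "F (Suc k) - F k \<le> (b - a) * b ^ m" by (simp only: mult_le_cancel_left_pos of_nat_0_less_iff zero_less_Suc)
    also have "\<dots> \<le> 1 / real k * b ^ m" using d1 ab by (intro mult_right_mono) auto
    finally show "F (Suc k) - F k \<le> G (Suc k) / real (Suc k) + (G (Suc k) / real k - G (Suc k) / real (Suc k))"
      by (simp add: G_def b_def)
    have "real (Suc m) * ((b - a) * a ^ m) \<le> real (Suc m) * (F (Suc k) - F k)"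
      using l F by (simp only: ac_simps)
    hence "(b - a) * a ^ m \<le> F (Suc k) - F k" by (simp only: mult_le_cancel_left_pos of_nat_0_less_iff zero_less_Suc)
    hence "1 / real (Suc k) * a ^ m \<le> F (Suc k) - F k"
      using mult_right_mono[OF d2, of "a ^ m"] ab by simp
    moreover have "1 / real (Suc k) * (b ^ m - a ^ m) \<le> 1 * (b ^ m - a ^ m)"
      using ab by (intro mult_right_mono) (auto intro: power_mono)
    moreover have "b ^ m / real (Suc k) = 1 / real (Suc k) * a ^ m + 1 / real (Suc k) * (b ^ m - a ^ m)"
      by (simp add: diff_divide_distrib)
    moreover have G: "G (Suc k) = b ^ m" "G k = a ^ m" by (simp_all add: G_def a_def b_def)
    ultimately have "b ^ m / real (Suc k) \<le> (F (Suc k) - F k) + 1 * (b ^ m - a ^ m)"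
      by (metis add_mono)
    thus "G (Suc k) / real (Suc k) \<le> F (Suc k) - F k + (G (Suc k) - G k)"
      unfolding G by simp
  qed
  have G1: "G 1 = 0" and F1: "F 1 = 0" using m by (auto simp: G_def F_def)
  have up: "(\<Sum>k=1..n. G k / real k) \<le> F n + G n"
    using n
  proof (induction n rule: dec_induct)
    case base
    show ?case by (simp add: F1[unfolded One_nat_def] G1[unfolded One_nat_def])
  next
    case (step k)
    thus ?case using inc(2)[of k] by simp
  qed
  \<comment> \<open>The factor 1 - 1/n lets the induction close: the loss G(k + 1) (1/k - 1/(k + 1))
    of a step is exactly its growth.\<close>
  have lo: "F n \<le> (\<Sum>k=1..n. G k / real k) + (1 - 1 / real n) * G n"
    using n
  proof (induction n rule: dec_induct)
    case base
    show ?case by (simp add: F1[unfolded One_nat_def] G1[unfolded One_nat_def])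
  next
    case (step k)
    have k: "k \<ge> 1" using step by simp
    have GG: "G k \<le> G (Suc k)" unfolding G_def using k by (intro power_mono) auto
    have "(1 - 1 / real k) * G k \<le> (1 - 1 / real k) * G (Suc k)"
      using k GG by (intro mult_left_mono) auto
    moreover have "(1 - 1 / real k) * G (Suc k) + (G (Suc k) / real k - G (Suc k) / real (Suc k)) = (1 - 1 / real (Suc k)) * G (Suc k)"
      by (simp add: algebra_simps)
    moreover have "F (Suc k) - F k \<le> G (Suc k) / real (Suc k) + (G (Suc k) / real k - G (Suc k) / real (Suc k))"
      by (rule inc(1)[OF k])
    ultimately show ?case using step.IH by (simp del: of_nat_Suc)
  qed
  have "(1 - 1 / real n) * G n \<le> 1 * G n" using n by (intro mult_right_mono) (auto simp: G_def)
  thus ?thesis using up lo unfolding F_def G_def by linarith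
qed

lemma sum_ln_over_le:
  assumes n: "n \<ge> 1" and L: "ln (real n) \<ge> 2"
  shows "(\<Sum>k=1..n. ln (real k) / real k) \<le> (ln (real n))\<^sup>2"
    and "(\<Sum>k=1..n. ln (real k) ^ 4 / real k) \<le> ln (real n) ^ 5"
proof -
  let ?L = "ln (real n)"
  have "(\<Sum>k=1..n. ln (real k) / real k) \<le> ?L\<^sup>2 / 2 + ?L"
    using sum_ln_power[of 1 n] n by (simp add: numeral_2_eq_2 abs_le_iff)
  moreover have "2 * ?L \<le> ?L\<^sup>2" using mult_right_mono[OF L, of ?L] L by (simp add: power2_eq_square)
  ultimately show "(\<Sum>k=1..n. ln (real k) / real k) \<le> ?L\<^sup>2" by linarith
  have "(\<Sum>k=1..n. ln (real k) ^ 4 / real k) \<le> ?L ^ 5 / 5 + ?L ^ 4"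
    using sum_ln_power[of 4 n] n by (simp add: eval_nat_numeral abs_le_iff)
  moreover have "2 * ?L ^ 4 \<le> ?L ^ 5"
    using mult_right_mono[OF L, of "?L ^ 4"] L by (simp add: eval_nat_numeral)
  moreover have "?L ^ 5 \<ge> 0" using L by simp
  ultimately show "(\<Sum>k=1..n. ln (real k) ^ 4 / real k) \<le> ?L ^ 5" by linarith
qed

section \<open>Lower bounds for the cosine sums\<close>

lemma one_minus_cos_ge:
  fixes y :: real
  assumes "\<bar>y\<bar> \<le> 1"
  shows "1 - cos y \<ge> y\<^sup>2 / 4"
proof -
  have "cos y = 1 - 2 * (sin (y / 2))\<^sup>2" using cos_double_sin[of "y / 2"] by simp
  moreover have "(sin (y / 2))\<^sup>2 \<ge> y\<^sup>2 / 8"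
  proof -
    have *: "sin z \<ge> 3 / 4 * z" if "0 \<le> z" "z \<le> 1 / 2" for z :: real
    proof -
      have "\<bar>sin z - (\<Sum>i<3. sin_coeff i * z ^ i)\<bar> \<le> inverse (fact 3) * \<bar>z\<bar> ^ 3"
        by (rule Maclaurin_sin_bound)
      hence "\<bar>sin z - z\<bar> \<le> z ^ 3 / 6"
        using that by (simp add: sin_coeff_def eval_nat_numeral lessThan_Suc)
      hence "sin z \<ge> z - z ^ 3 / 6" by linarith
      moreover have zz: "z\<^sup>2 \<le> 1 / 4"
        using power_mono[of z "1/2" 2] that by (simp add: power2_eq_square)
      moreover have "z ^ 3 \<le> z * (1 / 4)"
        using mult_left_mono[OF zz, of z] that by (simp add: power3_eq_cube power2_eq_square)
      ultimately show ?thesis using that by linarith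
    qed
    have "\<bar>sin (y / 2)\<bar> = sin \<bar>y / 2\<bar>"
    proof (cases "y \<ge> 0")
      case True
      thus ?thesis using *[of "y / 2"] assms by auto
    next
      case False
      thus ?thesis using *[of "- (y / 2)"] assms by auto
    qed
    also have "\<dots> \<ge> 3 / 4 * \<bar>y / 2\<bar>" using assms by (intro *) auto
    finally have "(3 / 4 * \<bar>y / 2\<bar>)\<^sup>2 \<le> \<bar>sin (y / 2)\<bar>\<^sup>2" by (intro power_mono) auto
    hence "9 / 64 * y\<^sup>2 \<le> (sin (y / 2))\<^sup>2" by (simp add: power_mult_distrib power_divide)
    thus ?thesis using zero_le_power2[of y] by linarith
  qed
  ultimately show ?thesis by simp
qed

text \<open>All terms are nonnegative, and only those up to \<open>M\<close>, with phases at most 1,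
  are estimated. \<open>M = n\<close> serves the central range; a smaller \<open>M\<close> serves
  larger arguments.\<close>

lemma sum_one_minus_cos_ge:
  assumes M: "1 \<le> M" "M \<le> n" and tM: "\<bar>t\<bar> * ln (real M) \<le> 1"
  shows "(\<Sum>k=1..n. (1 - cos (t * ln (real k))) / real k) \<ge> t\<^sup>2 / 4 * (ln (real M) ^ 3 / 3 - (ln (real M))\<^sup>2)"
proof -
  have "t\<^sup>2 / 4 * (ln (real M) ^ 3 / 3 - (ln (real M))\<^sup>2) \<le> t\<^sup>2 / 4 * (\<Sum>k=1..M. ln (real k) ^ 2 / real k)"
    using sum_ln_power[of 2 M] M by (intro mult_left_mono) (auto simp: numeral_3_eq_3 abs_le_iff)
  also have "\<dots> = (\<Sum>k=1..M. (t * ln (real k))\<^sup>2 / 4 / real k)"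
    by (simp add: sum_distrib_left power_mult_distrib)
  also have "\<dots> \<le> (\<Sum>k=1..M. (1 - cos (t * ln (real k))) / real k)"
  proof (intro sum_mono divide_right_mono one_minus_cos_ge)
    fix k assume k: "k \<in> {1..M}"
    hence "\<bar>t\<bar> * ln (real k) \<le> \<bar>t\<bar> * ln (real M)" by (intro mult_left_mono) auto
    thus "\<bar>t * ln (real k)\<bar> \<le> 1" using tM k by (simp add: abs_mult)
  qed auto
  also have "\<dots> \<le> (\<Sum>k=1..n. (1 - cos (t * ln (real k))) / real k)"
    by (rule sum_mono2) (use M in auto)
  finally show ?thesis .
qed

text \<open>The characteristic function at \<open>s\<close> of log P_n, centred at its mean and
  divided by log^{3/2} n/sqrt 3; the identification is \<open>scaled_chf_eq_average\<close>.\<close>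

definition scaled_chf :: "nat \<Rightarrow> real \<Rightarrow> complex" where
  "scaled_chf n s = (let t = sqrt 3 * s / ln (real n) powr (3/2)
     in cis (- t * (\<Sum>k=1..n. ln (real k) / real k)) * perm_chf t n)"

text \<open>One sixth of the skewness of the Poisson sum.\<close>

definition edge_coeff :: "nat \<Rightarrow> real" where
  "edge_coeff n = 3 powr (3/2) / (24 * sqrt (ln (real n)))"

text \<open>The Gaussian times 1 + kappa (i s)^3 with kappa = \<open>edge_coeff n\<close>, that is,
  the Fourier transform of the derivative of \<open>edge_cdf (edge_coeff n)\<close>.\<close>

definition edge_chf :: "nat \<Rightarrow> real \<Rightarrow> complex" where
  "edge_chf n s = of_real (exp (- s\<^sup>2 / 2)) * (1 - \<i> * of_real (edge_coeff n * s ^ 3))"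


section \<open>Cumulants and the ranges of the argument\<close>

lemma norm_exp_coeff_le_1:
  fixes x :: "nat \<Rightarrow> complex"
  assumes "\<And>j. norm (x j) \<le> 1"
  shows "norm (exp_coeff x n) \<le> 1"
proof (induction n rule: less_induct)
  case (less n)
  show ?case
  proof (cases "n = 0")
    case False
    have "real n * norm (exp_coeff x n) = norm (of_nat n * exp_coeff x n)" by (simp add: norm_mult)
    also have "\<dots> = norm (\<Sum>i<n. exp_coeff x i * x (n - i))" using False by (subst exp_coeff_rec) auto
    also have "\<dots> \<le> (\<Sum>i<n. norm (exp_coeff x i * x (n - i)))" by (rule norm_sum)
    also have "\<dots> \<le> (\<Sum>i<n. 1 * 1)"
      unfolding norm_mult using less assms by (intro sum_mono mult_mono) auto
    finally show ?thesis using False by simp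
  qed (simp add: exp_coeff_0)
qed

lemma norm_scaled_chf_eq: "norm (scaled_chf n s) = norm (perm_chf (sqrt 3 * s / ln (real n) powr (3/2)) n)"
  by (simp add: scaled_chf_def Let_def norm_mult)

lemma norm_scaled_chf_le_1: "norm (scaled_chf n s) \<le> 1"
  unfolding norm_scaled_chf_eq perm_chf_def by (rule norm_exp_coeff_le_1) simp

text \<open>The sum is the logarithm of the characteristic function of the centred Poisson sum. Its
  second and third cumulants are L^3/3 and L^4/4 up to the errors of \<open>sum_ln_power\<close>,
  whence the first two terms of the bound; the last one is the fourth order Taylor
  remainder.\<close>

lemma cumulant_expansion:
  assumes n: "n \<ge> 1" and L: "L = ln (real n)" "L \<ge> 2"
  shows "norm ((\<Sum>k=1..n. (npow t k - 1 - \<i> * of_real (t * ln (real k))) / of_nat k)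
     + of_real (t\<^sup>2 * L ^ 3 / 6) + \<i> * of_real (t ^ 3 * L ^ 4 / 24))
     \<le> t\<^sup>2 * L\<^sup>2 / 2 + \<bar>t\<bar> ^ 3 * L ^ 3 / 6 + t ^ 4 * L ^ 5 / 24"
proof -
  define M2 M3 M4 where "M2 = (\<Sum>k=1..n. ln (real k) ^ 2 / real k)"
    and "M3 = (\<Sum>k=1..n. ln (real k) ^ 3 / real k)" and "M4 = (\<Sum>k=1..n. ln (real k) ^ 4 / real k)"
  define W where "W = (\<Sum>k=1..n. (npow t k - 1 - \<i> * of_real (t * ln (real k))) / of_nat k)"
  have "W + of_real (t\<^sup>2 / 2 * M2) + \<i> * of_real (t ^ 3 / 6 * M3)
      = (\<Sum>k=1..n. (iexp (t * ln (real k)) - (\<Sum>i\<le>3. (\<i> * of_real (t * ln (real k))) ^ i / fact i)) / of_nat k)"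
    unfolding W_def M2_def M3_def sum_distrib_left of_real_sum sum.distrib[symmetric]
  proof (rule sum.cong[OF refl])
    fix k assume "k \<in> {1..n}"
    define x where "x = t * ln (real k)"
    have A: "(\<Sum>i\<le>3. (\<i> * of_real x) ^ i / fact i) = 1 + \<i> * of_real x - of_real (x\<^sup>2 / 2) - \<i> * of_real (x ^ 3 / 6)"
      by (simp add: atMost_Suc fact_numeral numeral_3_eq_3 power2_eq_square numeral_2_eq_2 field_simps)
    have B: "npow t k = iexp x" by (simp add: npow_def x_def cis_conv_exp)
    have C: "of_real (t\<^sup>2 / 2 * (ln (real k) ^ 2 / real k)) = of_real (x\<^sup>2 / 2) / (of_nat k :: complex)"
      by (simp add: x_def power_mult_distrib)
    have D: "of_real (t ^ 3 / 6 * (ln (real k) ^ 3 / real k)) = of_real (x ^ 3 / 6) / (of_nat k :: complex)"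
      by (simp add: x_def power_mult_distrib)
    show "(npow t k - 1 - \<i> * of_real (t * ln (real k))) / of_nat k
        + of_real (t\<^sup>2 / 2 * (ln (real k) ^ 2 / real k)) + \<i> * of_real (t ^ 3 / 6 * (ln (real k) ^ 3 / real k))
      = (iexp (t * ln (real k)) - (\<Sum>i\<le>3. (\<i> * of_real (t * ln (real k))) ^ i / fact i)) / of_nat k"
      unfolding C D B x_def[symmetric] A by (simp only: add_divide_distrib diff_divide_distrib times_divide_eq_right) simp
  qed
  also have "norm \<dots> \<le> (\<Sum>k=1..n. t ^ 4 / 24 * (ln (real k) ^ 4 / real k))"
  proof (rule order_trans[OF norm_sum sum_mono])
    fix k assume "k \<in> {1..n}"
    have "norm (iexp (t * ln (real k)) - (\<Sum>i\<le>3. (\<i> * of_real (t * ln (real k))) ^ i / fact i))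
        \<le> \<bar>t * ln (real k)\<bar> ^ Suc 3 / fact (Suc 3)" by (rule iexp_approx1)
    also have "\<dots> = t ^ 4 * ln (real k) ^ 4 / 24"
      by (simp add: power_mult_distrib abs_mult fact_numeral power_even_abs)
    finally show "norm ((iexp (t * ln (real k)) - (\<Sum>i\<le>3. (\<i> * of_real (t * ln (real k))) ^ i / fact i)) / of_nat k)
        \<le> t ^ 4 / 24 * (ln (real k) ^ 4 / real k)"
      using divide_right_mono[of _ "t ^ 4 * ln (real k) ^ 4 / 24" "real k"] by (simp add: norm_divide)
  qed
  also have "\<dots> = t ^ 4 / 24 * M4" by (simp only: M4_def sum_distrib_left)
  also have "\<dots> \<le> t ^ 4 / 24 * L ^ 5"
    using sum_ln_over_le(2)[OF n] L by (intro mult_left_mono) (auto simp: M4_def)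
  finally have 1: "norm (W + of_real (t\<^sup>2 / 2 * M2) + \<i> * of_real (t ^ 3 / 6 * M3)) \<le> t ^ 4 / 24 * L ^ 5" .
  have m2: "\<bar>M2 - L ^ 3 / 3\<bar> \<le> L\<^sup>2"
    using sum_ln_power[of 2 n] n by (simp add: M2_def L numeral_3_eq_3)
  have m3: "\<bar>M3 - L ^ 4 / 4\<bar> \<le> L ^ 3"
    using sum_ln_power[of 3 n] n by (simp add: M3_def L eval_nat_numeral)
  have tri: "norm (x - y - z) \<le> norm x + norm y + norm z" for x y z :: complex
    using norm_triangle_ineq4[of "x - y" z] norm_triangle_ineq4[of x y] by linarith
  have "W + of_real (t\<^sup>2 * L ^ 3 / 6) + \<i> * of_real (t ^ 3 * L ^ 4 / 24)
     = (W + of_real (t\<^sup>2 / 2 * M2) + \<i> * of_real (t ^ 3 / 6 * M3))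
       - of_real (t\<^sup>2 / 2 * (M2 - L ^ 3 / 3)) - \<i> * of_real (t ^ 3 / 6 * (M3 - L ^ 4 / 4))"
    by (simp add: algebra_simps)
  hence "norm (W + of_real (t\<^sup>2 * L ^ 3 / 6) + \<i> * of_real (t ^ 3 * L ^ 4 / 24))
     \<le> norm (W + of_real (t\<^sup>2 / 2 * M2) + \<i> * of_real (t ^ 3 / 6 * M3))
       + norm (of_real (t\<^sup>2 / 2 * (M2 - L ^ 3 / 3)) :: complex) + norm (\<i> * of_real (t ^ 3 / 6 * (M3 - L ^ 4 / 4)))"
    by (simp only: tri)
  also have "norm (of_real (t\<^sup>2 / 2 * (M2 - L ^ 3 / 3)) :: complex) = t\<^sup>2 / 2 * \<bar>M2 - L ^ 3 / 3\<bar>"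
    by (simp only: norm_of_real abs_mult) simp
  also have "norm (\<i> * of_real (t ^ 3 / 6 * (M3 - L ^ 4 / 4))) = \<bar>t\<bar> ^ 3 / 6 * \<bar>M3 - L ^ 4 / 4\<bar>"
    by (simp only: norm_mult norm_of_real abs_mult) (simp add: power_abs)
  also have "t\<^sup>2 / 2 * \<bar>M2 - L ^ 3 / 3\<bar> \<le> t\<^sup>2 / 2 * L\<^sup>2" using m2 by (intro mult_left_mono) auto
  also have "\<bar>t\<bar> ^ 3 / 6 * \<bar>M3 - L ^ 4 / 4\<bar> \<le> \<bar>t\<bar> ^ 3 / 6 * L ^ 3" using m3 by (intro mult_left_mono) auto
  finally show ?thesis using 1 unfolding W_def by simp
qed

lemma cis_poisson_chf:
  "cis (- t * (\<Sum>k=1..n. ln (real k) / real k)) * poisson_chf t n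
     = exp (\<Sum>k=1..n. (npow t k - 1 - \<i> * of_real (t * ln (real k))) / of_nat k)"
proof -
  have "cis (- t * (\<Sum>k=1..n. ln (real k) / real k)) = exp (\<Sum>k=1..n. - (\<i> * of_real (t * ln (real k))) / of_nat k)"
    unfolding cis_conv_exp sum_distrib_left of_real_sum by (intro arg_cong[where f = exp] sum.cong) auto
  hence "cis (- t * (\<Sum>k=1..n. ln (real k) / real k)) * poisson_chf t n
    = exp (\<Sum>k=1..n. - (\<i> * of_real (t * ln (real k))) / of_nat k + (npow t k - 1) / of_nat k)"
    by (simp only: poisson_chf_def exp_add sum.distrib)
  also have "\<dots> = exp (\<Sum>k=1..n. (npow t k - 1 - \<i> * of_real (t * ln (real k))) / of_nat k)"
    by (intro arg_cong[where f = exp] sum.cong) (auto simp: diff_divide_distrib)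
  finally show ?thesis .
qed

lemma sqrt3_le: "sqrt 3 \<le> 7 / 4"
  by (rule real_le_lsqrt) (simp_all add: power2_eq_square)

lemma scaled_t:
  assumes L: "L > 0" and t: "t = sqrt 3 * s / L powr (3/2)"
  shows "t\<^sup>2 = 3 * s\<^sup>2 / L ^ 3" "t = sqrt 3 * s / sqrt L ^ 3"
proof -
  have "L powr (3/2) = L powr (1 + 1/2)" by simp
  also have "\<dots> = sqrt L ^ 3"
    using L by (subst powr_add) (simp add: powr_half_sqrt power3_eq_cube)
  finally show 1: "t = sqrt 3 * s / sqrt L ^ 3" using t by simp
  show "t\<^sup>2 = 3 * s\<^sup>2 / L ^ 3"
  proof -
    have "(sqrt L ^ 3)\<^sup>2 = (sqrt L)\<^sup>2 ^ 3" by (simp only: power_mult[symmetric] mult.commute)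
    hence "(sqrt L ^ 3)\<^sup>2 = L ^ 3" using L by simp
    thus ?thesis unfolding 1 by (simp add: power_divide power_mult_distrib)
  qed
qed

lemma edge_coeff_eq: "ln (real n) \<ge> 0 \<Longrightarrow> edge_coeff n = sqrt 3 / (8 * sqrt (ln (real n)))"
proof -
  have "3 powr (3/2) = 3 powr (1 + 1/2 :: real)" by simp
  also have "\<dots> = 3 * sqrt 3" by (subst powr_add) (simp add: powr_half_sqrt)
  finally show ?thesis by (simp add: edge_coeff_def)
qed

text \<open>In the scaled variable t^2 L^2 = 3 s^2/L, so the growth 51 t^2 L^2 of the exponent is
  153 s^2/L.\<close>

lemma majorant_scaled_le:
  assumes n: "n \<ge> 1" and L: "L = ln (real n)" "L \<ge> 2" and t: "t = sqrt 3 * s / L powr (3/2)"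
  shows "majorant t n \<le> exp (- (\<Sum>k=1..n. (1 - cos (t * ln (real k))) / real k) / 8 + 153 * s\<^sup>2 / L)"
    and "t\<^sup>2 * (\<Sum>k=1..n. ln (real k) / real k) \<le> 3 * s\<^sup>2 / L"
proof -
  have "t\<^sup>2 * (\<Sum>k=1..n. ln (real k) / real k) \<le> t\<^sup>2 * L\<^sup>2"
    using sum_ln_over_le(1)[OF n] L by (intro mult_left_mono) auto
  also have "\<dots> = 3 * s\<^sup>2 / L"
    using L scaled_t(1)[OF _ t] by (simp add: power2_eq_square power3_eq_cube)
  finally show 1: "t\<^sup>2 * (\<Sum>k=1..n. ln (real k) / real k) \<le> 3 * s\<^sup>2 / L" .
  show "majorant t n \<le> exp (- (\<Sum>k=1..n. (1 - cos (t * ln (real k))) / real k) / 8 + 153 * s\<^sup>2 / L)"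
    by (rule order_trans[OF majorant_le_exp]) (use 1 in simp)
qed

text \<open>Two comparisons: with the Poisson product, where the constant is 102 * 3 from
  \<open>perm_chf_minus_poisson_chf\<close> times exp 39 from the majorant, and of the Poisson
  product with the Edgeworth term by cumulants, where it is 3. In this range the growth of the
  majorant is bounded.\<close>

lemma scaled_chf_central:
  assumes n: "n \<ge> 1" and L: "L = ln (real n)" "L \<ge> 100" and s: "\<bar>s\<bar> \<le> sqrt L / 2"
  shows "norm (scaled_chf n s - edge_chf n s) \<le> (306 * exp 39 + 3) / L * (s\<^sup>2 + s ^ 4 + s ^ 6) * exp (- s\<^sup>2 / 40)"
proof -
  define t where "t = sqrt 3 * s / L powr (3/2)"
  define a where "a = s\<^sup>2"
  have L0: "L > 0" using L by simp
  note t2 = scaled_t(1)[OF L0 t_def] and t1 = scaled_t(2)[OF L0 t_def]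
  have a0: "a \<ge> 0" by (simp add: a_def)
  have aL: "a \<le> L / 4"
  proof -
    have "\<bar>s\<bar>\<^sup>2 \<le> (sqrt L / 2)\<^sup>2" using s by (intro power_mono) auto
    thus ?thesis using L0 by (simp add: a_def power_divide)
  qed
  define w where "w = sqrt L"
  have w: "w > 0" "L = w\<^sup>2" using L0 by (auto simp: w_def)
  \<comment> \<open>The bound |s| \<le> sqrt L/2 is chosen for this: every phase t ln k with k \<le>
    n stays below 1.\<close>
  have tL: "\<bar>t\<bar> * L \<le> 1"
  proof -
    have "\<bar>t\<bar> * L = sqrt 3 * \<bar>s\<bar> / w"
      using w(1) unfolding t1 w_def[symmetric] w(2) by (simp add: abs_mult power2_eq_square power3_eq_cube)
    also have "\<dots> \<le> 7 / 4 * (w / 2) / w"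
      using s w(1) sqrt3_le by (intro divide_right_mono mult_mono) (auto simp: w_def)
    also have "\<dots> \<le> 1" using w by simp
    finally show ?thesis .
  qed
  define W where "W = (\<Sum>k=1..n. (npow t k - 1 - \<i> * of_real (t * ln (real k))) / of_nat k)"
  define \<kappa> where "\<kappa> = edge_coeff n"
  have \<kappa>: "\<kappa> = sqrt 3 / (8 * w)" using edge_coeff_eq[of n] L by (simp add: \<kappa>_def w_def)
  \<comment> \<open>What the exponent contains besides the Gaussian and the skewness term. It is
    O((a + a^2)/L) and also at most a/8, like the skewness term; so the perturbation
    \<open>z\<close> is at most a/4, and half of the Gaussian decay exp(-a/2) survives.\<close>
  define \<eta> where "\<eta> = W + of_real (a / 2) + \<i> * of_real (\<kappa> * s ^ 3)"
  have \<eta>: "norm \<eta> \<le> (2 * a + 3 / 8 * a\<^sup>2) / L"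
  proof -
    have "t\<^sup>2 * L ^ 3 / 6 = a / 2" using L0 by (simp add: t2 a_def)
    moreover have "t ^ 3 * L ^ 4 / 24 = \<kappa> * s ^ 3"
    proof -
      have "sqrt 3 ^ 3 = 3 * sqrt 3" by (simp add: power3_eq_cube)
      hence "t ^ 3 = 3 * sqrt 3 * s ^ 3 / w ^ 9"
        unfolding t1 w_def[symmetric] by (simp add: power_divide power_mult_distrib flip: power_mult)
      moreover have "L ^ 4 = w ^ 8" by (simp add: w(2) flip: power_mult)
      moreover have "w ^ 9 = w * w ^ 8" by (simp add: eval_nat_numeral)
      ultimately show ?thesis using w(1) by (simp add: \<kappa>)
    qed
    ultimately have "norm \<eta> \<le> t\<^sup>2 * L\<^sup>2 / 2 + \<bar>t\<bar> ^ 3 * L ^ 3 / 6 + t ^ 4 * L ^ 5 / 24"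
      using cumulant_expansion[OF n L(1), of t] L unfolding \<eta>_def W_def by simp
    also have "\<bar>t\<bar> ^ 3 * L ^ 3 = (t\<^sup>2 * L\<^sup>2) * (\<bar>t\<bar> * L)"
      by (simp add: power3_eq_cube power2_eq_square ac_simps)
    also have "\<dots> \<le> (t\<^sup>2 * L\<^sup>2) * 1" using tL by (intro mult_left_mono) auto
    also have "t ^ 4 * L ^ 5 = (t\<^sup>2)\<^sup>2 * L ^ 5" by simp
    also have "(t\<^sup>2)\<^sup>2 * L ^ 5 = 9 * a\<^sup>2 / L"
    proof -
      have "(t\<^sup>2)\<^sup>2 = 9 * a\<^sup>2 / (L * L ^ 5)"
        unfolding t2 a_def[symmetric] by (simp add: power_divide power_mult_distrib eval_nat_numeral)
      thus ?thesis using L0 by simp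
    qed
    also have "t\<^sup>2 * L\<^sup>2 = 3 * a / L"
      using L0 unfolding t2 a_def by (simp add: power2_eq_square power3_eq_cube)
    finally show ?thesis by (simp add: add_divide_distrib algebra_simps)
  qed
  have \<eta>a: "norm \<eta> \<le> a / 8"
  proof -
    have "2 * a + 3 / 8 * a\<^sup>2 \<le> 2 * a * (L / 100) + 3 / 8 * (a * (L / 4))"
      unfolding power2_eq_square using a0 aL L mult_left_mono[of 100 L a] by (intro add_mono mult_left_mono) auto
    also have "\<dots> \<le> a / 8 * L" using a0 L0 by (simp add: algebra_simps)
    finally have "(2 * a + 3 / 8 * a\<^sup>2) / L \<le> a / 8" using L0 by (simp add: divide_le_eq)
    thus ?thesis using \<eta> by linarith
  qed
  define z where "z = \<eta> - \<i> * of_real (\<kappa> * s ^ 3)"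
  have \<kappa>s: "norm (\<i> * of_real (\<kappa> * s ^ 3)) = \<kappa> * \<bar>s\<bar> ^ 3"
    using w by (simp add: \<kappa> norm_mult norm_divide norm_power abs_mult power_abs)
  have \<kappa>sa: "\<kappa> * \<bar>s\<bar> ^ 3 \<le> a / 8"
  proof -
    have "\<kappa> * \<bar>s\<bar> ^ 3 = sqrt 3 / 8 * (\<bar>s\<bar> / w) * a" by (simp add: \<kappa> a_def power3_eq_cube power2_eq_square)
    also have "\<dots> \<le> (7 / 4) / 8 * (1 / 2) * a"
      using s w(1) a0 sqrt3_le by (intro mult_right_mono mult_mono) (auto simp: w_def divide_le_eq)
    also have "\<dots> \<le> a / 8" using a0 by simp
    finally show ?thesis .
  qed
  have za: "norm z \<le> a / 4"
    using norm_triangle_ineq4[of \<eta> "\<i> * of_real (\<kappa> * s ^ 3)"] \<eta>a \<kappa>sa \<kappa>s unfolding z_def by linarith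
  have z2: "(norm z)\<^sup>2 \<le> (3 / 32 * a ^ 3) / L + a / 4 * norm \<eta>"
  proof -
    have "norm z \<le> norm \<eta> + \<kappa> * \<bar>s\<bar> ^ 3"
      using norm_triangle_ineq4[of \<eta> "\<i> * of_real (\<kappa> * s ^ 3)"] \<kappa>s unfolding z_def by linarith
    hence "(norm z)\<^sup>2 \<le> (norm \<eta> + \<kappa> * \<bar>s\<bar> ^ 3)\<^sup>2" by (intro power_mono) auto
    also have "\<dots> \<le> 2 * (norm \<eta>)\<^sup>2 + 2 * (\<kappa> * \<bar>s\<bar> ^ 3)\<^sup>2"
      using sum_squares_bound[of "norm \<eta>" "\<kappa> * \<bar>s\<bar> ^ 3"] by (simp add: power2_sum)
    also have "(norm \<eta>)\<^sup>2 \<le> a / 8 * norm \<eta>"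
      unfolding power2_eq_square using \<eta>a by (intro mult_right_mono) auto
    also have "(\<kappa> * \<bar>s\<bar> ^ 3)\<^sup>2 = 3 / 64 * a ^ 3 / L"
    proof -
      have "\<kappa>\<^sup>2 = 3 / (64 * L)" using w by (simp add: \<kappa> power_divide power_mult_distrib)
      moreover have "(\<bar>s\<bar> ^ 3)\<^sup>2 = a ^ 3"
        unfolding a_def by (simp add: power_mult[symmetric] mult.commute power_even_abs)
      ultimately show ?thesis by (simp add: power_mult_distrib)
    qed
    finally show ?thesis by simp
  qed
  have edge: "norm (exp W - edge_chf n s) \<le> 3 / L * (a + a\<^sup>2 + a ^ 3) * exp (- a / 40)"
  proof -
    have W: "W = of_real (- a / 2) + z" by (simp add: z_def \<eta>_def)
    have "exp W - edge_chf n s = of_real (exp (- a / 2)) * ((exp z - 1 - z) + \<eta>)"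
      unfolding W exp_add edge_chf_def \<kappa>_def[symmetric] a_def[symmetric] exp_of_real z_def
      by (simp add: algebra_simps)
    hence "norm (exp W - edge_chf n s) = exp (- a / 2) * norm ((exp z - 1 - z) + \<eta>)" by (simp add: norm_mult)
    also have "\<dots> \<le> exp (- a / 2) * (exp (a / 4) * (norm z)\<^sup>2 + exp (a / 4) * norm \<eta>)"
    proof (intro mult_left_mono order_trans[OF norm_triangle_ineq] add_mono)
      show "norm (exp z - 1 - z) \<le> exp (a / 4) * (norm z)\<^sup>2"
        by (rule order_trans[OF norm_exp_minus_1_minus_le]) (use za in \<open>auto intro: mult_right_mono\<close>)
      have "1 * norm \<eta> \<le> exp (a / 4) * norm \<eta>" using a0 by (intro mult_right_mono) auto
      thus "norm \<eta> \<le> exp (a / 4) * norm \<eta>" by simp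
    qed auto
    also have "\<dots> = exp (- a / 4) * ((norm z)\<^sup>2 + norm \<eta>)"
    proof -
      have "exp (- a / 2) * exp (a / 4) = exp (- a / 4)" by (simp flip: exp_add)
      thus ?thesis by (metis distrib_left mult.assoc)
    qed
    also have "\<dots> \<le> exp (- a / 4) * ((3 / 32 * a ^ 3) / L + (1 + a / 4) * ((2 * a + 3 / 8 * a\<^sup>2) / L))"
    proof (rule mult_left_mono)
      have "(norm z)\<^sup>2 + norm \<eta> \<le> (3 / 32 * a ^ 3) / L + (1 + a / 4) * norm \<eta>"
        using z2 by (simp add: algebra_simps)
      also have "(1 + a / 4) * norm \<eta> \<le> (1 + a / 4) * ((2 * a + 3 / 8 * a\<^sup>2) / L)"
        using \<eta> a0 by (intro mult_left_mono) auto
      finally show "(norm z)\<^sup>2 + norm \<eta> \<le> (3 / 32 * a ^ 3) / L + (1 + a / 4) * ((2 * a + 3 / 8 * a\<^sup>2) / L)" by simp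
    qed auto
    also have "(3 / 32 * a ^ 3) / L + (1 + a / 4) * ((2 * a + 3 / 8 * a\<^sup>2) / L)
        = ((3 / 32 * a ^ 3) + (1 + a / 4) * (2 * a + 3 / 8 * a\<^sup>2)) / L"
      by (metis add_divide_distrib times_divide_eq_right)
    also have "\<dots> \<le> (3 * (a + a\<^sup>2 + a ^ 3)) / L"
    proof (rule divide_right_mono)
      have "(3 / 32 * a ^ 3) + (1 + a / 4) * (2 * a + 3 / 8 * a\<^sup>2) = 2 * a + 7 / 8 * a\<^sup>2 + 3 / 16 * a ^ 3"
        by (simp add: field_simps power2_eq_square power3_eq_cube)
      also have "\<dots> \<le> 3 * a + 3 * a\<^sup>2 + 3 * a ^ 3" using a0 by (intro add_mono mult_right_mono) auto
      finally show "(3 / 32 * a ^ 3) + (1 + a / 4) * (2 * a + 3 / 8 * a\<^sup>2) \<le> 3 * (a + a\<^sup>2 + a ^ 3)" by simp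
    qed (use L0 in auto)
    finally have "norm (exp W - edge_chf n s) \<le> exp (- a / 4) * (3 * (a + a\<^sup>2 + a ^ 3) / L)"
      by (simp add: mult_left_mono)
    also have "\<dots> \<le> exp (- a / 40) * (3 * (a + a\<^sup>2 + a ^ 3) / L)"
      using a0 L0 by (intro mult_right_mono) auto
    finally show ?thesis by (simp add: mult.commute)
  qed
  have h: "norm (scaled_chf n s - exp W) \<le> (306 * exp 39) / L * a * exp (- a / 40)"
  proof -
    let ?S = "(\<Sum>k=1..n. (1 - cos (t * ln (real k))) / real k)"
    have S: "a / 5 \<le> ?S"
    proof -
      have "a / 5 \<le> 3 / 4 * a * (1 / 3 - 1 / L)"
      proof -
        have "1 / L \<le> 1 / 100" using L by (intro divide_left_mono) auto
        hence "a * (1 / 5) \<le> a * (3 / 4 * (1 / 3 - 1 / L))" using a0 by (intro mult_left_mono) auto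
        moreover have "a * (1 / 5) = a / 5" "a * (3 / 4 * (1 / 3 - 1 / L)) = 3 / 4 * a * (1 / 3 - 1 / L)"
          by (simp, simp only: ac_simps)
        ultimately show ?thesis by (simp only:)
      qed
      also have "\<dots> = t\<^sup>2 / 4 * (L ^ 3 / 3 - L\<^sup>2)"
        using L0 unfolding t2 a_def[symmetric] by (simp add: field_simps power2_eq_square power3_eq_cube)
      also have "\<dots> \<le> ?S" using sum_one_minus_cos_ge[of n n t] n tL L by simp
      finally show ?thesis .
    qed
    have "scaled_chf n s - exp W = cis (- t * (\<Sum>k=1..n. ln (real k) / real k)) * (perm_chf t n - poisson_chf t n)"
      unfolding scaled_chf_def Let_def W_def cis_poisson_chf[symmetric] L(1)[symmetric] t_def[symmetric]
      by (simp add: algebra_simps)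
    hence "norm (scaled_chf n s - exp W) = norm (perm_chf t n - poisson_chf t n)" by (simp add: norm_mult)
    also have "\<dots> \<le> majorant t n * (102 * t\<^sup>2 * (\<Sum>k=1..n. ln (real k) / real k))"
      by (rule perm_chf_minus_poisson_chf)
    \<comment> \<open>The cosine sum is at least a/5, which gives the decay a/40 after division by
      8; a \<le> L/4 bounds the growth 153 a/L by 39.\<close>
    also have "\<dots> \<le> exp (39 - a / 40) * (102 * (3 * a / L))"
    proof (rule mult_mono)
      have "153 * a / L \<le> 39"
        using aL L0 by (simp add: divide_le_eq)
      hence "- ?S / 8 + 153 * a / L \<le> 39 - a / 40" using S by simp
      thus "majorant t n \<le> exp (39 - a / 40)"
        using majorant_scaled_le(1)[OF n L(1) _ t_def] L by (simp add: a_def order_trans)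
      show "102 * t\<^sup>2 * (\<Sum>k=1..n. ln (real k) / real k) \<le> 102 * (3 * a / L)"
        using majorant_scaled_le(2)[OF n L(1) _ t_def] L by (simp add: a_def)
    qed (auto intro!: mult_nonneg_nonneg sum_nonneg)
    also have "exp (39 - a / 40) = exp 39 * exp (- a / 40)" by (simp flip: exp_add)
    finally show ?thesis by (simp add: ac_simps)
  qed
  have "norm (scaled_chf n s - edge_chf n s) \<le> norm (scaled_chf n s - exp W) + norm (exp W - edge_chf n s)"
    using norm_triangle_ineq[of "scaled_chf n s - exp W" "exp W - edge_chf n s"] by simp
  also have "\<dots> \<le> (306 * exp 39) / L * (a + a\<^sup>2 + a ^ 3) * exp (- a / 40) + 3 / L * (a + a\<^sup>2 + a ^ 3) * exp (- a / 40)"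
  proof (intro add_mono edge order_trans[OF h] mult_right_mono mult_left_mono)
    show "a \<le> a + a\<^sup>2 + a ^ 3" using a0 by simp
  qed (use L0 in auto)
  also have "\<dots> = (306 * exp 39 + 3) / L * (s\<^sup>2 + s ^ 4 + s ^ 6) * exp (- s\<^sup>2 / 40)"
  proof -
    have "a = s\<^sup>2" "a\<^sup>2 = s ^ 4" "a ^ 3 = s ^ 6" by (simp_all add: a_def flip: power_mult)
    thus ?thesis by (simp only: add_divide_distrib distrib_right)
  qed
  finally show ?thesis .
qed

lemma abs_le_1_plus_square: "\<bar>s\<bar> \<le> 1 + s\<^sup>2" for s :: real
proof -
  have "0 \<le> (\<bar>s\<bar> - 1)\<^sup>2" by simp
  hence "2 * \<bar>s\<bar> \<le> 1 + s\<^sup>2" by (simp add: power2_eq_square algebra_simps)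
  thus ?thesis using abs_ge_zero[of s] by linarith
qed

lemma edge_coeff_bounds:
  assumes "ln (real n) \<ge> 1"
  shows "0 \<le> edge_coeff n" "edge_coeff n \<le> 1"
proof -
  have "edge_coeff n = sqrt 3 / 8 * (1 / sqrt (ln (real n)))" using assms by (simp add: edge_coeff_eq)
  also have "\<dots> \<le> 7 / 4 / 8 * 1"
    using assms sqrt3_le by (intro mult_mono divide_right_mono) auto
  finally show "edge_coeff n \<le> 1" by simp
  show "0 \<le> edge_coeff n" using assms by (simp add: edge_coeff_eq)
qed

lemma norm_edge_chf_le:
  assumes "ln (real n) \<ge> 1"
  shows "norm (edge_chf n s) \<le> 2 * (1 + s\<^sup>2) ^ 2 * exp (- s\<^sup>2 / 2)"
proof -
  note \<kappa> = edge_coeff_bounds[OF assms]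
  note s1 = abs_le_1_plus_square[of s]
  have "norm (1 - \<i> * of_real (edge_coeff n * s ^ 3)) \<le> 1 + edge_coeff n * \<bar>s\<bar> ^ 3"
    by (rule order_trans[OF norm_triangle_ineq4]) (use \<kappa> in \<open>simp add: norm_mult norm_power abs_mult power_abs\<close>)
  also have "edge_coeff n * \<bar>s\<bar> ^ 3 \<le> 1 * (\<bar>s\<bar> * \<bar>s\<bar>\<^sup>2)"
    using \<kappa> by (intro mult_mono) (auto simp: power3_eq_cube power2_eq_square)
  also have "\<bar>s\<bar> * \<bar>s\<bar>\<^sup>2 \<le> (1 + s\<^sup>2) * (1 + s\<^sup>2)"
    using s1 by (intro mult_mono) auto
  also have "1 + 1 * ((1 + s\<^sup>2) * (1 + s\<^sup>2)) \<le> 2 * (1 + s\<^sup>2) ^ 2"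
    using mult_mono[of 1 "1 + s\<^sup>2" 1 "1 + s\<^sup>2"] by (simp add: power2_eq_square)
  finally have "norm (1 - \<i> * of_real (edge_coeff n * s ^ 3)) \<le> 2 * (1 + s\<^sup>2) ^ 2" by simp
  hence "exp (- s\<^sup>2 / 2) * norm (1 - \<i> * of_real (edge_coeff n * s ^ 3)) \<le> exp (- s\<^sup>2 / 2) * (2 * (1 + s\<^sup>2) ^ 2)"
    by (intro mult_left_mono) auto
  thus ?thesis by (simp add: edge_chf_def norm_mult mult.commute)
qed

text \<open>
  Here the phases \<open>t ln k\<close> exceed \<open>1\<close> for large \<open>k\<close>; the indices with \<open>ln k \<le> v\<close>, where \<open>t v\<close> is
  just below \<open>1\<close>, already produce enough decay.
\<close>
lemma scaled_chf_intermediate: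
  assumes n: "n \<ge> 1" and L: "L = ln (real n)" "L \<ge> 1000"
    and s: "sqrt L / 2 \<le> \<bar>s\<bar>" "\<bar>s\<bar> \<le> L powr (4/5)"
  shows "norm (scaled_chf n s) \<le> exp (- (L powr (7/10)) / 4096 + 153 * L powr (3/5))"
proof -
  define t where "t = sqrt 3 * s / L powr (3/2)"
  have L0: "L > 0" using L by simp
  have t2: "t\<^sup>2 = 3 * s\<^sup>2 / L ^ 3" by (rule scaled_t(1)[OF L0 t_def])
  have "0 < sqrt L / 2" using L0 by simp
  hence sp: "\<bar>s\<bar> > 0" using s(1) by linarith
  \<comment> \<open>Half of L^{3/2}/|s|: this gives |t| v = sqrt 3/2 < 1, and |s| \<ge> sqrt L/2
    becomes v \<le> L, so that exp v does not exceed n.\<close>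
  define v where "v = L powr (3/2) / (2 * \<bar>s\<bar>)"
  have tv: "\<bar>t\<bar> * v = sqrt 3 / 2" using sp L0 by (simp add: t_def v_def abs_mult)
  have vL: "v \<le> L"
  proof -
    have "L powr (3/2) = L powr (1 + 1/2)" by simp
    also have "\<dots> = L * sqrt L" using L0 by (subst powr_add) (simp add: powr_half_sqrt)
    also have "\<dots> \<le> L * (2 * \<bar>s\<bar>)" using s L0 by (intro mult_left_mono) auto
    finally show ?thesis using sp by (simp add: v_def divide_le_eq)
  qed
  have v_ge: "v \<ge> L powr (7/10) / 2"
  proof -
    have "L powr (7/10) = L powr (3/2 - 4/5)" by simp
    also have "\<dots> = L powr (3/2) / L powr (4/5)" by (rule powr_diff)
    also have "\<dots> \<le> L powr (3/2) / \<bar>s\<bar>" using s sp L0 by (intro divide_left_mono) auto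
    finally show ?thesis by (simp add: v_def)
  qed
  \<comment> \<open>Rounding exp v down to \<open>M\<close> costs at most 1 in the logarithm x. With
    v \<ge> 14 still x \<ge> 6 and x \<ge> v/2, hence x^3/3 - x^2 \<ge> x^3/6 \<ge> v^3/48.\<close>
  have v14: "v \<ge> 14"
  proof -
    have "sqrt 1000 \<le> sqrt L" using L by (intro real_sqrt_le_mono) simp
    moreover have "28 \<le> sqrt 1000" by (rule real_le_rsqrt) simp
    moreover have "sqrt L = L powr (1/2)" using L0 by (simp add: powr_half_sqrt)
    moreover have "L powr (1/2) \<le> L powr (7/10)" using L by (intro powr_mono) auto
    ultimately show ?thesis using v_ge by linarith
  qed
  define M where "M = nat \<lfloor>exp v\<rfloor>"
  have ev: "exp v \<ge> 1" using v14 by simp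
  have M1: "M \<ge> 1" using ev by (simp add: M_def le_nat_iff)
  have Mle: "real M \<le> exp v" using ev by (simp add: M_def)
  have Mge: "real M \<ge> exp (v - 1)"
  proof -
    have "real M \<ge> exp v - 1" using ev unfolding M_def by (subst of_nat_nat) linarith+
    moreover have "exp v - exp (v - 1) \<ge> 1"
    proof -
      have "exp v = exp 1 * exp (v - 1)" by (simp flip: exp_add)
      moreover have "exp 1 \<ge> (2::real)" using exp_ge_add_one_self[of "1::real"] by simp
      moreover have "exp (v - 1) \<ge> 1" using v14 by simp
      ultimately have "exp v \<ge> 2 * exp (v - 1)" by (simp add: mult_right_mono)
      thus ?thesis using \<open>exp (v - 1) \<ge> 1\<close> by linarith
    qed
    ultimately show ?thesis by linarith
  qed
  have "exp v \<le> exp L" using vL by simp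
  hence "real M \<le> exp L" using Mle by linarith
  hence Mn: "M \<le> n" using L n by simp
  define x where "x = ln (real M)"
  have x1: "x \<le> v"
  proof -
    have "ln (real M) \<le> ln (exp v)" using Mle M1 by (subst ln_le_cancel_iff) auto
    thus ?thesis by (simp add: x_def)
  qed
  have x2: "x \<ge> v - 1" unfolding x_def using Mge M1 by (simp add: ln_ge_iff)
  have tM: "\<bar>t\<bar> * ln (real M) \<le> 1"
  proof -
    have "\<bar>t\<bar> * x \<le> \<bar>t\<bar> * v" using x1 by (intro mult_left_mono) auto
    thus ?thesis using tv sqrt3_le by (simp add: x_def)
  qed
  let ?S = "(\<Sum>k=1..n. (1 - cos (t * ln (real k))) / real k)"
  have "v / 256 \<le> ?S"
  proof -
    have "v / 256 \<le> (3 / 4) * v / 192" using v14 by simp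
    also have "(3 / 4) = t\<^sup>2 * v\<^sup>2"
    proof -
      have "t\<^sup>2 * v\<^sup>2 = (\<bar>t\<bar> * v)\<^sup>2" by (simp add: power_mult_distrib)
      thus ?thesis unfolding tv by (simp add: power_divide)
    qed
    also have "t\<^sup>2 * v\<^sup>2 * v / 192 = t\<^sup>2 / 4 * (v ^ 3 / 48)" by (simp add: power2_eq_square power3_eq_cube)
    also have "\<dots> \<le> t\<^sup>2 / 4 * (x ^ 3 / 3 - x\<^sup>2)"
    proof (rule mult_left_mono)
      have x6: "x \<ge> 6" and xv: "x \<ge> v / 2" using x2 v14 by linarith+
      have "x\<^sup>2 * 6 \<le> x\<^sup>2 * x" using x6 by (intro mult_left_mono) auto
      moreover have "(v / 2) ^ 3 \<le> x ^ 3" using xv v14 by (intro power_mono) auto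
      ultimately show "v ^ 3 / 48 \<le> x ^ 3 / 3 - x\<^sup>2"
        by (simp add: power_divide power3_eq_cube power2_eq_square)
    qed auto
    also have "\<dots> \<le> ?S" unfolding x_def by (rule sum_one_minus_cos_ge[OF M1 Mn tM])
    finally show ?thesis .
  qed
  hence S: "L powr (7/10) / 512 \<le> ?S" using v_ge by simp
  \<comment> \<open>The growth exponent 3/5 = 2 (4/5) - 1 stays below the decay exponent 7/10 = 3/2
    - 4/5.\<close>
  have s2: "s\<^sup>2 / L \<le> L powr (3/5)"
  proof -
    have "\<bar>s\<bar>\<^sup>2 \<le> (L powr (4/5))\<^sup>2" using s by (intro power_mono) auto
    also have "(L powr (4/5))\<^sup>2 = L powr (8/5)" using L0 by (simp flip: powr_realpow add: powr_powr)
    also have "\<dots> = L powr (3/5 + 1)" by simp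
    also have "\<dots> = L powr (3/5) * L" using L0 by (subst powr_add) simp
    finally show ?thesis using L0 by (simp add: divide_le_eq)
  qed
  have "norm (scaled_chf n s) \<le> majorant t n"
    unfolding norm_scaled_chf_eq t_def L(1) by (rule perm_chf_le_majorant)
  also have "\<dots> \<le> exp (- ?S / 8 + 153 * s\<^sup>2 / L)"
    using L by (intro majorant_scaled_le(1)[OF n L(1) _ t_def]) auto
  also have "\<dots> \<le> exp (- (L powr (7/10)) / 4096 + 153 * L powr (3/5))"
    using S s2 by simp
  finally show ?thesis .
qed

text \<open>For y = s^2/L^{3/2} the hypothesis gives y \<ge> L^{8/5 - 3/2} = L^{1/10}, so
  \<open>L\<close> and |s| are bounded by powers of y, and L |s| \<le> y^{21}. Any power of y is
  absorbed by exp(-y/2).\<close>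

lemma gaussian_cutoff:
  fixes L s :: real
  assumes L: "L \<ge> 1" and s: "\<bar>s\<bar> \<ge> L powr (4/5)"
  shows "exp (- (s\<^sup>2 / (2 * L powr (3/2)))) \<le> (fact 21 * 2 ^ 21) / (L * \<bar>s\<bar>)"
proof -
  define y where "y = s\<^sup>2 / L powr (3/2)"
  have L0: "L > 0" using L by linarith
  have "0 < L powr (4/5)" using L0 by simp
  hence sp: "\<bar>s\<bar> > 0" using s by linarith
  have y: "y \<ge> L powr (1/10)"
  proof -
    have "(L powr (4/5))\<^sup>2 \<le> \<bar>s\<bar>\<^sup>2" using s by (intro power_mono) auto
    moreover have "(L powr (4/5))\<^sup>2 = L powr (8/5)" using L0 by (simp flip: powr_realpow add: powr_powr)
    ultimately have "L powr (8/5) / L powr (3/2) \<le> y" using L0 by (simp add: y_def divide_right_mono)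
    thus ?thesis by (simp flip: powr_diff)
  qed
  have y1: "y \<ge> 1" using y L ge_one_powr_ge_zero[of L "1/10"] by linarith
  have yL: "L \<le> y ^ 10"
  proof -
    have "(L powr (1/10)) ^ 10 \<le> y ^ 10" using y by (intro power_mono) auto
    moreover have "(L powr (1/10)) ^ 10 = L" using L0 by (simp flip: powr_realpow add: powr_powr)
    ultimately show ?thesis by simp
  qed
  have "(L * \<bar>s\<bar>)\<^sup>2 \<le> (y ^ 21)\<^sup>2"
  proof -
    have "s\<^sup>2 = y * L powr (3/2)" using L0 by (simp add: y_def)
    also have "\<dots> \<le> y * L powr 2" using y1 L by (intro mult_left_mono powr_mono) auto
    also have "L powr 2 = L\<^sup>2" using L0 by (simp add: powr_numeral)
    finally have "(L * \<bar>s\<bar>)\<^sup>2 \<le> L\<^sup>2 * (y * L\<^sup>2)" unfolding power_mult_distrib power2_abs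
      by (intro mult_left_mono) auto
    also have "\<dots> = y * L ^ 4" by (simp add: eval_nat_numeral)
    also have "\<dots> \<le> y * (y ^ 10) ^ 4" using yL L0 y1 by (intro mult_left_mono power_mono) auto
    also have "\<dots> = y ^ 41" by (simp flip: power_mult power_Suc)
    also have "\<dots> \<le> y ^ 42" using y1 by (intro power_increasing) auto
    finally show ?thesis by (simp flip: power_mult)
  qed
  hence Ls: "L * \<bar>s\<bar> \<le> y ^ 21" by (rule power2_le_imp_le) (use y1 in auto)
  have "L * \<bar>s\<bar> * exp (- (1/2) * y) \<le> y ^ 21 * exp (- (1/2) * y)"
    using Ls by (intro mult_right_mono) auto
  also have "\<dots> \<le> fact 21 / (1/2) ^ 21" using y1 by (intro power_exp_bound) auto
  also have "\<dots> = fact 21 * 2 ^ 21" by (simp add: power_one_over)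
  finally have "L * \<bar>s\<bar> * exp (- (1/2) * y) \<le> fact 21 * 2 ^ 21" .
  moreover have "exp (- (s\<^sup>2 / (2 * L powr (3/2)))) = exp (- (1/2) * y)" by (simp add: y_def)
  ultimately have "L * \<bar>s\<bar> * exp (- (s\<^sup>2 / (2 * L powr (3/2)))) \<le> fact 21 * 2 ^ 21"
    by (simp only:)
  moreover have "L * \<bar>s\<bar> > 0" using sp L0 by simp
  ultimately show ?thesis by (simp only: pos_le_divide_eq mult.commute)
qed

text \<open>The weight is made for the inversion: the transform of an interval is at most 2/|s|,
  which turns |s|/(1 + s^2) into an integrable function. The central expansion covers |s| \<le> sqrt
  L/2; beyond it both terms are small separately, the first one by the majorant up to L^{4/5} and by
  the Gaussian factor from there on.\<close>

theorem scaled_chf_edge_approx: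
  "\<exists>C. eventually (\<lambda>n. \<forall>s. norm (of_real (exp (- (s\<^sup>2 / (2 * ln (real n) powr (3/2))))) * scaled_chf n s - edge_chf n s)
      \<le> C / ln (real n) * (\<bar>s\<bar> / (1 + s\<^sup>2))) at_top"
proof -
  define K c4 c21 :: real where "K = 306 * exp 39 + 3" and "c4 = fact 4 / (1/40) ^ 4 * exp (1/40)"
    and "c21 = fact 21 * 2 ^ 21"
  define C where "C = (K + 2) * c4 + 8 * c4 + 2 + 2 * c21"
  have pos: "K \<ge> 0" "c4 \<ge> 0" "c21 \<ge> 0" by (auto simp: K_def c4_def c21_def)
  have c4: "(1 + a) ^ 4 * exp (- a / 40) \<le> c4" if "a \<ge> 0" for a
  proof -
    have "(1 + a) ^ 4 * exp (- (1/40) * (1 + a)) * exp (1/40) \<le> fact 4 / (1/40) ^ 4 * exp (1/40)"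
      using that by (intro mult_right_mono power_exp_bound) auto
    moreover have "exp (- (1/40) * (1 + a)) * exp (1/40) = exp (- a / 40)"
      by (simp add: field_simps flip: exp_add)
    ultimately show ?thesis unfolding c4_def by (metis mult.assoc)
  qed
  have bound: "norm (of_real (exp (- (s\<^sup>2 / (2 * L powr (3/2))))) * scaled_chf n s - edge_chf n s) \<le> C / L * (\<bar>s\<bar> / (1 + s\<^sup>2))"
    if n: "n \<ge> 1" and L: "L = ln (real n)" "L \<ge> 1000"
      and E: "exp (- (L powr (7/10)) / 4096 + 153 * L powr (3/5)) \<le> 1 / L\<^sup>2" for n L s
  proof -
    define a where "a = s\<^sup>2"
    define d where "d = exp (- (s\<^sup>2 / (2 * L powr (3/2))))"
    have a0: "a \<ge> 0" by (simp add: a_def)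
    have L0: "L > 0" using L by simp
    have saa: "\<bar>s\<bar> * \<bar>s\<bar> = a" by (simp add: a_def power2_eq_square)
    have s1: "\<bar>s\<bar> \<le> 1 + a" unfolding a_def by (rule abs_le_1_plus_square)
    have d01: "0 \<le> d" "d \<le> 1" by (auto simp: d_def)
    have edge: "norm (edge_chf n s) \<le> 2 * (1 + a) ^ 2 * exp (- a / 2)"
      using norm_edge_chf_le[of n s] L by (simp add: a_def)
    have nd: "norm (of_real d * scaled_chf n s) \<le> d * norm (scaled_chf n s)" using d01 by (simp add: norm_mult)
    have unit: "X / L * (\<bar>s\<bar> / (1 + a)) \<le> C / L * (\<bar>s\<bar> / (1 + a))" if "X \<le> C" for X
      using that a0 L0 by (intro mult_right_mono divide_right_mono) auto
    show ?thesis
    proof (cases "\<bar>s\<bar> \<le> sqrt L / 2")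
      case True
      \<comment> \<open>The smoothing factor \<open>d\<close> is within a/L of 1 here, which is as
        good as the central estimate itself.\<close>
      have "norm (of_real d * scaled_chf n s - edge_chf n s) \<le> norm (of_real d * (scaled_chf n s - edge_chf n s)) + norm (of_real (1 - d) * edge_chf n s)"
        using norm_triangle_ineq4[of "of_real d * (scaled_chf n s - edge_chf n s)" "of_real (1 - d) * edge_chf n s"]
        by (simp add: algebra_simps)
      also have "\<dots> = d * norm (scaled_chf n s - edge_chf n s) + (1 - d) * norm (edge_chf n s)"
        using d01 by (simp add: norm_mult del: of_real_diff)
      also have "\<dots> \<le> 1 * norm (scaled_chf n s - edge_chf n s) + (a / L) * norm (edge_chf n s)"
      proof (intro add_mono mult_right_mono)
        have "L powr 1 \<le> L powr (3/2)" using L by (intro powr_mono) auto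
        hence "L \<le> 2 * L powr (3/2)" using L0 by simp
        hence "a / (2 * L powr (3/2)) \<le> a / L" using a0 L0 by (intro divide_left_mono) auto
        moreover have "1 - a / (2 * L powr (3/2)) \<le> d"
          using exp_ge_add_one_self[of "- (a / (2 * L powr (3/2)))"] by (simp add: d_def a_def)
        ultimately show "1 - d \<le> a / L" by linarith
      qed (use d01 in auto)
      also have "\<dots> \<le> K / L * (a + a\<^sup>2 + a ^ 3) * exp (- a / 40) + a / L * (2 * (1 + a) ^ 2 * exp (- a / 40))"
      proof (intro add_mono mult_left_mono)
        have "L \<ge> 100" using L by simp
        from scaled_chf_central[OF n L(1) this True]
        have "norm (scaled_chf n s - edge_chf n s) \<le> K / L * (s\<^sup>2 + s ^ 4 + s ^ 6) * exp (- s\<^sup>2 / 40)"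
          unfolding K_def .
        moreover have "s\<^sup>2 = a" "s ^ 4 = a\<^sup>2" "s ^ 6 = a ^ 3" by (simp_all add: a_def flip: power_mult)
        ultimately show "1 * norm (scaled_chf n s - edge_chf n s) \<le> K / L * (a + a\<^sup>2 + a ^ 3) * exp (- a / 40)"
          by (simp only: mult_1)
        have "exp (- a / 2) \<le> exp (- a / 40)" using a0 by simp
        hence "2 * (1 + a) ^ 2 * exp (- a / 2) \<le> 2 * (1 + a) ^ 2 * exp (- a / 40)"
          by (intro mult_left_mono) auto
        thus "norm (edge_chf n s) \<le> 2 * (1 + a) ^ 2 * exp (- a / 40)" using edge by linarith
      qed (use a0 L0 in auto)
      also have "\<dots> \<le> K / L * (a * (1 + a) ^ 2) * exp (- a / 40) + a / L * (2 * (1 + a) ^ 2 * exp (- a / 40))"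
      proof (intro add_mono mult_right_mono mult_left_mono order_refl)
        have "a * (1 + a) ^ 2 = a + 2 * a\<^sup>2 + a ^ 3" by (simp add: power2_eq_square power3_eq_cube algebra_simps)
        thus "a + a\<^sup>2 + a ^ 3 \<le> a * (1 + a) ^ 2" by simp
      qed (use pos L0 in auto)
      also have "\<dots> = (K + 2) / L * (a * (1 + a) ^ 2 * exp (- a / 40))"
        by (simp add: add_divide_distrib algebra_simps)
      also have "\<dots> \<le> (K + 2) / L * (\<bar>s\<bar> / (1 + a) * c4)"
      proof (rule mult_left_mono)
        have "a * (1 + a) ^ 2 * exp (- a / 40) = \<bar>s\<bar> / (1 + a) * (\<bar>s\<bar> * (1 + a) ^ 3 * exp (- a / 40))"
          using a0 unfolding saa[symmetric] by (simp add: power3_eq_cube power2_eq_square)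
        also have "\<dots> \<le> \<bar>s\<bar> / (1 + a) * ((1 + a) * (1 + a) ^ 3 * exp (- a / 40))"
          using s1 a0 by (intro mult_left_mono mult_right_mono) auto
        also have "(1 + a) * (1 + a) ^ 3 = (1 + a) ^ 4" by (simp add: eval_nat_numeral)
        also have "\<bar>s\<bar> / (1 + a) * ((1 + a) ^ 4 * exp (- a / 40)) \<le> \<bar>s\<bar> / (1 + a) * c4"
          using c4[OF a0] a0 by (intro mult_left_mono) auto
        finally show "a * (1 + a) ^ 2 * exp (- a / 40) \<le> \<bar>s\<bar> / (1 + a) * c4" .
      qed (use pos L0 in auto)
      also have "\<dots> = ((K + 2) * c4) / L * (\<bar>s\<bar> / (1 + a))" by simp
      also have "\<dots> \<le> C / L * (\<bar>s\<bar> / (1 + a))" by (rule unit) (use pos in \<open>simp add: C_def\<close>)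
      finally show ?thesis by (simp add: d_def a_def)
    next
      case False
      hence sL: "sqrt L / 2 \<le> \<bar>s\<bar>" by simp
      have La: "L \<le> 4 * a"
      proof -
        have "(sqrt L / 2)\<^sup>2 \<le> \<bar>s\<bar>\<^sup>2" using sL L0 by (intro power_mono) auto
        thus ?thesis using L0 by (simp add: a_def power_divide)
      qed
      hence a1: "a \<ge> 1" using L by simp
      have sp: "\<bar>s\<bar> > 0" using saa a1 by (cases "s = 0") auto
      \<comment> \<open>For |s| \<ge> 1 the weight is comparable with 1/|s|, so it is enough to
        bound each term by a multiple of 1/(L |s|).\<close>
      have half: "1 / \<bar>s\<bar> \<le> 2 * (\<bar>s\<bar> / (1 + a))"
        using sp a1 saa by (simp add: field_simps)
      have q: "norm (edge_chf n s) \<le> (8 * c4) / L * (\<bar>s\<bar> / (1 + a))"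
      proof -
        have e: "exp (- a / 2) \<le> exp (- a / 40)" using a0 by simp
        have "L * (1 + a) * norm (edge_chf n s) \<le> (4 * a) * (1 + a) * (2 * (1 + a) ^ 2 * exp (- a / 40))"
          using La a0 L0 order_trans[OF edge mult_left_mono[OF e]] by (intro mult_mono) auto
        also have "\<dots> = 8 * \<bar>s\<bar> * (\<bar>s\<bar> * (1 + a) ^ 3 * exp (- a / 40))"
          unfolding saa[symmetric] by (simp add: power3_eq_cube power2_eq_square)
        also have "\<dots> \<le> 8 * \<bar>s\<bar> * ((1 + a) * (1 + a) ^ 3 * exp (- a / 40))"
          using s1 a0 by (intro mult_left_mono mult_right_mono) auto
        also have "(1 + a) * (1 + a) ^ 3 = (1 + a) ^ 4" by (simp add: eval_nat_numeral)
        also have "8 * \<bar>s\<bar> * ((1 + a) ^ 4 * exp (- a / 40)) \<le> 8 * \<bar>s\<bar> * c4"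
          using c4[OF a0] by (intro mult_left_mono) auto
        finally have "norm (edge_chf n s) * (L * (1 + a)) \<le> 8 * \<bar>s\<bar> * c4"
          by (simp only: mult.commute)
        moreover have "L * (1 + a) > 0" using L0 a0 by simp
        ultimately have "norm (edge_chf n s) \<le> 8 * \<bar>s\<bar> * c4 / (L * (1 + a))"
          by (simp only: pos_le_divide_eq)
        thus ?thesis by (simp add: mult.commute mult.left_commute)
      qed
      have f: "d * norm (scaled_chf n s) \<le> (2 + 2 * c21) / L * (\<bar>s\<bar> / (1 + a))"
      proof (cases "\<bar>s\<bar> \<le> L powr (4/5)")
        case True
        have "d * norm (scaled_chf n s) \<le> 1 * (1 / L\<^sup>2)"
          using d01 order_trans[OF scaled_chf_intermediate[OF n L sL True] E] by (intro mult_mono) auto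
        also have "\<dots> = 1 / L * (1 / L)" by (simp add: power2_eq_square)
        also have "\<dots> \<le> 1 / L * (1 / \<bar>s\<bar>)"
        proof -
          have "L powr (4/5) \<le> L powr 1" using L by (intro powr_mono) auto
          hence "\<bar>s\<bar> \<le> L" using True L0 by simp
          thus ?thesis using sp L0 by (intro mult_left_mono divide_left_mono) auto
        qed
        also have "\<dots> \<le> 1 / L * (2 * (\<bar>s\<bar> / (1 + a)))" using half L0 by (intro mult_left_mono) auto
        also have "\<dots> = 2 / L * (\<bar>s\<bar> / (1 + a))" by simp
        also have "\<dots> \<le> (2 + 2 * c21) / L * (\<bar>s\<bar> / (1 + a))"
          using pos L0 a0 by (intro mult_right_mono divide_right_mono) auto
        finally show ?thesis .
      next
        case False
        have "d * norm (scaled_chf n s) \<le> d * 1" using d01 norm_scaled_chf_le_1 by (intro mult_left_mono)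
        also have "\<dots> \<le> c21 / (L * \<bar>s\<bar>)"
          using gaussian_cutoff[of L s] False L by (simp add: d_def c21_def del: fact_numeral)
        also have "\<dots> = c21 / L * (1 / \<bar>s\<bar>)" by simp
        also have "\<dots> \<le> c21 / L * (2 * (\<bar>s\<bar> / (1 + a)))" using half L0 pos by (intro mult_left_mono) auto
        also have "\<dots> = (2 * c21) / L * (\<bar>s\<bar> / (1 + a))" by simp
        also have "\<dots> \<le> (2 + 2 * c21) / L * (\<bar>s\<bar> / (1 + a))"
          using pos L0 a0 by (intro mult_right_mono divide_right_mono) auto
        finally show ?thesis .
      qed
      have "norm (of_real d * scaled_chf n s - edge_chf n s) \<le> (2 + 2 * c21) / L * (\<bar>s\<bar> / (1 + a)) + (8 * c4) / L * (\<bar>s\<bar> / (1 + a))"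
        using norm_triangle_ineq4[of "of_real d * scaled_chf n s" "edge_chf n s"] f q nd by linarith
      also have "\<dots> = (2 + 2 * c21 + 8 * c4) / L * (\<bar>s\<bar> / (1 + a))"
        by (simp only: add_divide_distrib distrib_right)
      also have "\<dots> \<le> C / L * (\<bar>s\<bar> / (1 + a))" by (rule unit) (use pos in \<open>simp add: C_def\<close>)
      finally show ?thesis by (simp add: d_def a_def)
    qed
  qed
  have ln_top: "filterlim (\<lambda>n. ln (real n)) at_top at_top" by real_asymp
  have "eventually (\<lambda>L::real. exp (- (L powr (7/10)) / 4096 + 153 * L powr (3/5)) \<le> 1 / L\<^sup>2) at_top"
    by real_asymp
  hence "eventually (\<lambda>n. exp (- (ln (real n) powr (7/10)) / 4096 + 153 * ln (real n) powr (3/5)) \<le> 1 / (ln (real n))\<^sup>2) at_top"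
    using ln_top by (rule eventually_compose_filterlim)
  moreover have "eventually (\<lambda>n. ln (real n) \<ge> 1000) at_top" using ln_top by (simp add: filterlim_at_top)
  moreover have "eventually (\<lambda>n. n \<ge> 1) (at_top :: nat filter)" by (rule eventually_ge_at_top)
  ultimately have "eventually (\<lambda>n. \<forall>s. norm (of_real (exp (- (s\<^sup>2 / (2 * ln (real n) powr (3/2))))) * scaled_chf n s - edge_chf n s)
      \<le> C / ln (real n) * (\<bar>s\<bar> / (1 + s\<^sup>2))) at_top"
    by eventually_elim (use bound in blast)
  thus ?thesis by blast
qed

section \<open>Gaussian smoothing\<close>

lemma integral_derivative_zero:
  fixes F f :: "real \<Rightarrow> complex"
  assumes F: "\<And>x. (F has_vector_derivative f x) (at x)" and f: "\<And>x. isCont f x"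
    and int: "integrable lborel f" and top: "(F \<longlongrightarrow> 0) at_top" and bot: "(F \<longlongrightarrow> 0) at_bot"
  shows "(\<integral>x. f x \<partial>lborel) = 0"
proof -
  have "(LBINT x=-\<infinity>..\<infinity>. f x) = 0 - 0"
  proof (rule interval_integral_FTC_integrable[where F = F])
    show "set_integrable lborel (einterval (-\<infinity>) \<infinity>) f"
      using int by (simp add: set_integrable_def)
    show "((F \<circ> real_of_ereal) \<longlongrightarrow> 0) (at_right (-\<infinity>))"
      using bot by (simp add: ereal_tendsto_simps)
    show "((F \<circ> real_of_ereal) \<longlongrightarrow> 0) (at_left \<infinity>)"
      using top by (simp add: ereal_tendsto_simps)
  qed (use F f in auto)
  thus ?thesis by (simp add: interval_lebesgue_integral_def set_lebesgue_integral_def)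
qed

lemma integrable_gaussian_moment: "integrable lborel (\<lambda>s. exp (- s\<^sup>2 / 2) * s ^ k :: real)"
proof -
  have "integrable lborel (\<lambda>s. sqrt (2 * pi) * (std_normal_density s * s ^ k))"
    by (intro integrable_mult_right integrable_std_normal_moment)
  thus ?thesis by (simp add: std_normal_density_def)
qed

lemma integrable_gaussian_iexp:
  "integrable lborel (\<lambda>s. of_real (exp (- s\<^sup>2 / 2) * s ^ k) * iexp (s * x))"
proof (rule Bochner_Integration.integrable_bound[OF integrable_gaussian_moment[of k]])
  show "(\<lambda>s. of_real (exp (- s\<^sup>2 / 2) * s ^ k) * iexp (s * x)) \<in> borel_measurable lborel"
    by measurable
qed (simp add: norm_mult norm_power abs_mult power_abs)

lemma gaussian_fourier:
  "(\<integral>s. of_real (exp (- s\<^sup>2 / 2)) * iexp (s * x) \<partial>lborel) = of_real (sqrt (2 * pi) * exp (- x\<^sup>2 / 2))"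
proof -
  have "of_real (exp (- x\<^sup>2 / 2)) = char std_normal_distribution x"
    by (simp add: char_std_normal_distribution)
  also have "\<dots> = (\<integral>s. std_normal_density s *\<^sub>R iexp (x * s) \<partial>lborel)"
    unfolding char_def by (subst integral_density) auto
  also have "\<dots> = (\<integral>s. of_real (1 / sqrt (2 * pi)) * (of_real (exp (- s\<^sup>2 / 2)) * iexp (s * x)) \<partial>lborel)"
    by (intro Bochner_Integration.integral_cong) (auto simp: std_normal_density_def scaleR_conv_of_real mult.commute)
  also have "\<dots> = of_real (1 / sqrt (2 * pi)) * (\<integral>s. of_real (exp (- s\<^sup>2 / 2)) * iexp (s * x) \<partial>lborel)"
    by (rule integral_mult_right_zero)
  finally have "of_real (sqrt (2 * pi)) * of_real (exp (- x\<^sup>2 / 2))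
     = of_real (sqrt (2 * pi)) * (of_real (1 / sqrt (2 * pi)) * (\<integral>s. of_real (exp (- s\<^sup>2 / 2)) * iexp (s * x) \<partial>lborel))"
    by simp
  thus ?thesis by (simp add: mult.assoc[symmetric])
qed

text \<open>Write E = exp(-s^2/2 + i s x) and I k for the integral of s^k E. The derivatives of E
  and s E integrate to zero, which gives I 1 = i x I 0 and I 0 - I 2 + i x I 1 = 0; hence I 2 = (1 -
  x^2) I 0.\<close>

lemma gaussian_fourier_square:
  "(\<integral>s. of_real (exp (- s\<^sup>2 / 2) * s\<^sup>2) * iexp (s * x) \<partial>lborel)
     = of_real (sqrt (2 * pi) * (1 - x\<^sup>2) * exp (- x\<^sup>2 / 2))"
proof -
  define E where "E s = of_real (exp (- s\<^sup>2 / 2)) * iexp (s * x)" for s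
  define I where "I k = (\<integral>s. of_real (exp (- s\<^sup>2 / 2) * s ^ k) * iexp (s * x) \<partial>lborel)" for k
  have int: "integrable lborel (\<lambda>s. of_real (exp (- s\<^sup>2 / 2) * s ^ k) * iexp (s * x))" for k
    by (rule integrable_gaussian_iexp)
  have dE: "(E has_vector_derivative (- of_real s + \<i> * of_real x) * E s) (at s)" for s
  proof -
    have "((\<lambda>z. exp (- z\<^sup>2 / 2 + \<i> * (z * of_real x))) has_field_derivative
        (- of_real s + \<i> * of_real x) * exp (- (of_real s)\<^sup>2 / 2 + \<i> * (of_real s * of_real x))) (at (of_real s))"
      by (auto intro!: derivative_eq_intros simp: algebra_simps)
    hence "((\<lambda>s. exp (- (of_real s)\<^sup>2 / 2 + \<i> * (of_real s * of_real x))) has_vector_derivative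
        (- of_real s + \<i> * of_real x) * exp (- (of_real s)\<^sup>2 / 2 + \<i> * (of_real s * of_real x))) (at s)"
      by (rule has_vector_derivative_real_field)
    moreover have "E = (\<lambda>s. exp (- (of_real s)\<^sup>2 / 2 + \<i> * (of_real s * of_real x)))"
    proof
      fix s
      have "- (of_real s)\<^sup>2 / 2 = (of_real (- s\<^sup>2 / 2) :: complex)" by simp
      thus "E s = exp (- (of_real s)\<^sup>2 / 2 + \<i> * (of_real s * of_real x))"
        by (simp only: E_def exp_add exp_of_real of_real_mult)
    qed
    ultimately show ?thesis by (simp only:)
  qed
  have lim: "((\<lambda>s. of_real (s ^ k) * E s) \<longlongrightarrow> 0) F"
    if "((\<lambda>s. s ^ k * exp (- s\<^sup>2 / 2)) \<longlongrightarrow> 0) F" for k F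
  proof -
    have "norm (of_real (s ^ k) * E s) = norm (s ^ k * exp (- s\<^sup>2 / 2))" for s
      by (simp add: E_def norm_mult norm_power abs_mult power_abs)
    hence "eventually (\<lambda>s. norm (of_real (s ^ k) * E s) \<le> \<bar>s ^ k * exp (- s\<^sup>2 / 2)\<bar>) F"
      by (intro always_eventually) auto
    thus ?thesis by (rule Lim_null_comparison) (rule tendsto_rabs_zero[OF that])
  qed
  have E0: "(E \<longlongrightarrow> 0) at_top" "(E \<longlongrightarrow> 0) at_bot"
  proof -
    have "((\<lambda>s::real. s ^ 0 * exp (- s\<^sup>2 / 2)) \<longlongrightarrow> 0) at_top" by simp real_asymp
    from lim[OF this] show "(E \<longlongrightarrow> 0) at_top" by simp
    have "((\<lambda>s::real. s ^ 0 * exp (- s\<^sup>2 / 2)) \<longlongrightarrow> 0) at_bot" by simp real_asymp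
    from lim[OF this] show "(E \<longlongrightarrow> 0) at_bot" by simp
  qed
  have E1: "((\<lambda>s. of_real s * E s) \<longlongrightarrow> 0) at_top" "((\<lambda>s. of_real s * E s) \<longlongrightarrow> 0) at_bot"
  proof -
    have "((\<lambda>s::real. s ^ 1 * exp (- s\<^sup>2 / 2)) \<longlongrightarrow> 0) at_top" by simp real_asymp
    from lim[OF this] show "((\<lambda>s. of_real s * E s) \<longlongrightarrow> 0) at_top" by simp
    have "((\<lambda>s::real. s ^ 1 * exp (- s\<^sup>2 / 2)) \<longlongrightarrow> 0) at_bot" by simp real_asymp
    from lim[OF this] show "((\<lambda>s. of_real s * E s) \<longlongrightarrow> 0) at_bot" by simp
  qed
  have cE: "isCont E s" for s unfolding E_def by (auto intro!: continuous_intros)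
  have Ik: "of_real s ^ k * E s = of_real (exp (- s\<^sup>2 / 2) * s ^ k) * iexp (s * x)" for s k
    by (simp add: E_def)
  have int': "integrable lborel (\<lambda>s. c * (of_real s ^ k * E s))" for c k
    unfolding Ik by (intro integrable_mult_right int)
  have I': "(\<integral>s. c * (of_real s ^ k * E s) \<partial>lborel) = c * I k" for c k
    unfolding Ik I_def by (rule integral_mult_right_zero)
  have "(\<integral>s. (- 1) * (of_real s ^ 1 * E s) + \<i> * of_real x * (of_real s ^ 0 * E s) \<partial>lborel) = 0"
  proof (rule integral_derivative_zero[where F = E])
    show "(E has_vector_derivative (- 1) * (of_real s ^ 1 * E s) + \<i> * of_real x * (of_real s ^ 0 * E s)) (at s)" for s
      using dE[of s] by (simp add: algebra_simps)
    show "integrable lborel (\<lambda>s. (- 1) * (of_real s ^ 1 * E s) + \<i> * of_real x * (of_real s ^ 0 * E s))"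
      by (intro Bochner_Integration.integrable_add int')
  qed (intro E0 continuous_intros cE)+
  hence 1: "I 1 = \<i> * of_real x * I 0"
    unfolding Bochner_Integration.integral_add[OF int'[of "- 1" 1] int'[of "\<i> * of_real x" 0]] I'
    by (simp add: add_eq_0_iff)
  have "(\<integral>s. (1 * (of_real s ^ 0 * E s) + (- 1) * (of_real s ^ 2 * E s)) + \<i> * of_real x * (of_real s ^ 1 * E s) \<partial>lborel) = 0"
  proof (rule integral_derivative_zero[where F = "\<lambda>s. of_real s * E s"])
    show "((\<lambda>s. of_real s * E s) has_vector_derivative
        (1 * (of_real s ^ 0 * E s) + (- 1) * (of_real s ^ 2 * E s)) + \<i> * of_real x * (of_real s ^ 1 * E s)) (at s)" for s
    proof -
      have "((\<lambda>s. of_real s * E s) has_vector_derivative of_real s * ((- of_real s + \<i> * of_real x) * E s) + 1 * E s) (at s)"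
        by (intro has_vector_derivative_mult dE) (auto intro!: derivative_eq_intros simp: has_vector_derivative_def scaleR_conv_of_real has_derivative_of_real)
      thus ?thesis by (simp add: algebra_simps power2_eq_square)
    qed
    show "integrable lborel (\<lambda>s. (1 * (of_real s ^ 0 * E s) + (- 1) * (of_real s ^ 2 * E s)) + \<i> * of_real x * (of_real s ^ 1 * E s))"
      by (intro Bochner_Integration.integrable_add int')
  qed (intro E1 continuous_intros cE)+
  hence 2: "I 0 - I 2 + \<i> * of_real x * I 1 = 0"
    unfolding Bochner_Integration.integral_add[OF Bochner_Integration.integrable_add[OF int'[of 1 0] int'[of "- 1" 2]] int'[of "\<i> * of_real x" 1]]
      Bochner_Integration.integral_add[OF int'[of 1 0] int'[of "- 1" 2]] I'
    by simp
  have I0: "I 0 = of_real (sqrt (2 * pi) * exp (- x\<^sup>2 / 2))"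
    using gaussian_fourier[of x] by (simp add: I_def)
  have "I 2 = (1 - of_real x * of_real x) * I 0" using 1 2 by (simp add: algebra_simps)
  thus ?thesis unfolding I0 by (simp add: I_def power2_eq_square mult_ac)
qed

section \<open>Smoothed interval probabilities as Fourier integrals\<close>

lemma gaussian_fourier_scaled:
  assumes e: "\<epsilon> > 0"
  shows "(\<integral>s. of_real (exp (- \<epsilon>\<^sup>2 * s\<^sup>2 / 2)) * iexp (s * x) \<partial>lborel) = of_real (2 * pi * normal_density 0 \<epsilon> x)"
proof -
  have "(\<integral>s. of_real (exp (- s\<^sup>2 / 2)) * iexp (s * (x / \<epsilon>)) \<partial>lborel)
     = \<bar>\<epsilon>\<bar> *\<^sub>R (\<integral>s. of_real (exp (- (0 + \<epsilon> * s)\<^sup>2 / 2)) * iexp ((0 + \<epsilon> * s) * (x / \<epsilon>)) \<partial>lborel)"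
    using e by (intro lborel_integral_real_affine) auto
  also have "(\<lambda>s. of_real (exp (- (0 + \<epsilon> * s)\<^sup>2 / 2)) * iexp ((0 + \<epsilon> * s) * (x / \<epsilon>)))
     = (\<lambda>s. of_real (exp (- \<epsilon>\<^sup>2 * s\<^sup>2 / 2)) * iexp (s * x))"
    using e by (simp add: fun_eq_iff power_mult_distrib)
  finally have "(\<integral>s. of_real (exp (- \<epsilon>\<^sup>2 * s\<^sup>2 / 2)) * iexp (s * x) \<partial>lborel)
     = of_real (sqrt (2 * pi) * exp (- (x / \<epsilon>)\<^sup>2 / 2) / \<epsilon>)"
    using e gaussian_fourier[of "x / \<epsilon>"] by (simp add: scaleR_conv_of_real field_simps)
  also have "sqrt (2 * pi) * exp (- (x / \<epsilon>)\<^sup>2 / 2) / \<epsilon> = 2 * pi * normal_density 0 \<epsilon> x"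
  proof -
    have "2 * pi = sqrt (2 * pi) * sqrt (2 * pi)" by simp
    thus ?thesis using e unfolding normal_density_def
      by (simp add: real_sqrt_mult power_divide field_simps)
  qed
  finally show ?thesis .
qed

text \<open>The Fourier transform of the indicator of a bounded interval. A half-line would not be
  integrable; the limit to half-lines is taken only after inversion.\<close>

definition fourier_interval :: "real \<Rightarrow> real \<Rightarrow> real \<Rightarrow> complex" where
  "fourier_interval a b s = (\<integral>c. indicator {a..b} c *\<^sub>R iexp (- (s * c)) \<partial>lborel)"

text \<open>The probability that \<open>y - \<epsilon> N\<close> lies in \<open>{a..b}\<close>, for a standard normal variable \<open>N\<close>.\<close>
definition normal_interval :: "real \<Rightarrow> real \<Rightarrow> real \<Rightarrow> real \<Rightarrow> real" where
  "normal_interval \<epsilon> a b y = (\<integral>c. indicator {a..b} c * normal_density 0 \<epsilon> (y - c) \<partial>lborel)"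

lemma integrable_exp_scaled:
  assumes e: "\<epsilon> > 0"
  shows "integrable lborel (\<lambda>s::real. exp (- \<epsilon>\<^sup>2 * s\<^sup>2 / 2))"
proof -
  have "integrable lborel (\<lambda>s. sqrt (2 * pi * (1/\<epsilon>)\<^sup>2) * normal_density 0 (1 / \<epsilon>) s)"
    using e by (intro integrable_mult_right) auto
  thus ?thesis using e by (simp add: normal_density_def power_divide field_simps)
qed

text \<open>The Gaussian factor makes the double integral over the interval and the frequency
  absolutely convergent, so Fubini applies; the inner integral is the Gaussian density at
  \<open>y - c\<close>.\<close>

lemma normal_interval_fourier:
  assumes e: "\<epsilon> > 0"
  shows "(\<integral>s. of_real (exp (- \<epsilon>\<^sup>2 * s\<^sup>2 / 2)) * iexp (s * y) * fourier_interval a b s \<partial>lborel)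
     = of_real (2 * pi * normal_interval \<epsilon> a b y)"
proof -
  interpret lborel_pair: pair_sigma_finite lborel lborel ..
  let ?f = "\<lambda>c s. (indicator {a..b} c * exp (- \<epsilon>\<^sup>2 * s\<^sup>2 / 2)) *\<^sub>R iexp (s * (y - c))"
  have int: "integrable (lborel \<Otimes>\<^sub>M lborel) (case_prod ?f)"
  proof (rule Bochner_Integration.integrable_bound)
    show "integrable (lborel \<Otimes>\<^sub>M lborel) (\<lambda>(c, s). indicator {a..b} c * exp (- \<epsilon>\<^sup>2 * s\<^sup>2 / 2) :: real)"
    proof (rule lborel_pair.Fubini_integrable)
      show "(\<lambda>(c, s). indicator {a..b} c * exp (- \<epsilon>\<^sup>2 * s\<^sup>2 / 2) :: real) \<in> borel_measurable (lborel \<Otimes>\<^sub>M lborel)"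
        by measurable
      show "AE c in lborel. integrable lborel (\<lambda>s. case (c, s) of (c, s) \<Rightarrow> indicator {a..b} c * exp (- \<epsilon>\<^sup>2 * s\<^sup>2 / 2))"
        using integrable_exp_scaled[OF e] by (intro AE_I2) (simp add: integrable_mult_right)
      have "integrable lborel (\<lambda>c. indicator {a..b} c *\<^sub>R (\<integral>s. exp (- \<epsilon>\<^sup>2 * s\<^sup>2 / 2) \<partial>lborel :: real))"
        by (intro integrable_scaleR_left integrable_real_indicator) (auto simp: emeasure_lborel_Icc_eq)
      thus "integrable lborel (\<lambda>c. \<integral>s. norm (case (c, s) of (c, s) \<Rightarrow> indicator {a..b} c * exp (- \<epsilon>\<^sup>2 * s\<^sup>2 / 2)) \<partial>lborel)"
        by (simp add: abs_mult)
    qed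
    show "case_prod ?f \<in> borel_measurable (lborel \<Otimes>\<^sub>M lborel)" by measurable
    show "AE x in lborel \<Otimes>\<^sub>M lborel. norm (case_prod ?f x) \<le> norm (case x of (c, s) \<Rightarrow> indicator {a..b} c * exp (- \<epsilon>\<^sup>2 * s\<^sup>2 / 2))"
      by (intro AE_I2) (auto simp: case_prod_unfold)
  qed
  have "(\<integral>s. of_real (exp (- \<epsilon>\<^sup>2 * s\<^sup>2 / 2)) * iexp (s * y) * fourier_interval a b s \<partial>lborel) = (\<integral>s. (\<integral>c. ?f c s \<partial>lborel) \<partial>lborel)"
  proof (rule Bochner_Integration.integral_cong[OF refl])
    fix s
    have "(\<integral>c. ?f c s \<partial>lborel) = (\<integral>c. of_real (exp (- \<epsilon>\<^sup>2 * s\<^sup>2 / 2)) * iexp (s * y) * (indicator {a..b} c *\<^sub>R iexp (- (s * c))) \<partial>lborel)"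
    proof (rule Bochner_Integration.integral_cong[OF refl])
      fix c
      have "iexp (s * (y - c)) = iexp (s * y) * iexp (- (s * c))"
        by (simp add: exp_add[symmetric] algebra_simps)
      thus "?f c s = of_real (exp (- \<epsilon>\<^sup>2 * s\<^sup>2 / 2)) * iexp (s * y) * (indicator {a..b} c *\<^sub>R iexp (- (s * c)))"
        by (simp add: scaleR_conv_of_real)
    qed
    also have "\<dots> = of_real (exp (- \<epsilon>\<^sup>2 * s\<^sup>2 / 2)) * iexp (s * y) * fourier_interval a b s"
      unfolding fourier_interval_def by (rule integral_mult_right_zero)
    finally show "of_real (exp (- \<epsilon>\<^sup>2 * s\<^sup>2 / 2)) * iexp (s * y) * fourier_interval a b s = (\<integral>c. ?f c s \<partial>lborel)" ..
  qed
  also have "\<dots> = (\<integral>c. (\<integral>s. ?f c s \<partial>lborel) \<partial>lborel)"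
    by (rule lborel_pair.Fubini_integral[OF int])
  also have "\<dots> = (\<integral>c. of_real (2 * pi * (indicator {a..b} c * normal_density 0 \<epsilon> (y - c))) \<partial>lborel)"
  proof (rule Bochner_Integration.integral_cong[OF refl])
    fix c
    have "(\<integral>s. ?f c s \<partial>lborel) = (\<integral>s. of_real (indicator {a..b} c) * (of_real (exp (- \<epsilon>\<^sup>2 * s\<^sup>2 / 2)) * iexp (s * (y - c))) \<partial>lborel)"
      by (simp add: scaleR_conv_of_real mult.assoc)
    also have "\<dots> = of_real (indicator {a..b} c) * of_real (2 * pi * normal_density 0 \<epsilon> (y - c))"
      unfolding gaussian_fourier_scaled[OF e, symmetric] by (rule integral_mult_right_zero)
    finally show "(\<integral>s. ?f c s \<partial>lborel) = of_real (2 * pi * (indicator {a..b} c * normal_density 0 \<epsilon> (y - c)))"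
      by simp
  qed
  also have "\<dots> = of_real (\<integral>c. 2 * pi * (indicator {a..b} c * normal_density 0 \<epsilon> (y - c)) \<partial>lborel)"
    by (rule integral_complex_of_real)
  also have "\<dots> = of_real (2 * pi * normal_interval \<epsilon> a b y)"
    by (simp add: normal_interval_def)
  finally show ?thesis .
qed

lemma fourier_interval_eq:
  assumes "a \<le> b"
  shows "fourier_interval a b s = (if s = 0 then of_real (b - a) else \<i> / of_real s * (iexp (- (s * b)) - iexp (- (s * a))))"
proof (cases "s = 0")
  case True
  thus ?thesis using assms by (simp add: fourier_interval_def scaleR_conv_of_real)
next
  case False
  have "fourier_interval a b s = \<i> / of_real s * iexp (- (s * b)) - \<i> / of_real s * iexp (- (s * a))"
    unfolding fourier_interval_def
  proof (rule integral_FTC_Icc[OF assms])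
    fix c
    have "((\<lambda>z. \<i> / of_real s * exp (\<i> * (- (of_real s * z)))) has_field_derivative
        exp (\<i> * (- (of_real s * of_real c)))) (at (of_real c))"
      using False by (auto intro!: derivative_eq_intros)
    hence "((\<lambda>c. \<i> / of_real s * exp (\<i> * (- (of_real s * of_real c)))) has_vector_derivative
        exp (\<i> * (- (of_real s * of_real c)))) (at c)"
      by (rule has_vector_derivative_real_field)
    thus "((\<lambda>c. \<i> / of_real s * iexp (- (s * c))) has_vector_derivative iexp (- (s * c))) (at c within {a..b})"
      by (simp add: has_vector_derivative_at_within)
  qed (intro continuous_intros)
  thus ?thesis using False by (simp add: right_diff_distrib)
qed

text \<open>The first bound settles integrability. The second one does not depend on the interval
  and therefore survives the passage to half-lines.\<close>

lemma norm_fourier_interval_le: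
  assumes "a \<le> b"
  shows "norm (fourier_interval a b s) \<le> b - a" and "\<bar>s\<bar> * norm (fourier_interval a b s) \<le> 2"
proof -
  have "norm (fourier_interval a b s) \<le> (\<integral>c. norm (indicator {a..b} c *\<^sub>R iexp (- (s * c))) \<partial>lborel)"
    unfolding fourier_interval_def by (rule integral_norm_bound)
  also have "\<dots> = b - a" using assms by simp
  finally show "norm (fourier_interval a b s) \<le> b - a" .
  show "\<bar>s\<bar> * norm (fourier_interval a b s) \<le> 2"
  proof (cases "s = 0")
    case False
    have "\<bar>s\<bar> * norm (fourier_interval a b s) = norm (iexp (- (s * b)) - iexp (- (s * a)))"
      using False by (simp add: fourier_interval_eq[OF assms] norm_mult norm_divide)
    also have "\<dots> \<le> norm (iexp (- (s * b))) + norm (iexp (- (s * a)))" by (rule norm_triangle_ineq4)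
    also have "\<dots> = 2" by (simp only: norm_exp_i_times)
    finally show ?thesis .
  qed simp
qed

lemma fourier_interval_measurable:
  assumes "a \<le> b"
  shows "fourier_interval a b \<in> borel_measurable borel"
proof -
  have "fourier_interval a b = (\<lambda>s. if s = 0 then of_real (b - a) else \<i> / of_real s * (iexp (- (s * b)) - iexp (- (s * a))))"
    using fourier_interval_eq[OF assms] by (simp add: fun_eq_iff)
  also have "\<dots> \<in> borel_measurable borel" by measurable
  finally show ?thesis .
qed

section \<open>The Edgeworth approximation and its Fourier representation\<close>

definition edge_cdf :: "real \<Rightarrow> real \<Rightarrow> real" where
  "edge_cdf \<kappa> x = std_normal_cdf x + \<kappa> * ((1 - x\<^sup>2) * exp (- x\<^sup>2 / 2) / sqrt (2 * pi))"

lemma std_normal_cdf_diff: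
  assumes "a \<le> b"
  shows "std_normal_cdf b - std_normal_cdf a = normal_interval 1 a b 0"
proof -
  interpret real_distribution std_normal_distribution by (rule real_dist_normal_dist)
  have "std_normal_cdf b - std_normal_cdf a = measure std_normal_distribution {a<..b}"
  proof (cases "a < b")
    case True
    thus ?thesis by (simp add: cdf_diff_eq)
  qed (use assms in auto)
  also have "\<dots> = (\<integral>c. indicator {a<..b} c * std_normal_density c \<partial>lborel)"
  proof -
    have "measure std_normal_distribution {a<..b} = (\<integral>c. indicator {a<..b} c \<partial>std_normal_distribution)"
      by simp
    also have "\<dots> = (\<integral>c. std_normal_density c *\<^sub>R indicator {a<..b} c \<partial>lborel)"
      by (rule integral_density) auto
    finally show ?thesis by (simp add: mult.commute)
  qed
  also have "\<dots> = (\<integral>c. indicator {a..b} c * normal_density 0 1 (0 - c) \<partial>lborel)"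
  proof (rule integral_cong_AE)
    have "AE c in lborel. c \<noteq> a" by (rule AE_lborel_singleton)
    thus "AE c in lborel. indicator {a<..b} c * std_normal_density c = indicator {a..b} c * normal_density 0 1 (0 - c)"
      by eventually_elim (auto simp: normal_density_def split: split_indicator)
  qed auto
  finally show ?thesis by (simp add: normal_interval_def)
qed

text \<open>In the skewness term s^3 meets the 1/s of the interval's transform. What is left is s^2
  times boundary exponentials, which \<open>gaussian_fourier_square\<close> evaluates at
  \<open>- b\<close> and \<open>- a\<close>.\<close>

lemma edge_cdf_fourier:
  assumes ab: "a \<le> b"
  shows "(\<integral>s. of_real (exp (- s\<^sup>2 / 2)) * (1 - \<i> * of_real (\<kappa> * s ^ 3)) * fourier_interval a b s \<partial>lborel)
      = of_real (2 * pi * (edge_cdf \<kappa> b - edge_cdf \<kappa> a))"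
    and "integrable lborel (\<lambda>s. of_real (exp (- s\<^sup>2 / 2)) * (1 - \<i> * of_real (\<kappa> * s ^ 3)) * fourier_interval a b s)"
proof -
  let ?K = "fourier_interval a b"
  have [measurable]: "?K \<in> borel_measurable borel" by (rule fourier_interval_measurable[OF ab])
  define A where "A s = of_real (exp (- s\<^sup>2 / 2)) * ?K s" for s
  define J where "J x s = of_real (exp (- s\<^sup>2 / 2) * s ^ 2) * iexp (s * x)" for x s
  have split: "of_real (exp (- s\<^sup>2 / 2)) * (1 - \<i> * of_real (\<kappa> * s ^ 3)) * ?K s
      = A s + of_real \<kappa> * (J (- b) s - J (- a) s)" for s
  proof (cases "s = 0")
    case False
    have "\<i> * of_real (\<kappa> * s ^ 3) * ?K s = - (of_real (\<kappa> * s ^ 2) * (iexp (- (s * b)) - iexp (- (s * a))))"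
    proof -
      define Z where "Z = iexp (- (s * b)) - iexp (- (s * a))"
      have "\<i> * of_real (\<kappa> * s ^ 3) * (\<i> / of_real s * Z) = (\<i> * \<i>) * (of_real (\<kappa> * s ^ 3) / of_real s) * Z"
        by (simp only: times_divide_eq_left times_divide_eq_right ac_simps)
      also have "of_real (\<kappa> * s ^ 3) / of_real s = (of_real (\<kappa> * s ^ 2) :: complex)"
        using False by (simp add: power3_eq_cube power2_eq_square)
      finally show ?thesis using False by (simp add: fourier_interval_eq[OF ab] Z_def)
    qed
    hence "of_real (exp (- s\<^sup>2 / 2)) * (1 - \<i> * of_real (\<kappa> * s ^ 3)) * ?K s
        = of_real (exp (- s\<^sup>2 / 2)) * (?K s + of_real (\<kappa> * s ^ 2) * (iexp (- (s * b)) - iexp (- (s * a))))"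
      by (simp add: left_diff_distrib mult.assoc)
    also have "\<dots> = A s + of_real \<kappa> * (J (- b) s - J (- a) s)"
      by (simp add: A_def J_def algebra_simps)
    finally show ?thesis .
  qed (simp add: A_def J_def)
  have intA: "integrable lborel A"
  proof (rule Bochner_Integration.integrable_bound)
    show "integrable lborel (\<lambda>s. exp (- s\<^sup>2 / 2) * (b - a))"
      using integrable_gaussian_moment[of 0] by (intro integrable_mult_left) simp
    show "A \<in> borel_measurable lborel" unfolding A_def by measurable
    show "AE s in lborel. norm (A s) \<le> norm (exp (- s\<^sup>2 / 2) * (b - a))"
      using norm_fourier_interval_le(1)[OF ab] ab by (intro AE_I2) (simp add: A_def norm_mult abs_mult)
  qed
  have intJ: "integrable lborel (J x)" for x unfolding J_def by (rule integrable_gaussian_iexp)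
  have A: "(\<integral>s. A s \<partial>lborel) = of_real (2 * pi * (std_normal_cdf b - std_normal_cdf a))"
    using normal_interval_fourier[of 1 0 a b] by (simp add: A_def std_normal_cdf_diff[OF ab])
  have J: "(\<integral>s. J x s \<partial>lborel) = of_real (sqrt (2 * pi) * (1 - x\<^sup>2) * exp (- x\<^sup>2 / 2))" for x
    unfolding J_def by (rule gaussian_fourier_square)
  show "integrable lborel (\<lambda>s. of_real (exp (- s\<^sup>2 / 2)) * (1 - \<i> * of_real (\<kappa> * s ^ 3)) * ?K s)"
    unfolding split by (intro Bochner_Integration.integrable_add integrable_mult_right Bochner_Integration.integrable_diff intA intJ)
  have "(\<integral>s. A s + of_real \<kappa> * (J (- b) s - J (- a) s) \<partial>lborel)
      = (\<integral>s. A s \<partial>lborel) + of_real \<kappa> * ((\<integral>s. J (- b) s \<partial>lborel) - (\<integral>s. J (- a) s \<partial>lborel))"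
    using intA intJ by (simp add: Bochner_Integration.integral_add Bochner_Integration.integral_diff)
  also have "\<dots> = of_real (2 * pi * (edge_cdf \<kappa> b - edge_cdf \<kappa> a))"
  proof -
    have p: "2 * pi * (\<kappa> * (X / sqrt (2 * pi))) = \<kappa> * (sqrt (2 * pi) * X)" for X :: real
    proof -
      have "2 * pi * (\<kappa> * (X / sqrt (2 * pi))) = \<kappa> * ((2 * pi) / sqrt (2 * pi) * X)"
        by (simp only: times_divide_eq_left times_divide_eq_right ac_simps)
      also have "(2 * pi) / sqrt (2 * pi) = sqrt (2 * pi)" by (rule real_div_sqrt) simp
      finally show ?thesis .
    qed
    have "2 * pi * (edge_cdf \<kappa> b - edge_cdf \<kappa> a) = 2 * pi * (std_normal_cdf b - std_normal_cdf a)
       + (2 * pi * (\<kappa> * ((1 - b\<^sup>2) * exp (- b\<^sup>2 / 2) / sqrt (2 * pi))) - 2 * pi * (\<kappa> * ((1 - a\<^sup>2) * exp (- a\<^sup>2 / 2) / sqrt (2 * pi))))"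
      by (simp only: edge_cdf_def algebra_simps)
    also have "\<dots> = 2 * pi * (std_normal_cdf b - std_normal_cdf a)
       + \<kappa> * (sqrt (2 * pi) * (1 - b\<^sup>2) * exp (- b\<^sup>2 / 2) - sqrt (2 * pi) * (1 - a\<^sup>2) * exp (- a\<^sup>2 / 2))"
      unfolding p by (simp only: right_diff_distrib[of \<kappa>] mult.assoc)
    finally show ?thesis unfolding A J by simp
  qed
  finally show "(\<integral>s. of_real (exp (- s\<^sup>2 / 2)) * (1 - \<i> * of_real (\<kappa> * s ^ 3)) * ?K s \<partial>lborel)
      = of_real (2 * pi * (edge_cdf \<kappa> b - edge_cdf \<kappa> a))" unfolding split .
qed

section \<open>From characteristic functions to distribution functions\<close>

lemma integrable_cauchy_density: "integrable lborel (\<lambda>s::real. 1 / (1 + s\<^sup>2))"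
proof -
  have 1: "integrable lborel (\<lambda>s::real. indicator {0<..} s *\<^sub>R (1 / (1 + s\<^sup>2)))"
    using integrable_I0i_1_div_plus_square
    by (simp add: interval_lebesgue_integrable_def set_integrable_def zero_ereal_def)
  have "integrable lborel (\<lambda>s::real. indicator {0<..} (0 + (-1) * s) *\<^sub>R (1 / (1 + (0 + (-1) * s)\<^sup>2)))"
    by (rule lborel_integrable_real_affine[OF 1]) simp
  with 1 have "integrable lborel (\<lambda>s::real. indicator {0<..} s *\<^sub>R (1 / (1 + s\<^sup>2)) + indicator {0<..} (0 + (-1) * s) *\<^sub>R (1 / (1 + (0 + (-1) * s)\<^sup>2)))"
    by (rule Bochner_Integration.integrable_add)
  moreover have "AE s in lborel. s \<noteq> (0::real)" by (rule AE_lborel_singleton)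
  hence "AE s::real in lborel. 1 / (1 + s\<^sup>2) = indicator {0<..} s *\<^sub>R (1 / (1 + s\<^sup>2)) + indicator {0<..} (0 + (-1) * s) *\<^sub>R (1 / (1 + (0 + (-1) * s)\<^sup>2))"
    by eventually_elim (auto split: split_indicator)
  ultimately show ?thesis
    by (subst integrable_cong_AE[where g = "\<lambda>s::real. indicator {0<..} s *\<^sub>R (1 / (1 + s\<^sup>2)) + indicator {0<..} (0 + (-1) * s) *\<^sub>R (1 / (1 + (0 + (-1) * s)\<^sup>2))"]) auto
qed

text \<open>Both quantities are integrals of a transform against that of the interval. The
  integrands differ by at most 2 D/(1 + s^2), whatever the interval is.\<close>

lemma smoothed_average_approx:
  fixes X :: "'a \<Rightarrow> real"
  assumes A: "finite A" "A \<noteq> {}" and e: "\<epsilon> > 0" and ab: "a \<le> b" and D: "D \<ge> 0"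
    and approx: "\<And>s. norm (of_real (exp (- \<epsilon>\<^sup>2 * s\<^sup>2 / 2)) * ((\<Sum>\<sigma>\<in>A. iexp (s * X \<sigma>)) / of_nat (card A))
        - of_real (exp (- s\<^sup>2 / 2)) * (1 - \<i> * of_real (\<kappa> * s ^ 3))) \<le> D * (\<bar>s\<bar> / (1 + s\<^sup>2))"
  shows "\<bar>(\<Sum>\<sigma>\<in>A. normal_interval \<epsilon> a b (X \<sigma>)) / real (card A) - (edge_cdf \<kappa> b - edge_cdf \<kappa> a)\<bar>
      \<le> D * (\<integral>s. 1 / (1 + s\<^sup>2) \<partial>lborel)"
proof -
  let ?K = "fourier_interval a b"
  let ?g = "\<lambda>s. exp (- \<epsilon>\<^sup>2 * s\<^sup>2 / 2)"
  let ?N = "of_nat (card A) :: complex"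
  have [measurable]: "?K \<in> borel_measurable borel" by (rule fourier_interval_measurable[OF ab])
  have N: "card A > 0" using A by (simp add: card_gt_0_iff)
  define P where "P s = of_real (?g s) * ((\<Sum>\<sigma>\<in>A. iexp (s * X \<sigma>)) / ?N) * ?K s" for s
  define Q where "Q s = of_real (exp (- s\<^sup>2 / 2)) * (1 - \<i> * of_real (\<kappa> * s ^ 3)) * ?K s" for s
  have int1: "integrable lborel (\<lambda>s. of_real (?g s) * iexp (s * y) * ?K s)" for y
  proof (rule Bochner_Integration.integrable_bound)
    show "integrable lborel (\<lambda>s. ?g s * (b - a))"
      by (intro integrable_mult_left integrable_exp_scaled e)
    show "(\<lambda>s. of_real (?g s) * iexp (s * y) * ?K s) \<in> borel_measurable lborel" by measurable
    show "AE s in lborel. norm (of_real (?g s) * iexp (s * y) * ?K s) \<le> norm (?g s * (b - a))"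
      using norm_fourier_interval_le(1)[OF ab] ab by (intro AE_I2) (simp add: norm_mult abs_mult)
  qed
  have P_eq: "P s = (\<Sum>\<sigma>\<in>A. of_real (?g s) * iexp (s * X \<sigma>) * ?K s) / ?N" for s
    by (simp add: P_def sum_distrib_left sum_distrib_right sum_divide_distrib mult.assoc)
  have intP: "integrable lborel P"
    unfolding P_eq[abs_def] by (intro integrable_divide Bochner_Integration.integrable_sum int1)
  have intQ: "integrable lborel Q" unfolding Q_def by (rule edge_cdf_fourier(2)[OF ab])
  have "(\<integral>s. P s \<partial>lborel) = (\<Sum>\<sigma>\<in>A. of_real (2 * pi * normal_interval \<epsilon> a b (X \<sigma>))) / ?N"
    unfolding P_eq integral_divide_zero
    by (subst Bochner_Integration.integral_sum) (auto simp only: int1 normal_interval_fourier[OF e])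
  also have "\<dots> = of_real (2 * pi * ((\<Sum>\<sigma>\<in>A. normal_interval \<epsilon> a b (X \<sigma>)) / real (card A)))"
    by (simp add: sum_distrib_left)
  finally have P: "(\<integral>s. P s \<partial>lborel) = of_real (2 * pi * ((\<Sum>\<sigma>\<in>A. normal_interval \<epsilon> a b (X \<sigma>)) / real (card A)))" .
  have Q: "(\<integral>s. Q s \<partial>lborel) = of_real (2 * pi * (edge_cdf \<kappa> b - edge_cdf \<kappa> a))"
    unfolding Q_def by (rule edge_cdf_fourier(1)[OF ab])
  let ?d = "(\<Sum>\<sigma>\<in>A. normal_interval \<epsilon> a b (X \<sigma>)) / real (card A) - (edge_cdf \<kappa> b - edge_cdf \<kappa> a)"
  have "(\<integral>s. P s - Q s \<partial>lborel) = of_real (2 * pi * ?d)"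
    using intP intQ by (simp add: P Q right_diff_distrib)
  hence "2 * pi * \<bar>?d\<bar> = norm (\<integral>s. P s - Q s \<partial>lborel)" by (simp only: norm_of_real abs_mult) simp
  also have "\<dots> \<le> (\<integral>s. norm (P s - Q s) \<partial>lborel)" by (rule integral_norm_bound)
  also have "\<dots> \<le> (\<integral>s. 2 * D * (1 / (1 + s\<^sup>2)) \<partial>lborel)"
  proof (rule integral_mono)
    show "integrable lborel (\<lambda>s. norm (P s - Q s))"
      by (intro integrable_norm Bochner_Integration.integrable_diff intP intQ)
    show "integrable lborel (\<lambda>s. 2 * D * (1 / (1 + s\<^sup>2)))"
      by (intro integrable_mult_right integrable_cauchy_density)
    fix s
    have "P s - Q s = (of_real (?g s) * ((\<Sum>\<sigma>\<in>A. iexp (s * X \<sigma>)) / ?N) - of_real (exp (- s\<^sup>2 / 2)) * (1 - \<i> * of_real (\<kappa> * s ^ 3))) * ?K s"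
      by (simp add: P_def Q_def left_diff_distrib)
    hence "norm (P s - Q s) \<le> D * (\<bar>s\<bar> / (1 + s\<^sup>2)) * norm (?K s)"
      using mult_right_mono[OF approx[of s], of "norm (?K s)"] by (simp only: norm_mult norm_ge_zero)
    also have "\<dots> = D / (1 + s\<^sup>2) * (\<bar>s\<bar> * norm (?K s))" by simp
    also have "\<dots> \<le> D / (1 + s\<^sup>2) * 2"
      using norm_fourier_interval_le(2)[OF ab] D by (intro mult_left_mono) auto
    finally show "norm (P s - Q s) \<le> 2 * D * (1 / (1 + s\<^sup>2))" by (simp add: mult.commute)
  qed
  also have "\<dots> = 2 * (D * (\<integral>s. 1 / (1 + s\<^sup>2) \<partial>lborel))"
    unfolding integral_mult_right_zero by simp
  finally have "pi * \<bar>?d\<bar> \<le> D * (\<integral>s. 1 / (1 + s\<^sup>2) \<partial>lborel)" by simp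
  moreover have "1 * \<bar>?d\<bar> \<le> pi * \<bar>?d\<bar>" using pi_gt3 by (intro mult_right_mono) auto
  ultimately have "1 * \<bar>?d\<bar> \<le> D * (\<integral>s. 1 / (1 + s\<^sup>2) \<partial>lborel)" by (rule order_trans[rotated])
  thus ?thesis by (simp only: mult_1)
qed

text \<open>From (z - 1)^2 \<ge> 0 and exp(1/2) \<le> sqrt(2 pi). An exponential in place of the
  Gaussian gives a tail bound by an explicit primitive.\<close>

lemma normal_density_0_1_le: "normal_density 0 \<epsilon> u \<le> exp (- (u / \<epsilon>)) / \<epsilon>" if e: "\<epsilon> > 0"
proof -
  define z where "z = u / \<epsilon>"
  have "normal_density 0 \<epsilon> u = exp (- z\<^sup>2 / 2) / (sqrt (2 * pi) * \<epsilon>)"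
    using e by (simp add: normal_density_def z_def real_sqrt_mult power_divide)
  also have "\<dots> \<le> (exp (- z) * exp (1/2)) / (sqrt (2 * pi) * \<epsilon>)"
  proof (rule divide_right_mono)
    have "0 \<le> (z - 1)\<^sup>2" by simp
    hence "- z\<^sup>2 / 2 \<le> - z + 1/2" by (simp add: power2_eq_square algebra_simps)
    thus "exp (- z\<^sup>2 / 2) \<le> exp (- z) * exp (1/2)" by (simp flip: exp_add)
  qed (use e in auto)
  also have "\<dots> = exp (- z) / \<epsilon> * (exp (1/2) / sqrt (2 * pi))" by simp
  also have "\<dots> \<le> exp (- z) / \<epsilon> * 1"
  proof (rule mult_left_mono)
    have "exp (1/2 :: real) \<le> 1 + 1/2 + (1/2)\<^sup>2" by (rule exp_bound) auto
    also have "\<dots> \<le> 2" by (simp add: power2_eq_square)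
    also have "2 = sqrt (4 :: real)" by simp
    also have "\<dots> \<le> sqrt (2 * pi)" using pi_gt3 by (intro real_sqrt_le_mono) linarith
    finally show "exp (1/2) / sqrt (2 * pi) \<le> 1" by simp
  qed (use e in auto)
  finally show ?thesis by (simp add: z_def)
qed

lemma integrable_normal_interval:
  assumes e: "\<epsilon> > 0"
  shows "integrable lborel (\<lambda>c. indicator {a..b} c * normal_density 0 \<epsilon> (y - c))"
proof (rule Bochner_Integration.integrable_bound)
  show "integrable lborel (normal_density y \<epsilon>)" using e by simp
  show "(\<lambda>c. indicator {a..b} c * normal_density 0 \<epsilon> (y - c)) \<in> borel_measurable lborel" by measurable
  have "normal_density 0 \<epsilon> (y - c) = normal_density y \<epsilon> c" for c
    by (simp add: normal_density_def power2_commute)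
  thus "AE c in lborel. norm (indicator {a..b} c * normal_density 0 \<epsilon> (y - c)) \<le> norm (normal_density y \<epsilon> c)"
    by (intro AE_I2) (auto split: split_indicator)
qed

lemma normal_interval_nonneg: "normal_interval \<epsilon> a b y \<ge> 0"
  unfolding normal_interval_def by (intro Bochner_Integration.integral_nonneg) auto

lemma normal_interval_le_1:
  assumes e: "\<epsilon> > 0"
  shows "normal_interval \<epsilon> a b y \<le> 1"
proof -
  have "normal_density 0 \<epsilon> (y - c) = normal_density y \<epsilon> c" for c
    by (simp add: normal_density_def power2_commute)
  hence "normal_interval \<epsilon> a b y \<le> (\<integral>c. normal_density y \<epsilon> c \<partial>lborel)"
    unfolding normal_interval_def using e
    by (intro integral_mono integrable_normal_interval) (auto split: split_indicator)
  thus ?thesis using e by simp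
qed

lemma normal_interval_tail:
  assumes e: "\<epsilon> > 0" and y: "b + \<epsilon> * r \<le> y"
  shows "normal_interval \<epsilon> a b y \<le> exp (- r)"
proof (cases "a \<le> b")
  case True
  let ?F = "\<lambda>c. exp ((c - y) / \<epsilon>)"
  have F: "has_bochner_integral lborel (\<lambda>c. (?F c / \<epsilon>) * indicator {a..b} c) (?F b - ?F a)"
    by (rule has_bochner_integral_FTC_Icc_real[OF True])
       (use e in \<open>auto intro!: derivative_eq_intros continuous_intros\<close>)
  have "normal_interval \<epsilon> a b y \<le> (\<integral>c. (?F c / \<epsilon>) * indicator {a..b} c \<partial>lborel)"
    unfolding normal_interval_def
  proof (rule integral_mono[OF integrable_normal_interval[OF e]])
    show "integrable lborel (\<lambda>c. (?F c / \<epsilon>) * indicator {a..b} c)" using F by (rule integrable.intros)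
    show "indicator {a..b} c * normal_density 0 \<epsilon> (y - c) \<le> (?F c / \<epsilon>) * indicator {a..b} c" for c
      using normal_density_0_1_le[OF e, of "y - c"]
      by (auto simp: minus_divide_left split: split_indicator)
  qed
  also have "\<dots> = ?F b - ?F a" using F by (rule has_bochner_integral_integral_eq)
  also have "\<dots> \<le> ?F b" by simp
  also have "\<dots> \<le> exp (- r)" using y e by (simp add: divide_le_eq algebra_simps)
  finally show ?thesis .
qed (simp add: normal_interval_def)

lemma normal_interval_reflect: "normal_interval \<epsilon> a b y = normal_interval \<epsilon> (- b) (- a) (- y)"
proof -
  have "normal_interval \<epsilon> a b y = \<bar>-1\<bar> *\<^sub>R (\<integral>c. indicator {a..b} (0 + (-1) * c) * normal_density 0 \<epsilon> (y - (0 + (-1) * c)) \<partial>lborel)"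
    unfolding normal_interval_def by (rule lborel_integral_real_affine) simp
  also have "\<dots> = (\<integral>c. indicator {- b..- a} c * normal_density 0 \<epsilon> (- y - c) \<partial>lborel)"
  proof -
    have "indicator {a..b} (0 + (-1) * c) * normal_density 0 \<epsilon> (y - (0 + (-1) * c))
        = indicator {- b..- a} c * normal_density 0 \<epsilon> (- y - c)" for c
    proof -
      have "(y + c)\<^sup>2 = (- y - c)\<^sup>2" by (simp add: power2_eq_square algebra_simps)
      thus ?thesis by (auto simp: normal_density_def split: split_indicator)
    qed
    thus ?thesis by simp
  qed
  finally show ?thesis by (simp add: normal_interval_def)
qed

text \<open>One constant serves all \<open>\<kappa>\<close> between 0 and 1, and hence all large
  \<open>n\<close>. It is obtained by bounding the derivatives of both summands.\<close>

lemma edge_cdf_lipschitz: "\<exists>M\<ge>0. \<forall>\<kappa>\<in>{0..1}. \<forall>x y. \<bar>edge_cdf \<kappa> x - edge_cdf \<kappa> y\<bar> \<le> M * \<bar>x - y\<bar>"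
proof -
  define M where "M = 24 * exp (1/2 :: real)"
  let ?H = "\<lambda>x::real. (1 - x\<^sup>2) * exp (- x\<^sup>2 / 2) / sqrt (2 * pi)"
  have H: "\<bar>?H x - ?H y\<bar> \<le> M * \<bar>x - y\<bar>" for x y
  proof -
    have "norm (?H x - ?H y) \<le> M * norm (x - y)"
    proof (rule field_differentiable_bound[where S = UNIV and f' = "\<lambda>x. (x ^ 3 - 3 * x) * exp (- x\<^sup>2 / 2) / sqrt (2 * pi)"])
      fix x :: real
      show "(?H has_field_derivative (x ^ 3 - 3 * x) * exp (- x\<^sup>2 / 2) / sqrt (2 * pi)) (at x within UNIV)"
        by (rule DERIV_cdivide)
           (auto intro!: derivative_eq_intros simp: power3_eq_cube power2_eq_square algebra_simps)
      note s1 = abs_le_1_plus_square[of x]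
      have "\<bar>x ^ 3 - 3 * x\<bar> \<le> \<bar>x\<bar> * x\<^sup>2 + 3 * \<bar>x\<bar>"
        using abs_triangle_ineq4[of "x ^ 3" "3 * x"] by (simp add: power3_eq_cube power2_eq_square abs_mult)
      also have "\<dots> \<le> 3 * (\<bar>x\<bar> * (1 + x\<^sup>2))" by (simp add: algebra_simps)
      also have "\<dots> \<le> 3 * ((1 + x\<^sup>2) * (1 + x\<^sup>2))" using s1 by (intro mult_left_mono mult_right_mono) auto
      finally have c: "\<bar>x ^ 3 - 3 * x\<bar> \<le> 3 * (1 + x\<^sup>2) ^ 2" by (simp add: power2_eq_square)
      have "norm ((x ^ 3 - 3 * x) * exp (- x\<^sup>2 / 2) / sqrt (2 * pi)) = \<bar>x ^ 3 - 3 * x\<bar> * exp (- x\<^sup>2 / 2) / sqrt (2 * pi)"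
        by (simp add: abs_mult)
      also have "\<dots> \<le> \<bar>x ^ 3 - 3 * x\<bar> * exp (- x\<^sup>2 / 2) / 1"
        using pi_gt3 by (intro divide_left_mono) auto
      also have "\<dots> \<le> 3 * (1 + x\<^sup>2) ^ 2 * exp (- x\<^sup>2 / 2)"
        using c by (simp add: mult_right_mono)
      also have "\<dots> = 3 * ((1 + x\<^sup>2) ^ 2 * exp (- (1/2) * (1 + x\<^sup>2))) * exp (1/2)"
      proof -
        have "exp (- x\<^sup>2 / 2) = exp (- (1/2) * (1 + x\<^sup>2)) * exp (1/2)"
          by (simp add: field_simps flip: exp_add)
        thus ?thesis by simp
      qed
      also have "\<dots> \<le> 3 * (fact 2 / (1/2) ^ 2) * exp (1/2)"
        by (intro mult_right_mono mult_left_mono power_exp_bound) auto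
      also have "\<dots> = M" by (simp add: M_def power2_eq_square)
      finally show "norm ((x ^ 3 - 3 * x) * exp (- x\<^sup>2 / 2) / sqrt (2 * pi)) \<le> M" .
    qed auto
    thus ?thesis by simp
  qed
  have nd1: "normal_density 0 1 u \<le> 1" for u
  proof -
    have "normal_density 0 1 u = exp (- u\<^sup>2 / 2) / sqrt (2 * pi)" by (simp add: normal_density_def)
    also have "\<dots> \<le> 1 / 1" using pi_gt3 by (intro frac_le) auto
    finally show ?thesis by simp
  qed
  have P': "\<bar>std_normal_cdf x - std_normal_cdf y\<bar> \<le> \<bar>x - y\<bar>" if "y \<le> x" for x y
  proof -
    have "normal_interval 1 y x 0 \<le> (\<integral>c. indicator {y..x} c \<partial>lborel)"
      unfolding normal_interval_def
    proof (rule integral_mono[OF integrable_normal_interval])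
      show "integrable lborel (indicator {y..x} :: real \<Rightarrow> real)"
        by (intro integrable_real_indicator) (auto simp: emeasure_lborel_Icc_eq)
      show "indicator {y..x} c * normal_density 0 1 (0 - c) \<le> indicator {y..x} c" for c
        using nd1 by (auto split: split_indicator)
    qed auto
    also have "\<dots> = x - y" using that by simp
    finally show ?thesis using that normal_interval_nonneg[of 1 y x 0] by (simp add: std_normal_cdf_diff)
  qed
  have P: "\<bar>std_normal_cdf x - std_normal_cdf y\<bar> \<le> \<bar>x - y\<bar>" for x y
    using P'[of x y] P'[of y x] by (cases "x \<le> y") (auto simp: abs_minus_commute)
  have "\<bar>edge_cdf \<kappa> x - edge_cdf \<kappa> y\<bar> \<le> (1 + M) * \<bar>x - y\<bar>" if k: "\<kappa> \<in> {0..1}" for \<kappa> x y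
  proof -
    have "\<bar>\<kappa> * (?H x - ?H y)\<bar> \<le> 1 * (M * \<bar>x - y\<bar>)"
      unfolding abs_mult using k H[of x y] by (intro mult_mono) auto
    moreover have "edge_cdf \<kappa> x - edge_cdf \<kappa> y = (std_normal_cdf x - std_normal_cdf y) + \<kappa> * (?H x - ?H y)"
      by (simp only: edge_cdf_def right_diff_distrib)
    ultimately show ?thesis using P[of x y] by (simp add: distrib_right)
  qed
  moreover have "1 + M \<ge> 0" by (simp add: M_def)
  ultimately show ?thesis by blast
qed

lemma edge_cdf_limits:
  "(edge_cdf \<kappa> \<longlongrightarrow> 0) at_bot" "(edge_cdf \<kappa> \<longlongrightarrow> 1) at_top"
proof -
  interpret real_distribution std_normal_distribution by (rule real_dist_normal_dist)
  have b: "((\<lambda>x::real. (1 - x\<^sup>2) * exp (- x\<^sup>2 / 2) / sqrt (2 * pi)) \<longlongrightarrow> 0) at_bot" by real_asymp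
  have t: "((\<lambda>x::real. (1 - x\<^sup>2) * exp (- x\<^sup>2 / 2) / sqrt (2 * pi)) \<longlongrightarrow> 0) at_top" by real_asymp
  have "((\<lambda>x. std_normal_cdf x + \<kappa> * ((1 - x\<^sup>2) * exp (- x\<^sup>2 / 2) / sqrt (2 * pi))) \<longlongrightarrow> 0 + \<kappa> * 0) at_bot"
    by (intro tendsto_intros b cdf_lim_at_bot)
  thus "(edge_cdf \<kappa> \<longlongrightarrow> 0) at_bot" by (simp add: edge_cdf_def[abs_def])
  have "((\<lambda>x. std_normal_cdf x + \<kappa> * ((1 - x\<^sup>2) * exp (- x\<^sup>2 / 2) / sqrt (2 * pi))) \<longlongrightarrow> 1 + \<kappa> * 0) at_top"
    by (intro tendsto_intros t cdf_lim_at_top_prob)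
  thus "(edge_cdf \<kappa> \<longlongrightarrow> 1) at_top" by (simp add: edge_cdf_def[abs_def])
qed

text \<open>The smoothed indicator of [a, x - epsilon r] is at most that of X < x plus the tail
  exp(-r), and the one of [x + epsilon r, b] does the same for the complement. Two lower bounds thus
  replace a two-sided one and bounded intervals suffice; then a and b go to infinity, and the shift
  costs M epsilon r.\<close>

theorem esseen_edge:
  fixes X :: "'a \<Rightarrow> real"
  assumes A: "finite A" "A \<noteq> {}" and e: "\<epsilon> > 0" and D: "D \<ge> 0" and r: "r \<ge> 0" and \<kappa>: "\<kappa> \<in> {0..1}"
    and approx: "\<And>s. norm (of_real (exp (- \<epsilon>\<^sup>2 * s\<^sup>2 / 2)) * ((\<Sum>\<sigma>\<in>A. iexp (s * X \<sigma>)) / of_nat (card A))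
        - of_real (exp (- s\<^sup>2 / 2)) * (1 - \<i> * of_real (\<kappa> * s ^ 3))) \<le> D * (\<bar>s\<bar> / (1 + s\<^sup>2))"
    and M: "\<And>x y. \<bar>edge_cdf \<kappa> x - edge_cdf \<kappa> y\<bar> \<le> M * \<bar>x - y\<bar>"
  shows "\<bar>real (card {\<sigma>\<in>A. X \<sigma> < x}) / real (card A) - edge_cdf \<kappa> x\<bar>
      \<le> D * (\<integral>s. 1 / (1 + s\<^sup>2) \<partial>lborel) + exp (- r) + M * (\<epsilon> * r)"
proof -
  define B where "B = D * (\<integral>s. 1 / (1 + s\<^sup>2) \<partial>lborel) + exp (- r)"
  define p where "p = real (card {\<sigma>\<in>A. X \<sigma> < x}) / real (card A)"
  have N: "real (card A) > 0" using A by (simp add: card_gt_0_iff)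
  have cardsum: "real (card {\<sigma>\<in>A. P \<sigma>}) = (\<Sum>\<sigma>\<in>A. of_bool (P \<sigma>))" for P
    using A by (simp add: sum.If_cases of_bool_def Int_def)
  have lower: "edge_cdf \<kappa> (x - \<epsilon> * r) - edge_cdf \<kappa> a - B \<le> p" if "a \<le> x - \<epsilon> * r" for a
  proof -
    have "(\<Sum>\<sigma>\<in>A. normal_interval \<epsilon> a (x - \<epsilon> * r) (X \<sigma>)) \<le> (\<Sum>\<sigma>\<in>A. of_bool (X \<sigma> < x) + exp (- r))"
    proof (rule sum_mono)
      fix \<sigma> assume "\<sigma> \<in> A"
      show "normal_interval \<epsilon> a (x - \<epsilon> * r) (X \<sigma>) \<le> of_bool (X \<sigma> < x) + exp (- r)"
      proof (cases "X \<sigma> < x")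
        case True
        thus ?thesis using normal_interval_le_1[OF e, of a "x - \<epsilon> * r" "X \<sigma>"] by (simp add: add_increasing2)
      next
        case False
        thus ?thesis using normal_interval_tail[OF e, of "x - \<epsilon> * r" r "X \<sigma>" a] by simp
      qed
    qed
    also have "\<dots> = real (card {\<sigma>\<in>A. X \<sigma> < x}) + real (card A) * exp (- r)"
      by (simp add: sum.distrib cardsum)
    finally have "(\<Sum>\<sigma>\<in>A. normal_interval \<epsilon> a (x - \<epsilon> * r) (X \<sigma>)) / real (card A)
        \<le> (real (card {\<sigma>\<in>A. X \<sigma> < x}) + real (card A) * exp (- r)) / real (card A)"
      by (rule divide_right_mono) simp
    also have "\<dots> = p + exp (- r)" using N by (simp add: p_def add_divide_distrib)
    finally show ?thesis
      using smoothed_average_approx[OF A e that D approx] unfolding B_def by linarith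
  qed
  have upper: "edge_cdf \<kappa> b - edge_cdf \<kappa> (x + \<epsilon> * r) - B \<le> 1 - p" if "x + \<epsilon> * r \<le> b" for b
  proof -
    have "(\<Sum>\<sigma>\<in>A. normal_interval \<epsilon> (x + \<epsilon> * r) b (X \<sigma>)) \<le> (\<Sum>\<sigma>\<in>A. (1 - of_bool (X \<sigma> < x)) + exp (- r))"
    proof (rule sum_mono)
      fix \<sigma> assume "\<sigma> \<in> A"
      show "normal_interval \<epsilon> (x + \<epsilon> * r) b (X \<sigma>) \<le> (1 - of_bool (X \<sigma> < x)) + exp (- r)"
      proof (cases "X \<sigma> < x")
        case False
        thus ?thesis using normal_interval_le_1[OF e, of "x + \<epsilon> * r" b "X \<sigma>"] by (simp add: add_increasing2)
      next
        case True
        thus ?thesis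
          using normal_interval_tail[OF e, of "- (x + \<epsilon> * r)" r "- X \<sigma>" "- b"]
          unfolding normal_interval_reflect[of \<epsilon> "x + \<epsilon> * r"] by simp
      qed
    qed
    also have "\<dots> = real (card A) - real (card {\<sigma>\<in>A. X \<sigma> < x}) + real (card A) * exp (- r)"
      by (simp add: sum.distrib sum_subtractf cardsum)
    finally have "(\<Sum>\<sigma>\<in>A. normal_interval \<epsilon> (x + \<epsilon> * r) b (X \<sigma>)) / real (card A)
        \<le> (real (card A) - real (card {\<sigma>\<in>A. X \<sigma> < x}) + real (card A) * exp (- r)) / real (card A)"
      by (rule divide_right_mono) simp
    also have "\<dots> = 1 - p + exp (- r)" using N by (simp add: p_def add_divide_distrib diff_divide_distrib)
    finally show ?thesis
      using smoothed_average_approx[OF A e that D approx] unfolding B_def by linarith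
  qed
  have "edge_cdf \<kappa> (x - \<epsilon> * r) - 0 - B \<le> p"
  proof (rule tendsto_upperbound)
    show "((\<lambda>a. edge_cdf \<kappa> (x - \<epsilon> * r) - edge_cdf \<kappa> a - B) \<longlongrightarrow> edge_cdf \<kappa> (x - \<epsilon> * r) - 0 - B) at_bot"
      by (intro tendsto_intros edge_cdf_limits)
    show "eventually (\<lambda>a. edge_cdf \<kappa> (x - \<epsilon> * r) - edge_cdf \<kappa> a - B \<le> p) at_bot"
      using eventually_le_at_bot[of "x - \<epsilon> * r"] by eventually_elim (rule lower)
  qed simp
  moreover have "1 - edge_cdf \<kappa> (x + \<epsilon> * r) - B \<le> 1 - p"
  proof (rule tendsto_upperbound)
    show "((\<lambda>b. edge_cdf \<kappa> b - edge_cdf \<kappa> (x + \<epsilon> * r) - B) \<longlongrightarrow> 1 - edge_cdf \<kappa> (x + \<epsilon> * r) - B) at_top"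
      by (intro tendsto_intros edge_cdf_limits)
    show "eventually (\<lambda>b. edge_cdf \<kappa> b - edge_cdf \<kappa> (x + \<epsilon> * r) - B \<le> 1 - p) at_top"
      using eventually_ge_at_top[of "x + \<epsilon> * r"] by eventually_elim (rule upper)
  qed simp
  moreover have "\<bar>edge_cdf \<kappa> (x - \<epsilon> * r) - edge_cdf \<kappa> x\<bar> \<le> M * (\<epsilon> * r)" "\<bar>edge_cdf \<kappa> (x + \<epsilon> * r) - edge_cdf \<kappa> x\<bar> \<le> M * (\<epsilon> * r)"
    using M[of "x - \<epsilon> * r" x] M[of "x + \<epsilon> * r" x] e r by (simp_all add: abs_mult)
  ultimately have "\<bar>p - edge_cdf \<kappa> x\<bar> \<le> B + M * (\<epsilon> * r)" by linarith
  thus ?thesis by (simp add: p_def B_def)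
qed

section \<open>The defect of the logarithm of the order\<close>

abbreviation \<Lambda> :: "nat \<Rightarrow> real" where
  "\<Lambda> \<equiv> mangoldt"

text \<open>The p-adic valuation of a least common multiple is the maximum of the valuations. This
  is special to prime powers: 6 divides lcm(2, 3).\<close>

lemma primepow_dvd_Lcm_iff:
  assumes "finite S" "0 \<notin> S" "primepow (q::nat)"
  shows "q dvd Lcm S \<longleftrightarrow> (\<exists>j\<in>S. q dvd j)"
  using assms(1,2)
proof (induction S rule: finite_induct)
  case empty
  thus ?case using primepow_gt_Suc_0[OF assms(3)] by simp
next
  case (insert a S)
  obtain p k where pk: "prime p" "k > 0" "q = p ^ k" using assms(3) by (auto simp: primepow_def)
  have nz: "a \<noteq> 0" "Lcm S \<noteq> 0" using insert by (auto simp: Lcm_0_iff)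
  have "q dvd lcm a (Lcm S) \<longleftrightarrow> q dvd a \<or> q dvd Lcm S"
  proof -
    have m: "q dvd x \<longleftrightarrow> k \<le> multiplicity p x" if "x \<noteq> 0" for x
    proof -
      have "\<not> is_unit p" using pk(1) not_prime_unit by blast
      thus ?thesis using that unfolding pk(3) by (intro power_dvd_iff_le_multiplicity)
    qed
    have "lcm a (Lcm S) \<noteq> 0" using nz by simp
    thus ?thesis using multiplicity_lcm[OF nz, of p] pk(1) nz
      by (simp add: m le_max_iff_disj)
  qed
  thus ?case using insert by simp
qed

lemma sum_mangoldt_dvd:
  assumes "1 \<le> j" "j \<le> N"
  shows "(\<Sum>q=1..N. \<Lambda> q * mult_ind q j) = ln (real j)"
proof -
  have "(\<Sum>q=1..N. \<Lambda> q * mult_ind q j) = (\<Sum>d | d dvd j. \<Lambda> d)"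
  proof (rule sum.mono_neutral_cong_right)
    show "{d. d dvd j} \<subseteq> {1..N}"
    proof
      fix d assume "d \<in> {d. d dvd j}"
      hence "d dvd j" "d \<le> j" "d \<noteq> 0" using assms by (auto dest: dvd_imp_le)
      thus "d \<in> {1..N}" using assms by auto
    qed
  qed (auto simp: mult_ind_def)
  also have "\<dots> = ln (real j)" using mangoldt_sum[of j, where 'a = real] assms by simp
  finally show ?thesis .
qed

definition has_mult :: "nat \<Rightarrow> nat \<Rightarrow> (nat \<Rightarrow> nat) \<Rightarrow> real" where
  "has_mult N q \<alpha> = of_bool (\<exists>j\<in>{1..N}. \<alpha> j > 0 \<and> q dvd j)"

text \<open>log m is the sum of \<Lambda> over the divisors of m. Only prime powers count, and one
  divides the order exactly if it divides some cycle length.\<close>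

lemma ln_order_of_vec:
  "ln (real (order_of_vec N \<alpha>)) = (\<Sum>q=1..N. \<Lambda> q * has_mult N q \<alpha>)"
proof -
  define S where "S = {i. 1 \<le> i \<and> i \<le> N \<and> \<alpha> i > 0}"
  have S: "finite S" "0 \<notin> S" by (auto simp: S_def)
  have nz: "Lcm S \<noteq> 0" using S by (simp add: Lcm_0_iff)
  have "ln (real (Lcm S)) = (\<Sum>d | d dvd Lcm S. \<Lambda> d)"
    using mangoldt_sum[OF nz, where 'a = real] by simp
  also have "\<dots> = (\<Sum>d | primepow d \<and> d dvd Lcm S. \<Lambda> d)"
    using nz by (intro sum.mono_neutral_right) (auto simp: mangoldt_def finite_divisors_nat)
  also have "\<dots> = (\<Sum>q=1..N. \<Lambda> q * has_mult N q \<alpha>)"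
  proof (rule sum.mono_neutral_cong_left)
    show "{d. primepow d \<and> d dvd Lcm S} \<subseteq> {1..N}"
    proof safe
      fix d :: nat assume d: "primepow d" "d dvd Lcm S"
      then obtain j where "j \<in> S" "d dvd j" using primepow_dvd_Lcm_iff[OF S d(1)] by auto
      moreover from this have "d \<le> j" using S by (auto intro!: dvd_imp_le Nat.gr0I)
      ultimately show "d \<in> {1..N}" using primepow_gt_Suc_0[OF d(1)] by (auto simp: S_def)
    qed
    show "\<forall>d\<in>{1..N} - {d. primepow d \<and> d dvd Lcm S}. \<Lambda> d * has_mult N d \<alpha> = 0"
    proof
      fix d assume d: "d \<in> {1..N} - {d. primepow d \<and> d dvd Lcm S}"
      show "\<Lambda> d * has_mult N d \<alpha> = 0"
      proof (cases "primepow d")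
        case True
        hence "\<not> (\<exists>j\<in>S. d dvd j)" using primepow_dvd_Lcm_iff[OF S True] d by auto
        thus ?thesis by (auto simp: has_mult_def S_def)
      qed (simp add: mangoldt_def)
    qed
    show "\<Lambda> d = \<Lambda> d * has_mult N d \<alpha>" if "d \<in> {d. primepow d \<and> d dvd Lcm S}" for d
    proof -
      have "\<exists>j\<in>S. d dvd j" using primepow_dvd_Lcm_iff[OF S, of d] that by auto
      thus ?thesis by (auto simp: has_mult_def S_def)
    qed
  qed simp
  finally show ?thesis by (simp add: order_of_vec_def S_def)
qed

abbreviation mult_count :: "nat \<Rightarrow> nat \<Rightarrow> (nat \<Rightarrow> nat) \<Rightarrow> real" where
  "mult_count N q \<equiv> cycle_stat N (mult_ind q)"

lemma cycle_stat_ln: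
  "cycle_stat N (\<lambda>j. ln (real j)) \<alpha> = (\<Sum>q=1..N. \<Lambda> q * mult_count N q \<alpha>)"
proof -
  have "cycle_stat N (\<lambda>j. ln (real j)) \<alpha> = (\<Sum>j=1..N. \<Sum>q=1..N. \<Lambda> q * (real (\<alpha> j) * mult_ind q j))"
    unfolding cycle_stat_def
  proof (rule sum.cong[OF refl])
    fix j assume "j \<in> {1..N}"
    hence "real (\<alpha> j) * ln (real j) = real (\<alpha> j) * (\<Sum>q=1..N. \<Lambda> q * mult_ind q j)"
      by (subst sum_mangoldt_dvd) auto
    thus "real (\<alpha> j) * ln (real j) = (\<Sum>q=1..N. \<Lambda> q * (real (\<alpha> j) * mult_ind q j))"
      by (simp add: sum_distrib_left mult.left_commute)
  qed
  also have "\<dots> = (\<Sum>q=1..N. \<Lambda> q * mult_count N q \<alpha>)"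
    by (subst sum.swap) (simp add: cycle_stat_def sum_distrib_left)
  finally show ?thesis .
qed

text \<open>The second bound is (m - 1)^+ \<le> m (m - 1)/2 for integers m \<ge> 0, a factorial
  moment. The third fact makes the indicator one minus a multiplicative statistic, so that
  generating functions give its covariances.\<close>

lemma mult_count_bounds:
  "has_mult N q \<alpha> \<le> mult_count N q \<alpha>"
  "mult_count N q \<alpha> - has_mult N q \<alpha> \<le> ((mult_count N q \<alpha>)\<^sup>2 - mult_count N q \<alpha>) / 2"
  "has_mult N q \<alpha> = 1 - cycle_prod N (\<lambda>j. 1 - mult_ind q j) \<alpha>"
proof -
  define m where "m = (\<Sum>j\<in>{j\<in>{1..N}. q dvd j}. \<alpha> j)"
  have m: "mult_count N q \<alpha> = real m"
    unfolding cycle_stat_def m_def of_nat_sum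
    by (rule sum.mono_neutral_cong_right) (auto simp: mult_ind_def)
  have h: "has_mult N q \<alpha> = of_bool (m > 0)"
  proof -
    have "m > 0 \<longleftrightarrow> (\<exists>j\<in>{1..N}. \<alpha> j > 0 \<and> q dvd j)"
      unfolding m_def by (subst neq0_conv[symmetric], subst sum_eq_0_iff) auto
    thus ?thesis by (simp add: has_mult_def)
  qed
  show "has_mult N q \<alpha> \<le> mult_count N q \<alpha>" unfolding m h by simp
  show "mult_count N q \<alpha> - has_mult N q \<alpha> \<le> ((mult_count N q \<alpha>)\<^sup>2 - mult_count N q \<alpha>) / 2"
  proof (cases "m \<le> 1")
    case True
    hence "m = 0 \<or> m = 1" by auto
    thus ?thesis unfolding m h by auto
  next
    case False
    hence "0 \<le> (real m - 1) * (real m - 2)" by (intro mult_nonneg_nonneg) auto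
    thus ?thesis unfolding m h using False by (simp add: power2_eq_square algebra_simps)
  qed
  show "has_mult N q \<alpha> = 1 - cycle_prod N (\<lambda>j. 1 - mult_ind q j) \<alpha>"
  proof (cases "\<exists>j\<in>{1..N}. \<alpha> j > 0 \<and> q dvd j")
    case True
    then obtain j where "j \<in> {1..N}" "\<alpha> j > 0" "q dvd j" by auto
    hence "cycle_prod N (\<lambda>j. 1 - mult_ind q j) \<alpha> = 0"
      unfolding cycle_prod_def by (intro prod_zero) (auto simp: mult_ind_def)
    thus ?thesis using True by (simp add: has_mult_def)
  next
    case False
    hence "cycle_prod N (\<lambda>j. 1 - mult_ind q j) \<alpha> = 1"
      unfolding cycle_prod_def by (intro prod.neutral) (auto simp: mult_ind_def)
    thus ?thesis using False by (simp add: has_mult_def)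
  qed
qed

lemma cyc_exp_mult_count_le:
  assumes "q \<ge> 1" "n \<ge> 1"
  shows "cyc_exp n (mult_count n q) \<le> (1 + ln (real n)) / real q" "0 \<le> cyc_exp n (mult_count n q)"
proof -
  have e: "cyc_exp n (mult_count n q) = (\<Sum>k=1..n. mult_ind q k / real k)"
    by (rule cyc_exp_cycle_stat) simp
  show "cyc_exp n (mult_count n q) \<le> (1 + ln (real n)) / real q"
    unfolding e by (rule sum_mult_ind_le[OF assms])
  show "0 \<le> cyc_exp n (mult_count n q)"
    unfolding e by (intro sum_nonneg) (auto simp: mult_ind_def)
qed

text \<open>For a 0/1 valued \<open>f\<close> the diagonal part of the second moment is the mean
  itself and cancels in the factorial moment of order two; at most the squared mean is left.\<close>

lemma cyc_exp_excess_le: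
  assumes "q \<ge> 1" "n \<ge> 1"
  shows "cyc_exp n (\<lambda>\<alpha>. mult_count n q \<alpha> - has_mult n q \<alpha>) \<le> ((1 + ln (real n)) / real q)\<^sup>2"
proof -
  let ?E = "cyc_exp n (mult_count n q)"
  have "cyc_exp n (\<lambda>\<alpha>. mult_count n q \<alpha> - has_mult n q \<alpha>)
      \<le> cyc_exp n (\<lambda>\<alpha>. (1/2) * ((mult_count n q \<alpha>)\<^sup>2 - mult_count n q \<alpha>))"
    by (rule cyc_exp_mono) (use mult_count_bounds(2) in simp)
  also have "\<dots> = (1/2) * (cyc_exp n (\<lambda>\<alpha>. (mult_count n q \<alpha>)\<^sup>2) - ?E)"
    by (simp only: cyc_exp_cmult cyc_exp_diff)
  also have "cyc_exp n (\<lambda>\<alpha>. (mult_count n q \<alpha>)\<^sup>2) \<le> (\<Sum>k=1..n. (mult_ind q k)\<^sup>2 / real k) + ?E\<^sup>2"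
    by (rule cyc_var_cycle_stat_le) (auto simp: mult_ind_def)
  also have "(\<Sum>k=1..n. (mult_ind q k)\<^sup>2 / real k) = ?E"
    by (subst cyc_exp_cycle_stat) (auto simp: mult_ind_def intro!: sum.cong)
  finally have "cyc_exp n (\<lambda>\<alpha>. mult_count n q \<alpha> - has_mult n q \<alpha>) \<le> ?E\<^sup>2 / 2" by simp
  also have "\<dots> \<le> ?E\<^sup>2" by simp
  also have "\<dots> \<le> ((1 + ln (real n)) / real q)\<^sup>2"
    using cyc_exp_mult_count_le[OF assms] by (intro power_mono)
  finally show ?thesis .
qed

section \<open>Covariances of the divisibility events\<close>

lemma cycle_prod_mult: "cycle_prod N x \<alpha> * cycle_prod N y \<alpha> = cycle_prod N (\<lambda>j. x j * y j) \<alpha>"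
  by (simp add: cycle_prod_def prod.distrib power_mult_distrib)

abbreviation avoid :: "nat \<Rightarrow> nat \<Rightarrow> (nat \<Rightarrow> nat) \<Rightarrow> real" where
  "avoid N q \<equiv> cycle_prod N (\<lambda>j. 1 - mult_ind q j)"

lemma primepow_coprime_or_dvd:
  assumes "primepow (q::nat)" "primepow q'"
  shows "coprime q q' \<or> q dvd q' \<or> q' dvd q"
proof -
  obtain p k where pk: "prime p" "q = p ^ k" using assms(1) by (auto simp: primepow_def)
  obtain p' k' where pk': "prime p'" "q' = p' ^ k'" using assms(2) by (auto simp: primepow_def)
  show ?thesis
  proof (cases "p = p'")
    case True
    thus ?thesis using pk pk' by (cases "k \<le> k'") (auto intro: le_imp_power_dvd)
  next
    case False
    hence "coprime p p'" using pk pk' by (simp add: primes_coprime)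
    thus ?thesis using pk pk' by simp
  qed
qed

text \<open>Two prime powers are coprime or one divides the other. Coprime ones are settled by
  \<open>exp_coeff_avoid_both_le\<close>. Otherwise the least common multiple is the larger of the
  two, and the covariance, the same for complementary events, is at most the mean number of cycles
  with length divisible by it.\<close>

lemma cov_avoid_le:
  assumes q: "primepow q" "primepow q'" and n: "n \<ge> 1"
  shows "cyc_exp n (\<lambda>\<alpha>. avoid n q \<alpha> * avoid n q' \<alpha>) - cyc_exp n (avoid n q) * cyc_exp n (avoid n q')
      \<le> 2 * (1 + ln (real n)) / real (lcm q q')"
proof -
  have pos: "q \<ge> 1" "q' \<ge> 1" using q by (auto dest!: primepow_gt_Suc_0)
  have L: "1 + ln (real n) \<ge> 0" using n by simp
  have dvd: "cyc_exp n (\<lambda>\<alpha>. avoid n q \<alpha> * avoid n q' \<alpha>) - cyc_exp n (avoid n q) * cyc_exp n (avoid n q')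
      \<le> 2 * (1 + ln (real n)) / real q'" if "q' \<ge> 1" for q q'
  proof -
    let ?I = "\<lambda>q. has_mult n q"
    have a: "avoid n q \<alpha> = 1 - ?I q \<alpha>" for q \<alpha> using mult_count_bounds(3)[of n q \<alpha>] by simp
    have "cyc_exp n (\<lambda>\<alpha>. avoid n q \<alpha> * avoid n q' \<alpha>) = cyc_exp n (\<lambda>\<alpha>. 1 - ?I q \<alpha> - ?I q' \<alpha> + ?I q \<alpha> * ?I q' \<alpha>)"
      unfolding a by (simp add: algebra_simps)
    also have "\<dots> = 1 - cyc_exp n (?I q) - cyc_exp n (?I q') + cyc_exp n (\<lambda>\<alpha>. ?I q \<alpha> * ?I q' \<alpha>)"
      by (simp only: cyc_exp_add cyc_exp_diff cyc_exp_const)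
    finally have "cyc_exp n (\<lambda>\<alpha>. avoid n q \<alpha> * avoid n q' \<alpha>) - cyc_exp n (avoid n q) * cyc_exp n (avoid n q')
       = cyc_exp n (\<lambda>\<alpha>. ?I q \<alpha> * ?I q' \<alpha>) - cyc_exp n (?I q) * cyc_exp n (?I q')"
      unfolding a by (simp only: cyc_exp_diff cyc_exp_const) (simp add: algebra_simps)
    also have "\<dots> \<le> cyc_exp n (\<lambda>\<alpha>. ?I q \<alpha> * ?I q' \<alpha>)"
      by (simp, intro mult_nonneg_nonneg cyc_exp_nonneg) (auto simp: has_mult_def)
    also have "\<dots> \<le> cyc_exp n (mult_count n q')"
    proof (rule cyc_exp_mono)
      fix \<alpha>
      have "?I q \<alpha> * ?I q' \<alpha> \<le> 1 * ?I q' \<alpha>" by (intro mult_right_mono) (auto simp: has_mult_def)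
      thus "?I q \<alpha> * ?I q' \<alpha> \<le> mult_count n q' \<alpha>" using mult_count_bounds(1)[of n q' \<alpha>] by simp
    qed
    also have "\<dots> \<le> (1 + ln (real n)) / real q'" by (rule cyc_exp_mult_count_le[OF that n])
    also have "\<dots> \<le> 2 * (1 + ln (real n)) / real q'" using L by (intro divide_right_mono) auto
    finally show ?thesis .
  qed
  consider "coprime q q'" | "q dvd q'" | "q' dvd q" using primepow_coprime_or_dvd[OF q] by blast
  thus ?thesis
  proof cases
    case 1
    have "cyc_exp n (\<lambda>\<alpha>. avoid n q \<alpha> * avoid n q' \<alpha>) = exp_coeff (\<lambda>j. (1 - mult_ind q j) * (1 - mult_ind q' j)) n"
      unfolding cycle_prod_mult by (rule cyc_exp_cycle_prod) simp
    moreover have "cyc_exp n (avoid n q) = exp_coeff (\<lambda>j. 1 - mult_ind q j) n" for q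
      by (rule cyc_exp_cycle_prod) simp
    moreover have "lcm q q' = q * q'" using 1 by (simp add: lcm_coprime)
    ultimately show ?thesis using exp_coeff_avoid_both_le[OF pos 1 n] by simp
  next
    case 2
    hence "lcm q q' = q'" by (simp add: lcm_proj2_if_dvd)
    thus ?thesis using dvd[OF pos(2), of q] by simp
  next
    case 3
    hence "lcm q q' = q" by (simp add: lcm_proj1_if_dvd)
    thus ?thesis using dvd[OF pos(1), of q'] by (simp add: mult.commute)
  qed
qed

text \<open>Compare with \<open>ln (N!) \<le> N ln N\<close>.\<close>
lemma sum_mangoldt_over_le:
  assumes N: "N \<ge> 1"
  shows "(\<Sum>q=1..N. \<Lambda> q / real q) \<le> 2 * ln (real N)"
proof -
  have "(\<Sum>q=1..N. \<Lambda> q * (real N / (2 * real q))) \<le> (\<Sum>q=1..N. \<Lambda> q * (\<Sum>m=1..N. mult_ind q m))"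
  proof (intro sum_mono mult_left_mono mangoldt_nonneg)
    fix q assume q: "q \<in> {1..N}"
    have "(\<Sum>m=1..N. mult_ind q m) = real (card {m\<in>{1..N}. q dvd m})"
      by (simp add: mult_ind_def of_bool_def sum.If_cases Int_def)
    moreover have "card ((\<lambda>i. q * i) ` {1..N div q}) \<le> card {m\<in>{1..N}. q dvd m}"
    proof (rule card_mono)
      show "(\<lambda>i. q * i) ` {1..N div q} \<subseteq> {m\<in>{1..N}. q dvd m}"
      proof
        fix m assume "m \<in> (\<lambda>i. q * i) ` {1..N div q}"
        then obtain i where "m = q * i" "i \<in> {1..N div q}" by blast
        hence i: "m = q * i" "1 \<le> i" "i \<le> N div q" by simp_all
        have "q * i \<le> q * (N div q)" using i by simp
        also have "\<dots> \<le> N" by simp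
        finally show "m \<in> {m\<in>{1..N}. q dvd m}" using i q by auto
      qed
    qed simp
    moreover have "card ((\<lambda>i. q * i) ` {1..N div q}) = N div q"
      using q by (subst card_image) (auto simp: inj_on_def)
    ultimately have "real (N div q) \<le> (\<Sum>m=1..N. mult_ind q m)" by linarith
    \<comment> \<open>As q \<le> N, rounding N/q down loses at most half of it; this is the factor 2
      of the bound.\<close>
    moreover have "real N / (2 * real q) \<le> real (N div q)"
    proof -
      have d: "N div q \<ge> 1" using q by (simp add: div_greater_zero_iff Suc_le_eq)
      have "N = q * (N div q) + N mod q" by simp
      moreover have "N mod q < q" using q by (intro mod_less_divisor) simp
      moreover have "q \<le> q * (N div q)" using d by simp
      ultimately have "N \<le> q * (N div q) + q * (N div q)" by linarith
      hence "N \<le> 2 * q * (N div q)" by simp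
      hence "real N \<le> real (2 * q * (N div q))" by (rule of_nat_mono)
      thus ?thesis using q by (simp add: field_simps)
    qed
    ultimately show "real N / (2 * real q) \<le> (\<Sum>m=1..N. mult_ind q m)" by linarith
  qed
  also have "\<dots> = (\<Sum>m=1..N. \<Sum>q=1..N. \<Lambda> q * mult_ind q m)"
    by (subst sum.swap) (simp add: sum_distrib_left)
  also have "\<dots> = (\<Sum>m=1..N. ln (real m))" by (intro sum.cong sum_mangoldt_dvd) auto
  also have "\<dots> \<le> (\<Sum>m=1..N. ln (real N))" by (intro sum_mono) auto
  also have "\<dots> = real N * ln (real N)" by simp
  also have "(\<Sum>q=1..N. \<Lambda> q * (real N / (2 * real q))) = real N / 2 * (\<Sum>q=1..N. \<Lambda> q / real q)"
    by (simp add: sum_distrib_left mult.commute)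
  finally have "real N / 2 * (\<Sum>q=1..N. \<Lambda> q / real q) \<le> real N / 2 * (2 * ln (real N))" by simp
  thus ?thesis using N by (subst (asm) mult_le_cancel_left_pos) auto
qed

text \<open>Coprime pairs contribute at most the square of the sum of \<Lambda>(q)/q, that is 4 (ln
  Q)^2. If q' divides q, summing \<Lambda>(q') first gives ln q, and the pairs contribute at most 2
  (ln Q)^2; the opposite divisibility doubles this.\<close>

lemma sum_mangoldt_lcm_le:
  assumes Q: "Q \<ge> 1"
  shows "(\<Sum>q=1..Q. \<Sum>q'=1..Q. \<Lambda> q * \<Lambda> q' / real (lcm q q')) \<le> 8 * (ln (real Q))\<^sup>2"
proof -
  let ?S = "\<Sum>q=1..Q. \<Lambda> q / real q" and ?l = "ln (real Q)"
  have S0: "?S \<ge> 0" by (intro sum_nonneg divide_nonneg_nonneg mangoldt_nonneg) auto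
  have S: "?S \<le> 2 * ?l" by (rule sum_mangoldt_over_le[OF Q])
  have l0: "?l \<ge> 0" using Q by simp
  have nn: "\<Lambda> a * \<Lambda> b \<ge> 0" for a b by (intro mult_nonneg_nonneg mangoldt_nonneg)
  have "(\<Sum>q=1..Q. \<Sum>q'=1..Q. \<Lambda> q * \<Lambda> q' / real (lcm q q'))
      \<le> (\<Sum>q=1..Q. \<Sum>q'=1..Q. \<Lambda> q / real q * (\<Lambda> q' / real q') + (\<Lambda> q' / real q' * (\<Lambda> q * mult_ind q q') + \<Lambda> q / real q * (\<Lambda> q' * mult_ind q' q)))"
  proof (intro sum_mono)
    fix q q' assume qq: "q \<in> {1..Q}" "q' \<in> {1..Q}"
    have t: "0 \<le> \<Lambda> q / real q * (\<Lambda> q' / real q')" "0 \<le> \<Lambda> q' / real q' * (\<Lambda> q * mult_ind q q')"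
      "0 \<le> \<Lambda> q / real q * (\<Lambda> q' * mult_ind q' q)"
      by (auto simp: mult_ind_def intro!: mult_nonneg_nonneg divide_nonneg_nonneg mangoldt_nonneg)
    show "\<Lambda> q * \<Lambda> q' / real (lcm q q') \<le> \<Lambda> q / real q * (\<Lambda> q' / real q') + (\<Lambda> q' / real q' * (\<Lambda> q * mult_ind q q') + \<Lambda> q / real q * (\<Lambda> q' * mult_ind q' q))"
    proof (cases "primepow q \<and> primepow q'")
      case True
      then consider "coprime q q'" | "q dvd q'" | "q' dvd q" using primepow_coprime_or_dvd by blast
      thus ?thesis
      proof cases
        case 1
        hence "lcm q q' = q * q'" by (simp add: lcm_coprime)
        hence "\<Lambda> q * \<Lambda> q' / real (lcm q q') = \<Lambda> q / real q * (\<Lambda> q' / real q')" by simp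
        thus ?thesis using t by linarith
      next
        case 2
        hence "\<Lambda> q * \<Lambda> q' / real (lcm q q') = \<Lambda> q' / real q' * (\<Lambda> q * mult_ind q q')"
          by (simp add: lcm_proj2_if_dvd mult_ind_def)
        thus ?thesis using t by linarith
      next
        case 3
        hence "\<Lambda> q * \<Lambda> q' / real (lcm q q') = \<Lambda> q / real q * (\<Lambda> q' * mult_ind q' q)"
          by (simp add: lcm_proj1_if_dvd mult_ind_def)
        thus ?thesis using t by linarith
      qed
    next
      case False
      hence "\<Lambda> q * \<Lambda> q' = 0" by (auto simp: mangoldt_def)
      thus ?thesis using t by (simp only: div_0)
    qed
  qed
  also have "\<dots> = (\<Sum>q=1..Q. \<Sum>q'=1..Q. \<Lambda> q / real q * (\<Lambda> q' / real q'))
      + ((\<Sum>q=1..Q. \<Sum>q'=1..Q. \<Lambda> q' / real q' * (\<Lambda> q * mult_ind q q')) + (\<Sum>q=1..Q. \<Sum>q'=1..Q. \<Lambda> q / real q * (\<Lambda> q' * mult_ind q' q)))"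
    by (simp only: sum.distrib)
  also have "(\<Sum>q=1..Q. \<Sum>q'=1..Q. \<Lambda> q' / real q' * (\<Lambda> q * mult_ind q q')) = (\<Sum>q=1..Q. \<Sum>q'=1..Q. \<Lambda> q / real q * (\<Lambda> q' * mult_ind q' q))"
    by (rule sum.swap)
  also have "(\<Sum>q=1..Q. \<Sum>q'=1..Q. \<Lambda> q / real q * (\<Lambda> q' / real q')) = ?S * ?S"
    by (simp only: sum_product)
  also have "(\<Sum>q=1..Q. \<Sum>q'=1..Q. \<Lambda> q / real q * (\<Lambda> q' * mult_ind q' q)) \<le> ?S * ?l"
  proof -
    have "(\<Sum>q=1..Q. \<Sum>q'=1..Q. \<Lambda> q / real q * (\<Lambda> q' * mult_ind q' q)) = (\<Sum>q=1..Q. \<Lambda> q / real q * ln (real q))"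
      unfolding sum_distrib_left[symmetric] by (intro sum.cong refl arg_cong2[where f = "(*)"] sum_mangoldt_dvd) auto
    also have "\<dots> \<le> (\<Sum>q=1..Q. \<Lambda> q / real q * ?l)"
      by (intro sum_mono mult_left_mono divide_nonneg_nonneg mangoldt_nonneg) auto
    also have "\<dots> = ?S * ?l" by (simp only: sum_distrib_right)
    finally show ?thesis .
  qed
  finally have "(\<Sum>q=1..Q. \<Sum>q'=1..Q. \<Lambda> q * \<Lambda> q' / real (lcm q q')) \<le> ?S * ?S + (?S * ?l + ?S * ?l)"
    by simp
  also have "\<dots> \<le> (2 * ?l) * (2 * ?l) + ((2 * ?l) * ?l + (2 * ?l) * ?l)"
    using S S0 l0 by (intro add_mono mult_mono) auto
  also have "\<dots> = 8 * ?l\<^sup>2" by (simp add: power2_eq_square)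
  finally show ?thesis .
qed

section \<open>Variance and concentration of the defect\<close>

definition cyc_var :: "nat \<Rightarrow> ((nat \<Rightarrow> nat) \<Rightarrow> real) \<Rightarrow> real" where
  "cyc_var n F = cyc_exp n (\<lambda>\<alpha>. (F \<alpha> - cyc_exp n F)\<^sup>2)"

lemma cyc_var_eq: "cyc_var n F = cyc_exp n (\<lambda>\<alpha>. (F \<alpha>)\<^sup>2) - (cyc_exp n F)\<^sup>2"
proof -
  have "cyc_var n F = cyc_exp n (\<lambda>\<alpha>. (F \<alpha>)\<^sup>2 - (2 * cyc_exp n F) * F \<alpha> + (cyc_exp n F)\<^sup>2)"
    unfolding cyc_var_def by (simp add: power2_diff algebra_simps)
  also have "\<dots> = cyc_exp n (\<lambda>\<alpha>. (F \<alpha>)\<^sup>2) - (2 * cyc_exp n F) * cyc_exp n F + (cyc_exp n F)\<^sup>2"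
    by (simp only: cyc_exp_add cyc_exp_diff cyc_exp_cmult cyc_exp_const)
  finally show ?thesis by (simp add: power2_eq_square)
qed

lemma cyc_var_add_le: "cyc_var n (\<lambda>\<alpha>. F \<alpha> + G \<alpha>) \<le> 2 * cyc_var n F + 2 * cyc_var n G"
proof -
  have "cyc_var n (\<lambda>\<alpha>. F \<alpha> + G \<alpha>) \<le> cyc_exp n (\<lambda>\<alpha>. 2 * (F \<alpha> - cyc_exp n F)\<^sup>2 + 2 * (G \<alpha> - cyc_exp n G)\<^sup>2)"
    unfolding cyc_var_def
  proof (rule cyc_exp_mono)
    fix \<alpha>
    define u v where "u = F \<alpha> - cyc_exp n F" and "v = G \<alpha> - cyc_exp n G"
    have "F \<alpha> + G \<alpha> - cyc_exp n (\<lambda>\<alpha>. F \<alpha> + G \<alpha>) = u + v" by (simp add: u_def v_def cyc_exp_add)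
    moreover have "(u + v)\<^sup>2 \<le> 2 * u\<^sup>2 + 2 * v\<^sup>2" using sum_squares_bound[of u v] by (simp add: power2_sum)
    ultimately show "(F \<alpha> + G \<alpha> - cyc_exp n (\<lambda>\<alpha>. F \<alpha> + G \<alpha>))\<^sup>2 \<le> 2 * (F \<alpha> - cyc_exp n F)\<^sup>2 + 2 * (G \<alpha> - cyc_exp n G)\<^sup>2"
      by (simp only: u_def v_def)
  qed
  thus ?thesis by (simp add: cyc_exp_add cyc_exp_cmult cyc_var_def)
qed

text \<open>The sum is additive over cycles, so the Poisson variance bound applies. Squaring its
  weight produces pairs of moduli, and two moduli divide \<open>k\<close> exactly if their least
  common multiple does.\<close>

lemma cyc_var_mult_count:
  assumes Q: "Q \<ge> 1" and n: "n \<ge> 1"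
  shows "cyc_var n (\<lambda>\<alpha>. \<Sum>q=1..Q. \<Lambda> q * mult_count n q \<alpha>) \<le> (1 + ln (real n)) * (8 * (ln (real Q))\<^sup>2)"
proof -
  define f where "f j = (\<Sum>q=1..Q. \<Lambda> q * mult_ind q j)" for j
  have f: "(\<Sum>q=1..Q. \<Lambda> q * mult_count n q \<alpha>) = cycle_stat n f \<alpha>" for \<alpha>
    unfolding cycle_stat_def f_def sum_distrib_left by (subst sum.swap) (simp add: mult.left_commute)
  have L: "1 + ln (real n) \<ge> 0" using n by simp
  have f0: "f k \<ge> 0" for k
    unfolding f_def by (intro sum_nonneg mult_nonneg_nonneg mangoldt_nonneg) (simp add: mult_ind_def)
  have "cyc_var n (cycle_stat n f) \<le> (\<Sum>k=1..n. (f k)\<^sup>2 / real k)"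
    using cyc_var_cycle_stat_le[of n n f] f0 by (simp add: cyc_var_eq)
  also have "\<dots> = (\<Sum>k=1..n. \<Sum>q=1..Q. \<Sum>q'=1..Q. \<Lambda> q * \<Lambda> q' * (mult_ind (lcm q q') k / real k))"
  proof (rule sum.cong[OF refl])
    fix k
    have "(f k)\<^sup>2 = (\<Sum>q=1..Q. \<Sum>q'=1..Q. \<Lambda> q * \<Lambda> q' * mult_ind (lcm q q') k)"
      unfolding f_def power2_eq_square sum_product
      by (intro sum.cong refl) (auto simp: mult_ind_def)
    thus "(f k)\<^sup>2 / real k = (\<Sum>q=1..Q. \<Sum>q'=1..Q. \<Lambda> q * \<Lambda> q' * (mult_ind (lcm q q') k / real k))"
      by (simp add: sum_divide_distrib)
  qed
  also have "\<dots> = (\<Sum>q=1..Q. \<Sum>k=1..n. \<Sum>q'=1..Q. \<Lambda> q * \<Lambda> q' * (mult_ind (lcm q q') k / real k))"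
    by (rule sum.swap)
  also have "\<dots> = (\<Sum>q=1..Q. \<Sum>q'=1..Q. \<Sum>k=1..n. \<Lambda> q * \<Lambda> q' * (mult_ind (lcm q q') k / real k))"
    by (intro sum.cong refl sum.swap)
  also have "\<dots> = (\<Sum>q=1..Q. \<Sum>q'=1..Q. \<Lambda> q * \<Lambda> q' * (\<Sum>k=1..n. mult_ind (lcm q q') k / real k))"
    by (simp only: sum_distrib_left)
  also have "\<dots> \<le> (\<Sum>q=1..Q. \<Sum>q'=1..Q. \<Lambda> q * \<Lambda> q' * ((1 + ln (real n)) / real (lcm q q')))"
    using n by (intro sum_mono mult_left_mono sum_mult_ind_le mult_nonneg_nonneg mangoldt_nonneg)
               (auto simp: Suc_le_eq lcm_pos_nat)
  also have "\<dots> = (1 + ln (real n)) * (\<Sum>q=1..Q. \<Sum>q'=1..Q. \<Lambda> q * \<Lambda> q' / real (lcm q q'))"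
    by (simp add: sum_distrib_left mult.left_commute mult.commute)
  also have "\<dots> \<le> (1 + ln (real n)) * (8 * (ln (real Q))\<^sup>2)"
    by (intro mult_left_mono sum_mangoldt_lcm_le Q L)
  finally show ?thesis unfolding f .
qed

text \<open>As \<Lambda> is nonnegative, upper bounds for the covariances suffice. That is why
  \<open>cov_avoid_le\<close> is one-sided.\<close>

lemma cyc_var_avoid:
  assumes Q: "Q \<ge> 1" and n: "n \<ge> 1"
  shows "cyc_var n (\<lambda>\<alpha>. \<Sum>q=1..Q. \<Lambda> q * avoid n q \<alpha>) \<le> (2 * (1 + ln (real n))) * (8 * (ln (real Q))\<^sup>2)"
proof -
  have L: "2 * (1 + ln (real n)) \<ge> 0" using n by simp
  have 1: "cyc_exp n (\<lambda>\<alpha>. \<Sum>q=1..Q. \<Lambda> q * avoid n q \<alpha>) = (\<Sum>q=1..Q. \<Lambda> q * cyc_exp n (avoid n q))"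
    by (simp add: cyc_exp_sum cyc_exp_cmult)
  have 2: "cyc_exp n (\<lambda>\<alpha>. (\<Sum>q=1..Q. \<Lambda> q * avoid n q \<alpha>)\<^sup>2)
      = (\<Sum>q=1..Q. \<Sum>q'=1..Q. \<Lambda> q * \<Lambda> q' * cyc_exp n (\<lambda>\<alpha>. avoid n q \<alpha> * avoid n q' \<alpha>))"
  proof -
    have "(\<lambda>\<alpha>. (\<Sum>q=1..Q. \<Lambda> q * avoid n q \<alpha>)\<^sup>2)
        = (\<lambda>\<alpha>. \<Sum>q=1..Q. \<Sum>q'=1..Q. (\<Lambda> q * \<Lambda> q') * (avoid n q \<alpha> * avoid n q' \<alpha>))"
      by (simp add: power2_eq_square sum_product mult_ac)
    thus ?thesis by (simp only: cyc_exp_sum[OF finite_atLeastAtMost] cyc_exp_cmult)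
  qed
  have cov: "x * y * (c - a * b) = x * y * c - x * a * (y * b)" for x y c a b :: real
    by (simp add: algebra_simps)
  have "cyc_var n (\<lambda>\<alpha>. \<Sum>q=1..Q. \<Lambda> q * avoid n q \<alpha>) = (\<Sum>q=1..Q. \<Sum>q'=1..Q. \<Lambda> q * \<Lambda> q' *
      (cyc_exp n (\<lambda>\<alpha>. avoid n q \<alpha> * avoid n q' \<alpha>) - cyc_exp n (avoid n q) * cyc_exp n (avoid n q')))"
    unfolding cyc_var_eq 1 2
    unfolding power2_eq_square sum_product sum_subtractf[symmetric]
    by (intro sum.cong refl) (rule cov[symmetric])
  also have "\<dots> \<le> (\<Sum>q=1..Q. \<Sum>q'=1..Q. \<Lambda> q * \<Lambda> q' * (2 * (1 + ln (real n)) / real (lcm q q')))"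
  proof (intro sum_mono)
    fix q q' assume "q \<in> {1..Q}" "q' \<in> {1..Q}"
    let ?c = "cyc_exp n (\<lambda>\<alpha>. avoid n q \<alpha> * avoid n q' \<alpha>) - cyc_exp n (avoid n q) * cyc_exp n (avoid n q')"
    show "\<Lambda> q * \<Lambda> q' * ?c \<le> \<Lambda> q * \<Lambda> q' * (2 * (1 + ln (real n)) / real (lcm q q'))"
    proof (cases "primepow q \<and> primepow q'")
      case True
      thus ?thesis using cov_avoid_le[of q q' n] n by (intro mult_left_mono mult_nonneg_nonneg mangoldt_nonneg) auto
    next
      case False
      hence "\<Lambda> q * \<Lambda> q' = 0" by (auto simp: mangoldt_def)
      thus ?thesis by (simp only: mult_zero_left)
    qed
  qed
  also have "\<dots> = 2 * (1 + ln (real n)) * (\<Sum>q=1..Q. \<Sum>q'=1..Q. \<Lambda> q * \<Lambda> q' / real (lcm q q'))"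
    by (simp add: sum_distrib_left mult.left_commute mult.commute)
  also have "\<dots> \<le> (2 * (1 + ln (real n))) * (8 * (ln (real Q))\<^sup>2)"
    by (intro mult_left_mono sum_mangoldt_lcm_le Q L)
  finally show ?thesis .
qed

lemma sum_inverse_square_tail: "Q \<ge> 1 \<Longrightarrow> (\<Sum>q=Suc Q..n. 1 / (real q)\<^sup>2) \<le> 1 / real Q"
proof -
  assume Q: "Q \<ge> 1"
  have "(\<Sum>q=Suc Q..n. 1 / (real q)\<^sup>2) \<le> 1 / real Q - 1 / real n" if "Q \<le> n"
    using that
  proof (induction n rule: dec_induct)
    case (step m)
    have m: "real m > 0" using step Q by simp
    have "1 / (real (Suc m))\<^sup>2 \<le> 1 / (real m * real (Suc m))"
      using m by (intro divide_left_mono) (auto simp: power2_eq_square)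
    also have "\<dots> = 1 / real m - 1 / real (Suc m)" using m by (simp add: field_simps)
    finally show ?case using step by simp
  qed simp
  thus ?thesis using Q by (cases "Q \<le> n") (auto intro: order_trans)
qed

definition order_defect :: "nat \<Rightarrow> (nat \<Rightarrow> nat) \<Rightarrow> real" where
  "order_defect n \<alpha> = cycle_stat n (\<lambda>j. ln (real j)) \<alpha> - ln (real (order_of_vec n \<alpha>))"

text \<open>\<open>W\<close> collects the moduli up to \<open>Q\<close>. The excess of a modulus is
  its count plus its avoidance indicator minus 1, so two variance bounds apply, and 48 = 2 * 8 + 2 *
  16. In \<open>R\<close> the mean excess is at most ((1 + ln n)/q)^2, and \<Lambda>(q) adds the
  third logarithm.\<close>

lemma order_defect_split:
  assumes n: "n \<ge> 1" and Q: "1 \<le> Q" "Q \<le> n"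
  obtains W R where "\<And>\<alpha>. order_defect n \<alpha> = W \<alpha> + R \<alpha>"
    "cyc_var n W \<le> 48 * (1 + ln (real n)) * (ln (real Q))\<^sup>2"
    "\<And>\<alpha>. R \<alpha> \<ge> 0" "cyc_exp n R \<le> (1 + ln (real n)) ^ 3 / real Q"
proof
  let ?X = "\<lambda>q \<alpha>. mult_count n q \<alpha> - has_mult n q \<alpha>"
  define W R where "W \<alpha> = (\<Sum>q=1..Q. \<Lambda> q * ?X q \<alpha>)" and "R \<alpha> = (\<Sum>q=Suc Q..n. \<Lambda> q * ?X q \<alpha>)" for \<alpha>
  let ?l = "1 + ln (real n)"
  have l: "?l \<ge> 1" using n by simp
  show "order_defect n \<alpha> = W \<alpha> + R \<alpha>" for \<alpha>
  proof -
    have "order_defect n \<alpha> = (\<Sum>q=1..n. \<Lambda> q * ?X q \<alpha>)"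
      by (simp add: order_defect_def cycle_stat_ln ln_order_of_vec sum_subtractf right_diff_distrib)
    also have "{1..n} = {1..Q} \<union> {Suc Q..n}" using Q by auto
    also have "(\<Sum>q\<in>{1..Q} \<union> {Suc Q..n}. \<Lambda> q * ?X q \<alpha>) = W \<alpha> + R \<alpha>"
      unfolding W_def R_def by (rule sum.union_disjoint) auto
    finally show ?thesis .
  qed
  show "R \<alpha> \<ge> 0" for \<alpha>
    unfolding R_def using mult_count_bounds(1)[of n _ \<alpha>]
    by (intro sum_nonneg mult_nonneg_nonneg mangoldt_nonneg) (simp add: le_diff_eq)
  show "cyc_var n W \<le> 48 * ?l * (ln (real Q))\<^sup>2"
  proof -
    define Y Z where "Y \<alpha> = (\<Sum>q=1..Q. \<Lambda> q * mult_count n q \<alpha>)" and "Z \<alpha> = (\<Sum>q=1..Q. \<Lambda> q * avoid n q \<alpha>)" for \<alpha>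
    define c where "c = - (\<Sum>q=1..Q. \<Lambda> q)"
    have W: "W \<alpha> = (Y \<alpha> + Z \<alpha>) + c" for \<alpha>
      unfolding W_def Y_def Z_def c_def mult_count_bounds(3) sum_negf[symmetric] sum.distrib[symmetric]
      by (rule sum.cong) (auto simp: algebra_simps)
    have "cyc_var n W = cyc_var n (\<lambda>\<alpha>. Y \<alpha> + Z \<alpha>)"
      unfolding W[abs_def] cyc_var_def by (simp add: cyc_exp_add cyc_exp_const)
    also have "\<dots> \<le> 2 * cyc_var n Y + 2 * cyc_var n Z" by (rule cyc_var_add_le)
    also have "\<dots> \<le> 2 * (?l * (8 * (ln (real Q))\<^sup>2)) + 2 * ((2 * ?l) * (8 * (ln (real Q))\<^sup>2))"
      unfolding Y_def[abs_def] Z_def[abs_def]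
      by (intro add_mono mult_left_mono cyc_var_mult_count cyc_var_avoid Q n) auto
    finally show ?thesis by (simp add: algebra_simps)
  qed
  show "cyc_exp n R \<le> ?l ^ 3 / real Q"
  proof -
    have "cyc_exp n R = (\<Sum>q=Suc Q..n. \<Lambda> q * cyc_exp n (?X q))"
      unfolding R_def[abs_def] by (simp only: cyc_exp_sum[OF finite_atLeastAtMost] cyc_exp_cmult)
    also have "\<dots> \<le> (\<Sum>q=Suc Q..n. ?l * (?l / real q)\<^sup>2)"
    proof (rule sum_mono)
      fix q assume q: "q \<in> {Suc Q..n}"
      have "\<Lambda> q \<le> ln (real q)" using q by (intro mangoldt_le) auto
      also have "\<dots> \<le> ln (real n)" using q by simp
      finally have "\<Lambda> q \<le> ?l" by simp
      moreover have "cyc_exp n (?X q) \<le> (?l / real q)\<^sup>2" using q n by (intro cyc_exp_excess_le) auto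
      moreover have "cyc_exp n (?X q) \<ge> 0"
        using mult_count_bounds(1)[of n q] by (intro cyc_exp_nonneg) simp
      ultimately show "\<Lambda> q * cyc_exp n (?X q) \<le> ?l * (?l / real q)\<^sup>2"
        using mangoldt_nonneg[of q] by (intro mult_mono) auto
    qed
    also have "\<dots> = ?l ^ 3 * (\<Sum>q=Suc Q..n. 1 / (real q)\<^sup>2)"
      by (simp add: sum_distrib_left power_divide power3_eq_cube power2_eq_square mult.assoc)
    also have "\<dots> \<le> ?l ^ 3 * (1 / real Q)"
      using l Q by (intro mult_left_mono sum_inverse_square_tail) auto
    finally show ?thesis by simp
  qed
qed

definition cyc_prob :: "nat \<Rightarrow> ((nat \<Rightarrow> nat) \<Rightarrow> bool) \<Rightarrow> real" where
  "cyc_prob n P = cyc_exp n (\<lambda>\<alpha>. of_bool (P \<alpha>))"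

text \<open>If the deviation exceeds y, then the deviation of \<open>W\<close> or the sum of
  \<open>R\<close> and its mean is at least y/2, as \<open>R\<close> is nonnegative. Chebyshev
  handles \<open>W\<close> and Markov handles \<open>R\<close>, whose mean is at most 1 by the
  choice of \<open>Q\<close>.\<close>

lemma order_defect_concentration:
  assumes n: "n \<ge> 1" and Q: "1 \<le> Q" "Q \<le> n" "(1 + ln (real n)) ^ 3 \<le> real Q" and y: "y > 0"
  shows "cyc_prob n (\<lambda>\<alpha>. \<bar>order_defect n \<alpha> - cyc_exp n (order_defect n)\<bar> > y)
      \<le> 192 * (1 + ln (real n)) * (ln (real Q))\<^sup>2 / y\<^sup>2 + 4 / y"
proof -
  obtain W R where WR: "\<And>\<alpha>. order_defect n \<alpha> = W \<alpha> + R \<alpha>"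
    "cyc_var n W \<le> 48 * (1 + ln (real n)) * (ln (real Q))\<^sup>2"
    "\<And>\<alpha>. R \<alpha> \<ge> 0" "cyc_exp n R \<le> (1 + ln (real n)) ^ 3 / real Q"
    using order_defect_split[OF n Q(1,2)] by metis
  have R1: "cyc_exp n R \<le> 1"
    using WR(4) Q by (auto intro: order_trans)
  have R0: "cyc_exp n R \<ge> 0" using WR(3) by (rule cyc_exp_nonneg)
  let ?w = "\<lambda>\<alpha>. W \<alpha> - cyc_exp n W"
  have "cyc_prob n (\<lambda>\<alpha>. \<bar>order_defect n \<alpha> - cyc_exp n (order_defect n)\<bar> > y)
      \<le> cyc_exp n (\<lambda>\<alpha>. (4 / y\<^sup>2) * (?w \<alpha>)\<^sup>2 + (2 / y) * (R \<alpha> + cyc_exp n R))"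
    unfolding cyc_prob_def
  proof (rule cyc_exp_mono)
    fix \<alpha>
    have eq: "order_defect n \<alpha> - cyc_exp n (order_defect n) = ?w \<alpha> + (R \<alpha> - cyc_exp n R)"
    proof -
      have "order_defect n = (\<lambda>\<alpha>. W \<alpha> + R \<alpha>)" using WR(1) by (rule ext)
      thus ?thesis by (simp add: cyc_exp_add)
    qed
    have nn: "0 \<le> (4 / y\<^sup>2) * (?w \<alpha>)\<^sup>2" "0 \<le> (2 / y) * (R \<alpha> + cyc_exp n R)"
      using y WR(3)[of \<alpha>] R0 by auto
    show "of_bool (y < \<bar>order_defect n \<alpha> - cyc_exp n (order_defect n)\<bar>)
        \<le> (4 / y\<^sup>2) * (?w \<alpha>)\<^sup>2 + (2 / y) * (R \<alpha> + cyc_exp n R)"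
    proof (cases "y < \<bar>order_defect n \<alpha> - cyc_exp n (order_defect n)\<bar>")
      case True
      hence "y / 2 \<le> \<bar>?w \<alpha>\<bar> \<or> y / 2 \<le> R \<alpha> + cyc_exp n R"
        unfolding eq using WR(3)[of \<alpha>] R0 by linarith
      hence "1 \<le> (4 / y\<^sup>2) * (?w \<alpha>)\<^sup>2 \<or> 1 \<le> (2 / y) * (R \<alpha> + cyc_exp n R)"
      proof
        assume "y / 2 \<le> \<bar>?w \<alpha>\<bar>"
        hence "(y / 2)\<^sup>2 \<le> \<bar>?w \<alpha>\<bar>\<^sup>2" using y by (intro power_mono) auto
        thus ?thesis using y by (simp add: field_simps power_divide)
      next
        assume "y / 2 \<le> R \<alpha> + cyc_exp n R"
        thus ?thesis using y by (simp add: field_simps)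
      qed
      hence "1 \<le> (4 / y\<^sup>2) * (?w \<alpha>)\<^sup>2 + (2 / y) * (R \<alpha> + cyc_exp n R)" using nn by linarith
      thus ?thesis using True by (simp only: of_bool_eq)
    qed (use nn in simp)
  qed
  also have "\<dots> = (4 / y\<^sup>2) * cyc_var n W + (2 / y) * (cyc_exp n R + cyc_exp n R)"
    by (simp only: cyc_exp_add cyc_exp_cmult cyc_exp_const cyc_var_def)
  also have "\<dots> \<le> (4 / y\<^sup>2) * (48 * (1 + ln (real n)) * (ln (real Q))\<^sup>2) + (2 / y) * (1 + 1)"
    using WR(2) R1 y by (intro add_mono mult_left_mono) auto
  finally show ?thesis by (simp add: algebra_simps add_divide_distrib)
qed

section \<open>Combining the estimates\<close>

lemma perms_finite_nonempty: "finite {\<sigma>. \<sigma> permutes {1..n::nat}}" "{\<sigma>. \<sigma> permutes {1..n::nat}} \<noteq> {}"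
proof -
  show "finite {\<sigma>. \<sigma> permutes {1..n::nat}}" by (rule finite_permutations) simp
  have "id permutes {1..n}" by (rule permutes_id)
  thus "{\<sigma>. \<sigma> permutes {1..n::nat}} \<noteq> {}" by blast
qed

lemma card_perms: "card {\<sigma>. \<sigma> permutes {1..n::nat}} = fact n"
  by (simp add: card_permutations)

lemma expectation_unif_perm:
  fixes F :: "(nat \<Rightarrow> nat) \<Rightarrow> real"
  shows "measure_pmf.expectation (unif_perm n) (\<lambda>\<sigma>. F (cycle_count n \<sigma>)) = cyc_exp n F"
  unfolding unif_perm_def cyc_exp_def cycle_sum_def
  by (subst integral_pmf_of_set[OF perms_finite_nonempty(2,1)])
     (simp add: card_perms cycle_count_eq_cycles_in del: One_nat_def)

lemma prob_unif_perm:
  "measure_pmf.prob (unif_perm n) {\<sigma>. P (cycle_count n \<sigma>)} = cyc_prob n P"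
proof -
  have "measure_pmf.prob (unif_perm n) {\<sigma>. P (cycle_count n \<sigma>)}
      = measure_pmf.expectation (unif_perm n) (\<lambda>\<sigma>. indicator {\<sigma>. P (cycle_count n \<sigma>)} \<sigma>)"
    by simp
  also have "(\<lambda>\<sigma>. indicator {\<sigma>. P (cycle_count n \<sigma>)} \<sigma>) = (\<lambda>\<sigma>. of_bool (P (cycle_count n \<sigma>)) :: real)"
    by (simp add: fun_eq_iff indicator_def)
  also have "measure_pmf.expectation (unif_perm n) \<dots> = cyc_prob n P"
    unfolding cyc_prob_def by (rule expectation_unif_perm)
  finally show ?thesis .
qed

lemma cyc_prob_card:
  "cyc_prob n P = real (card {\<sigma>\<in>{\<sigma>. \<sigma> permutes {1..n}}. P (cycles_in {1..n} \<sigma>)}) / real (card {\<sigma>. \<sigma> permutes {1..n}})"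
proof -
  have "(\<Sum>\<sigma> | \<sigma> permutes {1..n}. of_bool (P (cycles_in {1..n} \<sigma>)))
      = real (card {\<sigma>\<in>{\<sigma>. \<sigma> permutes {1..n}}. P (cycles_in {1..n} \<sigma>)})"
    using perms_finite_nonempty(1)[of n] by (simp add: of_bool_def sum.If_cases Int_def)
  thus ?thesis by (simp add: cyc_prob_def cyc_exp_def cycle_sum_def card_perms del: One_nat_def)
qed

lemma cyc_prob_mono: "(\<And>\<alpha>. P \<alpha> \<Longrightarrow> Q \<alpha>) \<Longrightarrow> cyc_prob n P \<le> cyc_prob n Q"
  unfolding cyc_prob_def by (intro cyc_exp_mono) auto

lemma cyc_prob_disj: "cyc_prob n (\<lambda>\<alpha>. P \<alpha> \<or> Q \<alpha>) \<le> cyc_prob n P + cyc_prob n Q"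
  unfolding cyc_prob_def cyc_exp_add[symmetric] by (intro cyc_exp_mono) auto

section \<open>The Edgeworth approximation for log P_n and its transfer to log O_n\<close>

abbreviation log_lengths :: "nat \<Rightarrow> (nat \<Rightarrow> nat) \<Rightarrow> real" where
  "log_lengths n \<equiv> cycle_stat n (\<lambda>j. ln (real j))"

definition std_dev :: "nat \<Rightarrow> real" where
  "std_dev n = 1 / sqrt 3 * ln (real n) powr (3/2)"

text \<open>exp(i t log P_n) is the product of \<open>npow t j\<close> over the cycles, so
  \<open>cyc_exp_cycle_prod\<close> evaluates its average; the mean enters as a phase.\<close>

lemma scaled_chf_eq_average:
  assumes L: "ln (real n) > 0"
  shows "(\<Sum>\<sigma> | \<sigma> permutes {1..n}.
      iexp (s * ((log_lengths n (cycles_in {1..n} \<sigma>) - cyc_exp n (log_lengths n)) / std_dev n)))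
      / of_nat (card {\<sigma>. \<sigma> permutes {1..n}}) = scaled_chf n s"
proof -
  define t where "t = sqrt 3 * s / ln (real n) powr (3/2)"
  have \<mu>: "cyc_exp n (log_lengths n) = (\<Sum>k=1..n. ln (real k) / real k)"
    by (rule cyc_exp_cycle_stat) simp
  have prod: "cycle_prod n (npow t) \<alpha> = cis (t * log_lengths n \<alpha>)" for \<alpha>
  proof -
    have "cis (t * log_lengths n \<alpha>) = exp (\<Sum>j=1..n. of_nat (\<alpha> j) * (\<i> * of_real (t * ln (real j))))"
      unfolding cis_conv_exp cycle_stat_def sum_distrib_left of_real_sum
      by (intro arg_cong[where f = exp] sum.cong) auto
    also have "\<dots> = (\<Prod>j=1..n. exp (\<i> * of_real (t * ln (real j))) ^ \<alpha> j)"
      by (simp only: exp_sum[OF finite_atLeastAtMost] exp_of_nat_mult)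
    finally show ?thesis by (simp add: cycle_prod_def npow_def cis_conv_exp)
  qed
  have "(\<Sum>\<sigma> | \<sigma> permutes {1..n}.
      iexp (s * ((log_lengths n (cycles_in {1..n} \<sigma>) - cyc_exp n (log_lengths n)) / std_dev n)))
      / of_nat (card {\<sigma>. \<sigma> permutes {1..n}})
    = cyc_exp n (\<lambda>\<alpha>. iexp (s * ((log_lengths n \<alpha> - cyc_exp n (log_lengths n)) / std_dev n)))"
    by (simp add: cyc_exp_def cycle_sum_def card_perms del: One_nat_def)
  moreover have "(\<lambda>\<alpha>. iexp (s * ((log_lengths n \<alpha> - cyc_exp n (log_lengths n)) / std_dev n)))
      = (\<lambda>\<alpha>. cis (- t * cyc_exp n (log_lengths n)) * cycle_prod n (npow t) \<alpha>)"
  proof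
    fix \<alpha>
    have "s * ((log_lengths n \<alpha> - cyc_exp n (log_lengths n)) / std_dev n)
        = t * (log_lengths n \<alpha> - cyc_exp n (log_lengths n))"
      by (simp add: t_def std_dev_def)
    also have "\<dots> = - t * cyc_exp n (log_lengths n) + t * log_lengths n \<alpha>" by (simp add: algebra_simps)
    finally show "iexp (s * ((log_lengths n \<alpha> - cyc_exp n (log_lengths n)) / std_dev n))
        = cis (- t * cyc_exp n (log_lengths n)) * cycle_prod n (npow t) \<alpha>"
      by (simp only: prod cis_mult) (simp only: cis_conv_exp)
  qed
  moreover have "cyc_exp n (\<lambda>\<alpha>. cis (- t * cyc_exp n (log_lengths n)) * cycle_prod n (npow t) \<alpha>) = scaled_chf n s"
    by (simp add: cyc_exp_cmult cyc_exp_cycle_prod scaled_chf_def Let_def t_def[symmetric] perm_chf_def \<mu>)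
  ultimately show ?thesis by (simp only:)
qed

text \<open>The kernel width \<epsilon> = L^{-3/4} is the one built into
  \<open>scaled_chf_edge_approx\<close>, as \<epsilon>^2 = L^{-3/2}. With r = 2 ln L the tail
  exp(-r) is 1/L^2, and the shift costs 2 M \<epsilon> ln L.\<close>

lemma log_lengths_edgeworth:
  "\<exists>K\<ge>0. \<exists>M\<ge>0. eventually (\<lambda>n. edge_coeff n \<in> {0..1} \<and>
      (\<forall>x y. \<bar>edge_cdf (edge_coeff n) x - edge_cdf (edge_coeff n) y\<bar> \<le> M * \<bar>x - y\<bar>) \<and>
      (\<forall>x. \<bar>cyc_prob n (\<lambda>\<alpha>. (log_lengths n \<alpha> - cyc_exp n (log_lengths n)) / std_dev n < x) - edge_cdf (edge_coeff n) x\<bar>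
        \<le> K / ln (real n) + 1 / (ln (real n))\<^sup>2 + 2 * M * (ln (ln (real n)) * ln (real n) powr (- 3/4)))) at_top"
proof -
  obtain M where M: "M \<ge> 0" "\<And>\<kappa> x y. \<kappa> \<in> {0..1} \<Longrightarrow> \<bar>edge_cdf \<kappa> x - edge_cdf \<kappa> y\<bar> \<le> M * \<bar>x - y\<bar>"
    using edge_cdf_lipschitz by blast
  obtain C where C: "eventually (\<lambda>n. \<forall>s. norm (of_real (exp (- (s\<^sup>2 / (2 * ln (real n) powr (3/2))))) * scaled_chf n s - edge_chf n s)
      \<le> C / ln (real n) * (\<bar>s\<bar> / (1 + s\<^sup>2))) at_top" using scaled_chf_edge_approx by blast
  define I :: real where "I = (\<integral>s. 1 / (1 + s\<^sup>2) \<partial>lborel)"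
  have I: "I \<ge> 0" unfolding I_def by (intro Bochner_Integration.integral_nonneg) (simp add: add_nonneg_nonneg)
  define D where "D = max C 0"
  have ln_top: "filterlim (\<lambda>n. ln (real n)) at_top at_top" by real_asymp
  hence "eventually (\<lambda>n. ln (real n) \<ge> 3) at_top" by (simp add: filterlim_at_top)
  with C have "eventually (\<lambda>n. edge_coeff n \<in> {0..1} \<and>
      (\<forall>x y. \<bar>edge_cdf (edge_coeff n) x - edge_cdf (edge_coeff n) y\<bar> \<le> M * \<bar>x - y\<bar>) \<and>
      (\<forall>x. \<bar>cyc_prob n (\<lambda>\<alpha>. (log_lengths n \<alpha> - cyc_exp n (log_lengths n)) / std_dev n < x) - edge_cdf (edge_coeff n) x\<bar>
        \<le> (D * I) / ln (real n) + 1 / (ln (real n))\<^sup>2 + 2 * M * (ln (ln (real n)) * ln (real n) powr (- 3/4)))) at_top"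
  proof eventually_elim
    case (elim n)
    define L where "L = ln (real n)"
    have L: "L \<ge> 3" using elim by (simp add: L_def)
    have L0: "L > 0" using L by simp
    have \<kappa>: "edge_coeff n \<in> {0..1}" using edge_coeff_bounds[of n] L by (simp add: L_def)
    define \<epsilon> where "\<epsilon> = L powr (- 3/4)"
    have e0: "\<epsilon> > 0" using L0 by (simp add: \<epsilon>_def)
    have e2: "\<epsilon>\<^sup>2 = 1 / L powr (3/2)"
    proof -
      have "\<epsilon>\<^sup>2 = L powr (- 3/2)" using L0 by (simp add: \<epsilon>_def powr_powr flip: powr_realpow)
      also have "\<dots> = inverse (L powr (3/2))" by (simp add: powr_minus flip: minus_divide_left)
      finally show ?thesis by (simp add: inverse_eq_divide)
    qed
    define X where "X \<sigma> = (log_lengths n (cycles_in {1..n} \<sigma>) - cyc_exp n (log_lengths n)) / std_dev n" for \<sigma>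
    let ?A = "{\<sigma>. \<sigma> permutes {1..n}}"
    have approx: "norm (of_real (exp (- \<epsilon>\<^sup>2 * s\<^sup>2 / 2)) * ((\<Sum>\<sigma>\<in>?A. iexp (s * X \<sigma>)) / of_nat (card ?A))
        - of_real (exp (- s\<^sup>2 / 2)) * (1 - \<i> * of_real (edge_coeff n * s ^ 3))) \<le> D / L * (\<bar>s\<bar> / (1 + s\<^sup>2))" for s
    proof -
      have ch: "(\<Sum>\<sigma>\<in>?A. iexp (s * X \<sigma>)) / of_nat (card ?A) = scaled_chf n s"
        unfolding X_def using L0 by (intro scaled_chf_eq_average) (simp add: L_def)
      have ex: "- \<epsilon>\<^sup>2 * s\<^sup>2 / 2 = - (s\<^sup>2 / (2 * L powr (3/2)))" unfolding e2 by simp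
      have "norm (of_real (exp (- (s\<^sup>2 / (2 * L powr (3/2))))) * scaled_chf n s - edge_chf n s) \<le> C / L * (\<bar>s\<bar> / (1 + s\<^sup>2))"
        using elim(1) by (simp only: L_def)
      also have "\<dots> \<le> D / L * (\<bar>s\<bar> / (1 + s\<^sup>2))"
        using L0 by (intro mult_right_mono divide_right_mono) (auto simp: D_def add_nonneg_nonneg)
      finally show ?thesis unfolding ch ex edge_chf_def .
    qed
    have "\<bar>cyc_prob n (\<lambda>\<alpha>. (log_lengths n \<alpha> - cyc_exp n (log_lengths n)) / std_dev n < x) - edge_cdf (edge_coeff n) x\<bar>
        \<le> (D * I) / L + 1 / L\<^sup>2 + 2 * M * (ln L * L powr (- 3/4))" for x
    proof -
      have "\<bar>real (card {\<sigma>\<in>?A. X \<sigma> < x}) / real (card ?A) - edge_cdf (edge_coeff n) x\<bar>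
          \<le> D / L * (\<integral>s. 1 / (1 + s\<^sup>2) \<partial>lborel) + exp (- (2 * ln L)) + M * (\<epsilon> * (2 * ln L))"
        by (rule esseen_edge[OF perms_finite_nonempty e0 _ _ \<kappa> approx M(2)[OF \<kappa>]])
           (use L0 L in \<open>auto simp: D_def\<close>)
      moreover have "exp (- (2 * ln L)) = 1 / L\<^sup>2"
      proof -
        have "exp (2 * ln L) = exp (ln L) * exp (ln L)" by (simp flip: exp_add)
        thus ?thesis using L0 by (simp add: exp_minus power2_eq_square inverse_eq_divide)
      qed
      ultimately show ?thesis unfolding cyc_prob_card X_def I_def \<epsilon>_def by (simp add: mult_ac)
    qed
    thus ?case using \<kappa> M(2) unfolding L_def by blast
  qed
  moreover have "D * I \<ge> 0" using I by (simp add: D_def)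
  ultimately show ?thesis using M(1) by blast
qed

text \<open>Outside an event of probability O(\<eta>) the defect is within \<eta> standard
  deviations of its mean. There the standardized log O_n and log P_n differ by at most \<eta>, so
  one distribution function lies between shifts of the other, and the Lipschitz bound absorbs the
  shift.\<close>

theorem theorem3:
  shows "(\<lambda>n::nat. SUP x::real.
            \<bar>measure_pmf.prob (unif_perm n)
                {\<sigma>. (log_order n \<sigma> - measure_pmf.expectation (unif_perm n) (log_order n))
                      / (1 / sqrt 3 * ln (real n) powr (3/2)) < x}
              - std_normal_cdf x
              - 3 powr (3/2) / (24 * sqrt (2 * pi))
                  * ((1 - x\<^sup>2) * exp (- x\<^sup>2 / 2) / sqrt (ln (real n)))\<bar>)
         \<in> O(\<lambda>n. (ln (ln (real n)) / ln (real n)) powr (2/3))"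
proof -
  obtain K M where KM: "K \<ge> 0" "M \<ge> 0" and ev: "eventually (\<lambda>n. edge_coeff n \<in> {0..1} \<and>
      (\<forall>x y. \<bar>edge_cdf (edge_coeff n) x - edge_cdf (edge_coeff n) y\<bar> \<le> M * \<bar>x - y\<bar>) \<and>
      (\<forall>x. \<bar>cyc_prob n (\<lambda>\<alpha>. (log_lengths n \<alpha> - cyc_exp n (log_lengths n)) / std_dev n < x) - edge_cdf (edge_coeff n) x\<bar>
        \<le> K / ln (real n) + 1 / (ln (real n))\<^sup>2 + 2 * M * (ln (ln (real n)) * ln (real n) powr (- 3/4)))) at_top"
    using log_lengths_edgeworth by blast
  let ?f = "\<lambda>n x. \<bar>measure_pmf.prob (unif_perm n)
                {\<sigma>. (log_order n \<sigma> - measure_pmf.expectation (unif_perm n) (log_order n))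
                      / (1 / sqrt 3 * ln (real n) powr (3/2)) < x}
              - std_normal_cdf x
              - 3 powr (3/2) / (24 * sqrt (2 * pi))
                  * ((1 - x\<^sup>2) * exp (- x\<^sup>2 / 2) / sqrt (ln (real n)))\<bar>"
  define \<eta> where "\<eta> L = (ln L / L) powr (2/3)" for L :: real
  define G where "G = K + 1 + 2 * M + M + 192 * 48 * 2 + 8"
  \<comment> \<open>Since (ln L/L)^2 = \<eta>^3, the left side of the fourth inequality is (1 + 1/L)
    \<eta>. It comes from Chebyshev's bound and fixes the exponent 2/3; the first three hold with
    room to spare.\<close>
  define P where "P L \<longleftrightarrow> 1 / L \<le> \<eta> L \<and> 1 / L\<^sup>2 \<le> \<eta> L \<and> ln L * L powr (- 3/4) \<le> \<eta> L \<and>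
      (1 + L) * (ln L)\<^sup>2 / ((\<eta> L)\<^sup>2 * L ^ 3) \<le> 2 * \<eta> L \<and> 1 / (\<eta> L * L powr (3/2)) \<le> \<eta> L \<and>
      ln ((1 + L) ^ 3 + 1) \<le> 4 * ln L \<and> (1 + L) ^ 3 + 1 \<le> exp L \<and> L \<ge> 3" for L
  have ln_top: "filterlim (\<lambda>n. ln (real n)) at_top at_top" by real_asymp
  have "eventually (\<lambda>L. 1 / L \<le> \<eta> L) at_top" "eventually (\<lambda>L. 1 / L\<^sup>2 \<le> \<eta> L) at_top"
    "eventually (\<lambda>L. ln L * L powr (- 3/4) \<le> \<eta> L) at_top"
    "eventually (\<lambda>L. (1 + L) * (ln L)\<^sup>2 / ((\<eta> L)\<^sup>2 * L ^ 3) \<le> 2 * \<eta> L) at_top"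
    "eventually (\<lambda>L. 1 / (\<eta> L * L powr (3/2)) \<le> \<eta> L) at_top"
    unfolding \<eta>_def by real_asymp+
  moreover have "eventually (\<lambda>L::real. ln ((1 + L) ^ 3 + 1) \<le> 4 * ln L) at_top"
    "eventually (\<lambda>L::real. (1 + L) ^ 3 + 1 \<le> exp L) at_top" "eventually (\<lambda>L::real. L \<ge> 3) at_top"
    by real_asymp+
  ultimately have "eventually P at_top"
    unfolding P_def by (intro eventually_conj)
  hence asym: "eventually (\<lambda>n. P (ln (real n))) at_top"
    using ln_top by (rule eventually_compose_filterlim)
  have "eventually (\<lambda>n. \<forall>x. ?f n x \<le> G * \<eta> (ln (real n))) at_top"
    using ev asym eventually_ge_at_top[of 1]
  proof eventually_elim
    case (elim n)
    define L where "L = ln (real n)"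
    have a: "1 / L \<le> \<eta> L" "1 / L\<^sup>2 \<le> \<eta> L" "ln L * L powr (- 3/4) \<le> \<eta> L"
      "(1 + L) * (ln L)\<^sup>2 / ((\<eta> L)\<^sup>2 * L ^ 3) \<le> 2 * \<eta> L" "1 / (\<eta> L * L powr (3/2)) \<le> \<eta> L"
      "ln ((1 + L) ^ 3 + 1) \<le> 4 * ln L" "(1 + L) ^ 3 + 1 \<le> exp L" "L \<ge> 3"
      using elim(2) unfolding L_def[symmetric] P_def by simp_all
    have L0: "L > 0" using a(8) by simp
    have eta: "\<eta> L > 0" using a(8) by (simp add: \<eta>_def)
    define \<kappa> where "\<kappa> = edge_coeff n"
    let ?def = "\<lambda>\<alpha>. order_defect n \<alpha> - cyc_exp n (order_defect n)"
    let ?X = "\<lambda>\<alpha>. (log_lengths n \<alpha> - cyc_exp n (log_lengths n)) / std_dev n"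
    let ?O = "\<lambda>\<alpha>. ln (real (order_of_vec n \<alpha>))"
    have sd: "std_dev n > 0" using L0 by (simp add: std_dev_def L_def)
    define y where "y = \<eta> L * std_dev n"
    have y0: "y > 0" using eta sd by (simp add: y_def)
    define \<rho> where "\<rho> = cyc_prob n (\<lambda>\<alpha>. \<bar>?def \<alpha>\<bar> > y)"
    have \<rho>: "\<rho> \<le> 192 * 48 * (2 * \<eta> L) + 8 * \<eta> L"
    proof -
      \<comment> \<open>The smallest choice for which the mean of the remainder is at most 1; ln Q
        remains of order ln L.\<close>
      define Q where "Q = nat \<lceil>(1 + L) ^ 3\<rceil>"
      have p1: "(1 + L) ^ 3 \<ge> 1" using L0 by (simp add: one_le_power)
      have Q1: "(1 + L) ^ 3 \<le> real Q" unfolding Q_def by (rule real_nat_ceiling_ge)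
      have Q2: "real Q \<le> (1 + L) ^ 3 + 1"
      proof -
        have "0 \<le> \<lceil>(1 + L) ^ 3\<rceil>" using p1 by (simp add: zero_le_ceiling)
        hence "real Q = of_int \<lceil>(1 + L) ^ 3\<rceil>" unfolding Q_def by (rule of_nat_nat)
        thus ?thesis using of_int_ceiling_le_add_one[of "(1 + L) ^ 3"] by simp
      qed
      have Q3: "Q \<ge> 1" using Q1 p1 by linarith
      have "real Q \<le> real n" using Q2 a(7) elim(3) by (simp add: L_def)
      hence Q4: "Q \<le> n" by simp
      have lQ: "0 \<le> ln (real Q)" "ln (real Q) \<le> 4 * ln L"
      proof -
        show "0 \<le> ln (real Q)" using Q3 by simp
        have "ln (real Q) \<le> ln ((1 + L) ^ 3 + 1)" using Q2 Q3 by (intro ln_mono) auto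
        thus "ln (real Q) \<le> 4 * ln L" using a(6) by linarith
      qed
      have "\<rho> \<le> 192 * (1 + L) * (ln (real Q))\<^sup>2 / y\<^sup>2 + 4 / y"
        unfolding \<rho>_def L_def by (rule order_defect_concentration) (use elim(3) Q3 Q4 Q1 y0 in \<open>auto simp: L_def\<close>)
      also have "\<dots> \<le> 192 * (1 + L) * (4 * ln L)\<^sup>2 / y\<^sup>2 + 4 / y"
      proof -
        have "(ln (real Q))\<^sup>2 \<le> (4 * ln L)\<^sup>2" using lQ by (intro power_mono)
        hence "192 * (1 + L) * (ln (real Q))\<^sup>2 \<le> 192 * (1 + L) * (4 * ln L)\<^sup>2"
          using L0 by (intro mult_left_mono) simp_all
        hence "192 * (1 + L) * (ln (real Q))\<^sup>2 / y\<^sup>2 \<le> 192 * (1 + L) * (4 * ln L)\<^sup>2 / y\<^sup>2"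
          by (rule divide_right_mono) (rule zero_le_power2)
        thus ?thesis by (rule add_right_mono)
      qed
      \<comment> \<open>48 = 16 * 3: the square of 4 ln L, and the 3 from the square of the standard
        deviation, L^3/3.\<close>
      also have "192 * (1 + L) * (4 * ln L)\<^sup>2 / y\<^sup>2 = 192 * 48 * ((1 + L) * (ln L)\<^sup>2 / ((\<eta> L)\<^sup>2 * L ^ 3))"
      proof -
        have "(L powr (3/2))\<^sup>2 = L powr (3/2 + 3/2)" by (simp only: power2_eq_square powr_add)
        also have "\<dots> = L powr 3" by simp
        also have "L powr 3 = L ^ 3" using L0 by (simp add: powr_numeral)
        finally have l: "(L powr (3/2))\<^sup>2 = L ^ 3" .
        have "y\<^sup>2 = (\<eta> L)\<^sup>2 * ((1 / sqrt 3)\<^sup>2 * (L powr (3/2))\<^sup>2)"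
          unfolding y_def std_dev_def L_def[symmetric] by (simp only: power_mult_distrib)
        also have "(1 / sqrt 3)\<^sup>2 = 1 / (3 :: real)" by (simp add: power_divide)
        finally have "y\<^sup>2 = ((\<eta> L)\<^sup>2 * L ^ 3) / 3" unfolding l by simp
        moreover have "(4 * ln L)\<^sup>2 = 16 * (ln L)\<^sup>2" by (simp add: power_mult_distrib)
        moreover have "192 * (1 + L) * (16 * u) / (v / 3) = 192 * 48 * ((1 + L) * u / v)" for u v :: real
          by simp
        ultimately show ?thesis by (simp only:)
      qed
      also have "\<dots> \<le> 192 * 48 * (2 * \<eta> L)" using a(4) by (intro mult_left_mono) auto
      also have "4 / y = 4 * sqrt 3 * (1 / (\<eta> L * L powr (3/2)))"
        by (simp add: y_def std_dev_def L_def)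
      also have "\<dots> \<le> 4 * 2 * \<eta> L"
        using a(5) sqrt3_le eta L0 by (intro mult_mono) auto
      finally show ?thesis by simp
    qed
    have T: "\<bar>cyc_prob n (\<lambda>\<alpha>. ?X \<alpha> < x) - edge_cdf \<kappa> x\<bar> \<le> (K + 1 + 2 * M) * \<eta> L" for x
    proof -
      have "\<bar>cyc_prob n (\<lambda>\<alpha>. ?X \<alpha> < x) - edge_cdf \<kappa> x\<bar> \<le> K / L + 1 / L\<^sup>2 + 2 * M * (ln L * L powr (- 3/4))"
        using elim(1) unfolding \<kappa>_def L_def by blast
      also have "K / L = K * (1 / L)" by simp
      also have "K * (1 / L) + 1 / L\<^sup>2 + 2 * M * (ln L * L powr (- 3/4)) \<le> K * \<eta> L + \<eta> L + 2 * M * \<eta> L"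
        using a KM by (intro add_mono mult_left_mono) auto
      finally show ?thesis by (simp add: algebra_simps)
    qed
    show ?case
    proof
      fix x
      let ?W = "\<lambda>\<alpha>. (?O \<alpha> - cyc_exp n ?O) / std_dev n < x"
      have O: "?O \<alpha> - cyc_exp n ?O = (log_lengths n \<alpha> - cyc_exp n (log_lengths n)) - ?def \<alpha>" for \<alpha>
      proof -
        have "?O = (\<lambda>\<alpha>. log_lengths n \<alpha> - order_defect n \<alpha>)" by (simp add: order_defect_def)
        hence "cyc_exp n ?O = cyc_exp n (log_lengths n) - cyc_exp n (order_defect n)"
          by (simp add: cyc_exp_diff)
        thus ?thesis by (simp add: order_defect_def)
      qed
      have near: "\<bar>(?O \<alpha> - cyc_exp n ?O) / std_dev n - ?X \<alpha>\<bar> \<le> \<eta> L" if "\<not> \<bar>?def \<alpha>\<bar> > y" for \<alpha>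
      proof -
        have "\<bar>(?O \<alpha> - cyc_exp n ?O) / std_dev n - ?X \<alpha>\<bar> = \<bar>?def \<alpha>\<bar> / std_dev n"
          unfolding O diff_divide_distrib[of _ "?def \<alpha>"] using sd by simp
        also have "\<dots> \<le> y / std_dev n" using that sd by (intro divide_right_mono) auto
        also have "\<dots> = \<eta> L" using sd by (simp add: y_def)
        finally show ?thesis .
      qed
      have up: "cyc_prob n ?W \<le> cyc_prob n (\<lambda>\<alpha>. ?X \<alpha> < x + \<eta> L) + \<rho>"
      proof -
        have "cyc_prob n ?W \<le> cyc_prob n (\<lambda>\<alpha>. ?X \<alpha> < x + \<eta> L \<or> \<bar>?def \<alpha>\<bar> > y)"
        proof (rule cyc_prob_mono)
          fix \<alpha> assume w: "?W \<alpha>"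
          show "?X \<alpha> < x + \<eta> L \<or> \<bar>?def \<alpha>\<bar> > y"
          proof (cases "\<bar>?def \<alpha>\<bar> > y")
            case False
            show ?thesis using near[OF False] w by linarith
          qed simp
        qed
        thus ?thesis using cyc_prob_disj[of n "\<lambda>\<alpha>. ?X \<alpha> < x + \<eta> L" "\<lambda>\<alpha>. \<bar>?def \<alpha>\<bar> > y"] unfolding \<rho>_def by linarith
      qed
      have lo: "cyc_prob n (\<lambda>\<alpha>. ?X \<alpha> < x - \<eta> L) \<le> cyc_prob n ?W + \<rho>"
      proof -
        have "cyc_prob n (\<lambda>\<alpha>. ?X \<alpha> < x - \<eta> L) \<le> cyc_prob n (\<lambda>\<alpha>. ?W \<alpha> \<or> \<bar>?def \<alpha>\<bar> > y)"
        proof (rule cyc_prob_mono)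
          fix \<alpha> assume w: "?X \<alpha> < x - \<eta> L"
          show "?W \<alpha> \<or> \<bar>?def \<alpha>\<bar> > y"
          proof (cases "\<bar>?def \<alpha>\<bar> > y")
            case False
            show ?thesis using near[OF False] w by linarith
          qed simp
        qed
        thus ?thesis using cyc_prob_disj[of n ?W "\<lambda>\<alpha>. \<bar>?def \<alpha>\<bar> > y"] unfolding \<rho>_def by linarith
      qed
      have lip: "\<bar>edge_cdf \<kappa> (x + \<eta> L) - edge_cdf \<kappa> x\<bar> \<le> M * \<eta> L" "\<bar>edge_cdf \<kappa> (x - \<eta> L) - edge_cdf \<kappa> x\<bar> \<le> M * \<eta> L"
      proof -
        have l: "\<bar>edge_cdf \<kappa> u - edge_cdf \<kappa> v\<bar> \<le> M * \<bar>u - v\<bar>" for u v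
          using elim(1) unfolding \<kappa>_def by blast
        show "\<bar>edge_cdf \<kappa> (x + \<eta> L) - edge_cdf \<kappa> x\<bar> \<le> M * \<eta> L" "\<bar>edge_cdf \<kappa> (x - \<eta> L) - edge_cdf \<kappa> x\<bar> \<le> M * \<eta> L"
          using l[of "x + \<eta> L" x] l[of "x - \<eta> L" x] eta by simp_all
      qed
      have "\<bar>cyc_prob n ?W - edge_cdf \<kappa> x\<bar> \<le> (K + 1 + 2 * M) * \<eta> L + M * \<eta> L + \<rho>"
        using up lo lip T[of "x + \<eta> L"] T[of "x - \<eta> L"] by linarith
      also have "\<dots> \<le> (K + 1 + 2 * M) * \<eta> L + M * \<eta> L + (192 * 48 * (2 * \<eta> L) + 8 * \<eta> L)"
        using \<rho> by (intro add_left_mono)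
      also have "\<dots> = G * \<eta> L" by (simp add: G_def algebra_simps)
      finally have main: "\<bar>cyc_prob n ?W - edge_cdf \<kappa> x\<bar> \<le> G * \<eta> L" .
      have "measure_pmf.prob (unif_perm n)
                {\<sigma>. (log_order n \<sigma> - measure_pmf.expectation (unif_perm n) (log_order n))
                      / (1 / sqrt 3 * ln (real n) powr (3/2)) < x} = cyc_prob n ?W"
        unfolding expectation_unif_perm[of n ?O] std_dev_def[symmetric] by (rule prob_unif_perm)
      moreover have "edge_cdf \<kappa> x = std_normal_cdf x + 3 powr (3/2) / (24 * sqrt (2 * pi))
                  * ((1 - x\<^sup>2) * exp (- x\<^sup>2 / 2) / sqrt (ln (real n)))"
        by (simp add: edge_cdf_def \<kappa>_def edge_coeff_def)
      ultimately have "?f n x = \<bar>cyc_prob n ?W - edge_cdf \<kappa> x\<bar>" by (simp only: diff_diff_eq)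
      thus "?f n x \<le> G * \<eta> (ln (real n))" using main by (simp only: L_def)
    qed
  qed
  hence "eventually (\<lambda>n. norm (SUP x. ?f n x) \<le> G * norm ((ln (ln (real n)) / ln (real n)) powr (2/3))) at_top"
  proof eventually_elim
    case (elim n)
    have "(SUP x. ?f n x) \<le> G * \<eta> (ln (real n))"
      by (rule cSUP_least) (use elim in auto)
    moreover have "0 \<le> (SUP x. ?f n x)"
    proof -
      \<comment> \<open>Boundedness makes the supremum an upper bound of its range, hence
        nonnegative, and the norm in the O-estimate can be removed.\<close>
      have bdd: "bdd_above (range (?f n))" by (rule bdd_above_edgeworth_deviation)
      have "0 \<le> ?f n 0" by (rule abs_ge_zero)
      also have "\<dots> \<le> (SUP x. ?f n x)"
        by (rule cSUP_upper[OF UNIV_I bdd])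
      finally show ?thesis .
    qed
    ultimately show ?case by (simp add: \<eta>_def)
  qed
  thus ?thesis by (rule bigoI)
qed

end
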